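(* Let $1\le k<d$ be integers and $\theta\in(0,1]$. (i) If $\mu\in\mathcal M(\mathbb{R}^d)$, then for all $u\ge0$, $$\dim_{\mathrm H}\{V\in G(d,k):\dim_{\mathrm F}^{\theta}\mu_V<u\}\le\max\Big\{0,\ k(d-k)+\frac{u-\dim_{\mathrm F}^{\theta}\mu}{\theta}\Big\}.$$ (ii) If $X$ is a Borel set in $\mathbb{R}^d$, then for all $u\in[0,k]$, $$\dim_{\mathrm H}\{V\in G(d,k):\dim_{\mathrm F}^{\theta}P_V(X)<u\}\le\max\Big\{0,\ k(d-k)+\frac{u-\dim_{\mathrm F}^{\theta}X}{\theta}\Big\}.$$
   Context: $G(d,k)$ is the Grassmannian of $k$-dimensional linear subspaces $V$ of $\mathbb{R}^d$, with its usual metric (e.g. $\|P_V-P_W\|$), with respect to which Hausdorff dimensions of its subsets are taken. $P_V:\mathbb{R}^d\to V$ is orthogonal projection, and $V$ is identified with $\mathbb{R}^k$. $\mu_V$ is the push-forward of $\mu$ under $P_V$, i.e. $\mu_V(B)=\mu(P_V^{-1}(B))$, a measure on $\mathbb{R}^k$. $\dim_{\mathrm H}$ is Hausdorff dimension, with $\dim_{\mathrm H}\varnothing=0$. For $X\subseteq\mathbb{R}^d$, $\mathcal M(X)$ is the set of Borel measures $\mu$ compactly supported on $X$ with $0<\mu(X)<\infty$. The Fourier transform is $\widehat\mu(z)=\int e^{-2\pi i z\cdot x}\,d\mu(x)$. For $\mu\in\mathcal M(\mathbb{R}^d)$ and $\theta\in(0,1]$ put $$\mathcal J_{s,\theta}(\mu)=\Big(\int_{\mathbb{R}^d}|\widehat\mu(z)|^{2/\theta}|z|^{s/\theta-d}\,dz\Big)^{\theta}.$$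 The Fourier spectrum of $\mu$ at $\theta$ is $\dim_{\mathrm F}^{\theta}\mu=\sup\{s\in\mathbb{R}:\mathcal J_{s,\theta}(\mu)<\infty\}$ (possibly $+\infty$), and of a set $X\subseteq\mathbb{R}^d$ it is $\dim_{\mathrm F}^{\theta}X=\sup\{\min\{\dim_{\mathrm F}^{\theta}\mu,d\}:\mu\in\mathcal M(X)\}$ (suprema over empty sets are $0$). For $\mu_V$ and $P_V(X)$ these definitions are used in $\mathbb{R}^k$, i.e. with $d$ replaced by $k$. *)

theory Defs
  imports "HOL-Analysis.Analysis"
begin

section \<open>Hausdorff measure and dimension in a metric space\<close>

text \<open>The value \<open>|U|\<^sup>s\<close>; the case distinction is needed since \<open>0 powr 0 = 0\<close> in HOL,
  whereas the zero-dimensional Hausdorff measure has to be counting measure.\<close>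

definition diam_power :: "real \<Rightarrow> 'a::metric_space set \<Rightarrow> ennreal" where
  "diam_power s U =
     (if U = {} then 0 else if s = 0 then 1 else ennreal (diameter U powr s))"

text \<open>Covers consist of bounded sets because \<^term>\<open>diameter\<close> is only meaningful for those.
  Finite covers are included, since some \<open>U i\<close> may be empty.\<close>

definition hausdorff_content :: "real \<Rightarrow> real \<Rightarrow> 'a::metric_space set \<Rightarrow> ennreal" where
  "hausdorff_content s \<delta> A =
     (INF U \<in> {U :: nat \<Rightarrow> 'a set.
                 A \<subseteq> (\<Union>i. U i) \<and> (\<forall>i. bounded (U i) \<and> diameter (U i) \<le> \<delta>)}.
        \<Sum>i. diam_power s (U i))"

definition hausdorff_measure :: "real \<Rightarrow> 'a::metric_space set \<Rightarrow> ennreal" where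
  "hausdorff_measure s A = (SUP \<delta> \<in> {0<..}. hausdorff_content s \<delta> A)"

definition hausdorff_dim :: "'a::metric_space set \<Rightarrow> ereal" where
  "hausdorff_dim A = Inf {ereal s |s. 0 \<le> s \<and> hausdorff_measure s A = 0}"

lemma hausdorff_dim_empty: "hausdorff_dim ({} :: 'a::metric_space set) = 0"
proof -
  have "hausdorff_measure s ({} :: 'a set) = 0" for s
  proof -
    have "hausdorff_content s \<delta> ({} :: 'a set) \<le> 0" if "\<delta> > 0" for \<delta>
      unfolding hausdorff_content_def
      by (rule INF_lower2[where i = "\<lambda>_. {}"]) (use that in \<open>auto simp: diam_power_def\<close>)
    then show ?thesis
      unfolding hausdorff_measure_def by (auto intro!: antisym SUP_least)
  qed
  then have "hausdorff_dim ({} :: 'a set) = Inf {ereal s |s. 0 \<le> s}"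
    by (simp add: hausdorff_dim_def)
  also have "\<dots> = 0"
    by (rule antisym) (auto intro!: Inf_lower Inf_greatest exI[of _ 0] simp: zero_ereal_def)
  finally show ?thesis .
qed


section \<open>The Grassmannian and orthogonal projections\<close>

definition grassmannian :: "nat \<Rightarrow> 'a::euclidean_space set set" where
  "grassmannian k = {V. subspace V \<and> dim V = k}"

definition orth_proj :: "'a::euclidean_space set \<Rightarrow> 'a \<Rightarrow> 'a" where
  "orth_proj V x = (THE y. y \<in> V \<and> (\<forall>v\<in>V. orthogonal (x - y) v))"

lemma orth_proj_unique:
  assumes "subspace V" "y \<in> V" "\<And>v. v \<in> V \<Longrightarrow> orthogonal (x - y) v"
  shows "orth_proj V x = y"
  unfolding orth_proj_def
proof (rule the_equality)
  fix y' assume y': "y' \<in> V \<and> (\<forall>v\<in>V. orthogonal (x - y') v)"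
  have "y - y' \<in> V" using assms y' by (simp add: subspace_diff)
  then have "(x - y') \<bullet> (y - y') = 0" "(x - y) \<bullet> (y - y') = 0"
    using assms y' by (auto simp: orthogonal_def)
  then have "(y - y') \<bullet> (y - y') = 0" by (simp add: inner_diff_left)
  then show "y' = y" by simp
qed (use assms in auto)

lemma orth_proj_props:
  assumes "subspace V"
  shows "orth_proj V x \<in> V" "v \<in> V \<Longrightarrow> orthogonal (x - orth_proj V x) v"
proof -
  obtain y z where "y \<in> span V" "\<And>w. w \<in> span V \<Longrightarrow> orthogonal z w" "x = y + z"
    using orthogonal_subspace_decomp_exists by metis
  then have "y \<in> V" "\<And>v. v \<in> V \<Longrightarrow> orthogonal (x - y) v"
    using assms by (auto simp: span_eq_iff[THEN iffD2])
  with orth_proj_unique[OF assms this]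
  show "orth_proj V x \<in> V" "v \<in> V \<Longrightarrow> orthogonal (x - orth_proj V x) v" by auto
qed

lemma bounded_linear_orth_proj:
  assumes "subspace V"
  shows "bounded_linear (orth_proj V)"
proof -
  note p = orth_proj_props[OF assms]
  have "linear (orth_proj V)"
  proof
    fix x y show "orth_proj V (x + y) = orth_proj V x + orth_proj V y"
    proof (rule orth_proj_unique[OF assms])
      fix v assume "v \<in> V"
      then show "orthogonal (x + y - (orth_proj V x + orth_proj V y)) v"
        using p(2)[of v x] p(2)[of v y] by (simp add: orthogonal_def inner_diff_left inner_add_left)
    qed (use p assms in \<open>auto intro: subspace_add\<close>)
  next
    fix c x show "orth_proj V (c *\<^sub>R x) = c *\<^sub>R orth_proj V x"
    proof (rule orth_proj_unique[OF assms])
      fix v assume "v \<in> V"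
      then show "orthogonal (c *\<^sub>R x - c *\<^sub>R orth_proj V x) v"
        using p(2)[of v x] by (simp add: orthogonal_def inner_diff_left)
    qed (use p assms in \<open>auto intro: subspace_scale\<close>)
  qed
  then show ?thesis by (simp add: linear_conv_bounded_linear)
qed

text \<open>The Grassmannian carries the metric \<open>\<parallel>P\<^sub>V - P\<^sub>W\<parallel>\<close>: a set of subspaces is viewed in the
  normed space of bounded operators by identifying \<open>V\<close> with \<open>P\<^sub>V\<close>.\<close>

definition proj_op :: "'a::euclidean_space set \<Rightarrow> 'a \<Rightarrow>\<^sub>L 'a" where
  "proj_op V = Blinfun (orth_proj V)"

lemma dist_proj_op:
  assumes "subspace V" "subspace W"
  shows "dist (proj_op V) (proj_op W) = onorm (\<lambda>x. orth_proj V x - orth_proj W x)"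
  using assms unfolding dist_norm proj_op_def norm_blinfun.rep_eq minus_blinfun.rep_eq
  by (simp add: bounded_linear_Blinfun_apply bounded_linear_orth_proj)

definition grassmannian_dim :: "'a::euclidean_space set set \<Rightarrow> ereal" where
  "grassmannian_dim S = hausdorff_dim (proj_op ` S)"

text \<open>An identification of \<open>V\<close> with a Euclidean space, given by a linear isometry onto \<open>V\<close>.\<close>

definition isometric_coords :: "('b::euclidean_space \<Rightarrow> 'a::euclidean_space) \<Rightarrow> 'a set \<Rightarrow> bool" where
  "isometric_coords f V \<longleftrightarrow> linear f \<and> (\<forall>x. norm (f x) = norm x) \<and> range f = V"

lemma isometric_coords_exist:
  assumes "V \<in> grassmannian (DIM('b))"
  shows "\<exists>f :: 'b::euclidean_space \<Rightarrow> 'a::euclidean_space. isometric_coords f V"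
proof -
  have "subspace V" "dim V = DIM('b)" using assms by (auto simp: grassmannian_def)
  then obtain f :: "'b \<Rightarrow> 'a" where "linear f" "f ` UNIV = V" "\<And>x. x \<in> UNIV \<Longrightarrow> norm (f x) = norm x"
    using isometry_subspaces[of "UNIV :: 'b set" V] by auto
  then show ?thesis unfolding isometric_coords_def by blast
qed

text \<open>The projection \<open>P\<^sub>V\<close> with \<open>V\<close> identified with a Euclidean space via \<open>f\<close>.\<close>

definition coord_proj ::
    "('b::euclidean_space \<Rightarrow> 'a::euclidean_space) \<Rightarrow> 'a set \<Rightarrow> 'a \<Rightarrow> 'b" where
  "coord_proj f V x = inv f (orth_proj V x)"


section \<open>Fourier spectrum\<close>

definition msupport :: "'a::topological_space measure \<Rightarrow> 'a set" where
  "msupport \<mu> = {x. \<forall>U. open U \<longrightarrow> x \<in> U \<longrightarrow> 0 < emeasure \<mu> U}"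

text \<open>The class \<open>\<M>(X)\<close>. The set \<open>X\<close> need not be Borel (it may be a projection of a Borel set),
  and \<^term>\<open>emeasure\<close> is \<open>0\<close> on non-measurable sets. As \<open>X\<close> contains the support, whose
  complement is null, \<open>\<mu>(X)\<close> is the total mass, so the latter is used.\<close>

definition compact_measures :: "'a::euclidean_space set \<Rightarrow> 'a measure set" where
  "compact_measures X = {\<mu>. sets \<mu> = sets borel \<and> compact (msupport \<mu>) \<and> msupport \<mu> \<subseteq> X \<and>
     0 < emeasure \<mu> UNIV \<and> emeasure \<mu> UNIV < \<infinity>}"

definition fourier_transform :: "'a::euclidean_space measure \<Rightarrow> 'a \<Rightarrow> complex" where
  "fourier_transform \<mu> z = (LINT x|\<mu>. exp (- (2 * pi * \<i> * complex_of_real (z \<bullet> x))))"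

definition ennreal_powr :: "ennreal \<Rightarrow> real \<Rightarrow> ennreal" where
  "ennreal_powr a p = (if a = \<infinity> then \<infinity> else ennreal (enn2real a powr p))"

definition J_energy :: "real \<Rightarrow> real \<Rightarrow> 'a::euclidean_space measure \<Rightarrow> ennreal" where
  "J_energy s \<theta> \<mu> =
     ennreal_powr
       (\<integral>\<^sup>+ z. ennreal (cmod (fourier_transform \<mu> z) powr (2 / \<theta>) *
                       norm z powr (s / \<theta> - real DIM('a))) \<partial>lborel) \<theta>"

text \<open>Supremum with the convention that it is \<open>0\<close> (rather than \<open>-\<infinity>\<close>) for the empty set.\<close>

definition Sup0 :: "ereal set \<Rightarrow> ereal" where
  "Sup0 A = (if A = {} then 0 else Sup A)"

definition fourier_spectrum_measure :: "real \<Rightarrow> 'a::euclidean_space measure \<Rightarrow> ereal" where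
  "fourier_spectrum_measure \<theta> \<mu> = Sup0 {ereal s |s. J_energy s \<theta> \<mu> < \<infinity>}"

definition fourier_spectrum_set :: "real \<Rightarrow> 'a::euclidean_space set \<Rightarrow> ereal" where
  "fourier_spectrum_set \<theta> X =
     Sup0 {min (fourier_spectrum_measure \<theta> \<mu>) (ereal (real DIM('a))) |\<mu>. \<mu> \<in> compact_measures X}"

end

theory Submission
  imports Defs
begin

text \<open>Let \<open>F\<close> be the modulus of the Fourier transform of \<open>\<mu>\<close> to the power \<open>2 / \<theta>\<close>, so that the energy
  of \<open>\<mu>\<^sub>V\<close> is a weighted integral of \<open>F\<close> over \<open>V\<close>. A countable union
  of charts writes \<open>V\<close> as the range of a matrix \<open>A\<close> whose rows contain the \<open>k\<close> unit vectors, the other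
  \<open>k (d - k)\<close> entries being free and bounded. No Frostman measure on the exceptional set is needed: if
  the integral over \<open>V\<close> diverges, then for infinitely many \<open>j\<close> its part over the shell of radius
  \<open>2\<^sup>j\<close> is at least \<open>2\<^sup>-\<^sup>\<epsilon>\<^sup>j\<close>, so it suffices to bound the number of cells of side \<open>2\<^sup>-\<^sup>j\<close> that contain
  such a matrix. Since \<open>\<mu>\<close> has compact support, \<open>F\<close> is dominated by its averages against rapidly
  decaying weights. Summed over one matrix per cell, these averages meet every point about
  \<open>2\<^sup>j\<^sup>(\<^sup>k\<^sup>-\<^sup>1\<^sup>)\<^sup>(\<^sup>d\<^sup>-\<^sup>k\<^sup>)\<close> times, as prescribing \<open>A y\<close> for one \<open>y\<close> of size \<open>2\<^sup>j\<close> up to a bounded error fixes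
  one entry in each free row. Hence the sum is controlled by the integral of \<open>F\<close> over the whole space.\<close>

section \<open>Null sets of Hausdorff measures\<close>

text \<open>Exponents: the energy of order u in dimension k has weight |y|^\<sigma> with \<sigma> =
  u/\<theta> - k; finite energy of order s in dimension d has weight |z|^a with a = s/\<theta> - d.
  Trading one for the other on the shell of radius 2^j costs 2^(j(\<sigma> - a)), the overlap costs
  2^(j(k-1)(d-k)), and \<sigma> - a + (k-1)(d-k) = k(d-k) + (u-s)/\<theta>. Weights in 1 + |.|
  replace those in |.|: for u > 0 the singularity at the origin is integrable in dimension k, so
  divergence can only come from infinity. This leaves u = 0, where the exceptional set is empty
  because spectra are nonnegative, and the case without any finite energy, where the spectrum is 0
  by convention and exponents a just below -d serve. Part (ii) follows by pushing forward nearly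
  optimal measures on X; u \<le> k is what lets the truncation at k be removed. The empty X carries
  no measure and has spectrum 0 by convention, so there a bound for the dimension of the whole
  Grassmannian is required; it comes out of the same counting, applied to a point mass.\<close>

lemma hausdorff_measure_zeroI:
  fixes A :: "'a::metric_space set"
  assumes "\<And>\<delta> \<eta>. \<delta> > 0 \<Longrightarrow> \<eta> > 0 \<Longrightarrow> \<exists>U :: nat \<Rightarrow> 'a set. A \<subseteq> (\<Union>i. U i) \<and>
    (\<forall>i. bounded (U i) \<and> diameter (U i) \<le> \<delta>) \<and> (\<Sum>i. diam_power s (U i)) \<le> ennreal \<eta>"
  shows "hausdorff_measure s A = 0"
proof -
  have "hausdorff_content s \<delta> A \<le> 0" if "\<delta> > 0" for \<delta>
  proof (rule ennreal_le_epsilon)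
    fix \<eta> :: real assume "0 < \<eta>"
    from assms[OF \<open>\<delta> > 0\<close> this] obtain U where U: "A \<subseteq> (\<Union>i. U i)"
      "\<forall>i. bounded (U i) \<and> diameter (U i) \<le> \<delta>" "(\<Sum>i. diam_power s (U i)) \<le> ennreal \<eta>" by blast
    have "hausdorff_content s \<delta> A \<le> (\<Sum>i. diam_power s (U i))"
      unfolding hausdorff_content_def by (rule INF_lower) (use U in auto)
    then show "hausdorff_content s \<delta> A \<le> 0 + ennreal \<eta>" using U by simp
  qed
  then show ?thesis unfolding hausdorff_measure_def by (auto intro!: antisym SUP_least)
qed

lemma hausdorff_measure_zeroD:
  fixes A :: "'a::metric_space set"
  assumes "hausdorff_measure s A = 0" "\<delta> > 0" "\<eta> > 0"
  shows "\<exists>U :: nat \<Rightarrow> 'a set. A \<subseteq> (\<Union>i. U i) \<and>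
    (\<forall>i. bounded (U i) \<and> diameter (U i) \<le> \<delta>) \<and> (\<Sum>i. diam_power s (U i)) \<le> ennreal \<eta>"
proof -
  have "hausdorff_content s \<delta> A \<le> hausdorff_measure s A"
    unfolding hausdorff_measure_def by (rule SUP_upper) (use assms in auto)
  then have "hausdorff_content s \<delta> A < ennreal \<eta>" using assms by simp
  then show ?thesis unfolding hausdorff_content_def INF_less_iff by (force intro: less_imp_le)
qed

lemma hausdorff_measure_zero_subset:
  assumes "hausdorff_measure s B = 0" "A \<subseteq> B"
  shows "hausdorff_measure s A = 0"
  using hausdorff_measure_zeroD[OF assms(1)] assms(2)
  by (intro hausdorff_measure_zeroI) (meson subset_trans)

lemma hausdorff_measure_zero_UN_nat:
  fixes A :: "nat \<Rightarrow> 'a::metric_space set"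
  assumes "\<And>n. hausdorff_measure s (A n) = 0"
  shows "hausdorff_measure s (\<Union>n. A n) = 0"
proof (rule hausdorff_measure_zeroI)
  fix \<delta> \<eta> :: real assume "\<delta> > 0" "\<eta> > 0"
  have "\<exists>U :: nat \<Rightarrow> 'a set. A n \<subseteq> (\<Union>i. U i) \<and> (\<forall>i. bounded (U i) \<and> diameter (U i) \<le> \<delta>) \<and>
      (\<Sum>i. diam_power s (U i)) \<le> ennreal (\<eta> * (1/2) ^ Suc n)" for n
    by (rule hausdorff_measure_zeroD) (use assms \<open>\<delta> > 0\<close> \<open>\<eta> > 0\<close> in auto)
  then obtain U :: "nat \<Rightarrow> nat \<Rightarrow> 'a set" where U: "\<And>n. A n \<subseteq> (\<Union>i. U n i)"
    "\<And>n i. bounded (U n i) \<and> diameter (U n i) \<le> \<delta>"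
    "\<And>n. (\<Sum>i. diam_power s (U n i)) \<le> ennreal (\<eta> * (1/2) ^ Suc n)" by metis
  define W where "W = (\<lambda>i. case prod_decode i of (n, i) \<Rightarrow> U n i)"
  have "(\<Sum>i. diam_power s (W i)) = (\<Sum>n. \<Sum>i. diam_power s (U n i))"
    using suminf_ennreal_2dimen[of "\<lambda>n. \<Sum>i. diam_power s (U n i)" "\<lambda>(n,i). diam_power s (U n i)"]
    by (simp add: W_def case_prod_beta)
  also have "\<dots> \<le> (\<Sum>n. ennreal (\<eta> * (1/2) ^ Suc n))"
    by (intro suminf_le U) auto
  also have "\<dots> = ennreal \<eta>"
  proof (rule suminf_ennreal_eq)
    show "(\<lambda>n. \<eta> * (1/2) ^ Suc n) sums \<eta>"
      using sums_mult[OF power_half_series, of \<eta>] by simp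
  qed (use \<open>\<eta> > 0\<close> in auto)
  finally have "(\<Sum>i. diam_power s (W i)) \<le> ennreal \<eta>" .
  moreover have "(\<Union>n. A n) \<subseteq> (\<Union>i. W i)"
  proof
    fix x assume "x \<in> (\<Union>n. A n)"
    then obtain n i where "x \<in> U n i" using U(1) by blast
    then have "x \<in> W (prod_encode (n, i))" by (simp add: W_def)
    then show "x \<in> (\<Union>i. W i)" by blast
  qed
  moreover have "bounded (W i) \<and> diameter (W i) \<le> \<delta>" for i
    using U(2) by (simp add: W_def case_prod_beta)
  ultimately show "\<exists>U. (\<Union>n. A n) \<subseteq> (\<Union>i. U i) \<and> (\<forall>i. bounded (U i) \<and> diameter (U i) \<le> \<delta>) \<and>
    (\<Sum>i. diam_power s (U i)) \<le> ennreal \<eta>" by blast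
qed

lemma hausdorff_measure_zero_UN:
  fixes A :: "'i \<Rightarrow> 'a::metric_space set"
  assumes "countable I" "\<And>i. i \<in> I \<Longrightarrow> hausdorff_measure s (A i) = 0"
  shows "hausdorff_measure s (\<Union>i\<in>I. A i) = 0"
proof (cases "I = {}")
  case True
  then show ?thesis
    using hausdorff_measure_zero_UN_nat[of s "\<lambda>_. {}"]
    by (auto intro!: hausdorff_measure_zeroI exI[of _ "\<lambda>_. {}"] simp: diam_power_def)
next
  case False
  then have "(\<Union>i\<in>I. A i) = (\<Union>n. A (from_nat_into I n))"
    using range_from_nat_into[OF False assms(1)] by (metis image_image)
  then show ?thesis
    using hausdorff_measure_zero_UN_nat[of s "\<lambda>n. A (from_nat_into I n)"] assms(2)
      from_nat_into[OF False] by simp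
qed

text \<open>Borel-Cantelli for covers: the sets of all generations \<open>j \<ge> J\<close> still
  cover \<open>E\<close>, and the \<open>t\<close>-sums of generation \<open>j\<close> are dominated
  by a convergent geometric series, so the tail from \<open>J\<close> on is as small as
  desired.\<close>

lemma hausdorff_measure_zero_limsup:
  fixes \<U> :: "nat \<Rightarrow> 'a::metric_space set set"
  assumes "t > 0" "\<epsilon> > 0" "c \<ge> 0" "K \<ge> 0"
    and fin: "\<And>j. finite (\<U> j)"
    and diam: "\<And>j U. U \<in> \<U> j \<Longrightarrow> bounded U \<and> diameter U \<le> c * 2 powr - real j"
    and card: "\<And>j. j \<ge> 1 \<Longrightarrow> real (card (\<U> j)) * 2 powr - (real j * t) \<le> K * 2 powr - (\<epsilon> * real j)"
    and cover: "\<And>x J. x \<in> E \<Longrightarrow> \<exists>j\<ge>J. x \<in> \<Union>(\<U> j)"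
  shows "hausdorff_measure t E = 0"
proof (rule hausdorff_measure_zeroI)
  fix \<delta> \<eta> :: real assume "\<delta> > 0" "\<eta> > 0"
  define q where "q = 2 powr - \<epsilon>"
  have q: "0 < q" "q < 1" using \<open>\<epsilon> > 0\<close> by (auto simp: q_def powr_minus_divide)
  have qj: "2 powr - (\<epsilon> * real j) = q ^ j" for j
    by (simp add: q_def powr_powr flip: powr_realpow)
  \<comment> \<open>\<open>L * q ^ J\<close> is the sum of \<open>c powr t * K * q ^ j\<close> over
    \<open>j \<ge> J\<close>, which bounds the whole cost of the cover starting at generation
    \<open>J\<close>.\<close>
  define L where "L = c powr t * K / (1 - q)"
  have L: "L \<ge> 0" using assms q by (simp add: L_def)
  have "(\<lambda>j. c * (1/2)^j) \<longlonglongrightarrow> c * 0" by (intro tendsto_intros) auto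
  then have "eventually (\<lambda>j. c * (1/2)^j < \<delta>) sequentially"
    using \<open>\<delta> > 0\<close> by (intro order_tendstoD(2)[where y = "c * 0"]) auto
  moreover have "(\<lambda>j. L * q^j) \<longlonglongrightarrow> L * 0" using q by (intro tendsto_intros LIMSEQ_realpow_zero) auto
  then have "eventually (\<lambda>j. L * q^j < \<eta>) sequentially"
    using \<open>\<eta> > 0\<close> by (intro order_tendstoD(2)[where y = "L * 0"]) auto
  ultimately have "eventually (\<lambda>j. c * (1/2)^j < \<delta> \<and> L * q^j < \<eta> \<and> j \<ge> 1) sequentially"
    using eventually_ge_at_top by eventually_elim auto
  then obtain J where J: "c * (1/2)^J < \<delta>" "L * q^J < \<eta>" "J \<ge> 1"
    by (auto simp: eventually_sequentially)
  have half: "2 powr - real j = (1/2)^j" for j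
    by (simp add: powr_minus powr_realpow power_one_over inverse_eq_divide)
  have "\<exists>f. bij_betw f {0..<card (\<U> j)} (\<U> j)" for j
    using ex_bij_betw_nat_finite[OF fin] by blast
  then obtain f where f: "\<And>j. bij_betw (f j) {0..<card (\<U> j)} (\<U> j)" by metis
  have fU: "f j i \<in> \<U> j" if "i < card (\<U> j)" for i j using f[of j] that by (auto simp: bij_betw_def)
  \<comment> \<open>Each finite family is padded by empty sets, whose \<open>diam_power\<close> is
    0, to fit covers indexed by all natural numbers.\<close>
  define V where "V = (\<lambda>j i. if i < card (\<U> (j + J)) then f (j + J) i else {})"
  define W where "W = (\<lambda>i. case prod_decode i of (j, i) \<Rightarrow> V j i)"
  have VW: "(\<Sum>i. diam_power t (W i)) = (\<Sum>j. \<Sum>i. diam_power t (V j i))"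
    using suminf_ennreal_2dimen[of "\<lambda>n. \<Sum>i. diam_power t (V n i)" "\<lambda>(n,i). diam_power t (V n i)"]
    by (simp add: W_def case_prod_beta)
  have le: "(\<Sum>i. diam_power t (V j i)) \<le> ennreal (c powr t * K * q ^ (j + J))" for j
  proof -
    have "(\<Sum>i. diam_power t (V j i)) = (\<Sum>i<card (\<U> (j + J)). diam_power t (V j i))"
      by (rule suminf_finite) (auto simp: V_def diam_power_def)
    also have "\<dots> \<le> (\<Sum>i<card (\<U> (j + J)). ennreal ((c * 2 powr - real (j + J)) powr t))"
    proof (rule sum_mono)
      fix i assume "i \<in> {..<card (\<U> (j + J))}"
      then have "V j i \<in> \<U> (j + J)" using fU by (simp add: V_def)
      from diam[OF this] show "diam_power t (V j i) \<le> ennreal ((c * 2 powr - real (j + J)) powr t)"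
        using \<open>t > 0\<close> by (auto simp: diam_power_def intro!: ennreal_leI powr_mono2 diameter_ge_0)
    qed
    also have "\<dots> = ennreal (real (card (\<U> (j + J))) * (c * 2 powr - real (j + J)) powr t)"
      by (simp add: ennreal_mult' flip: ennreal_of_nat_eq_real_of_nat)
    also have "\<dots> \<le> ennreal (c powr t * K * q ^ (j + J))"
    proof (rule ennreal_leI)
      have "real (card (\<U> (j + J))) * (c * 2 powr - real (j + J)) powr t
          = c powr t * (real (card (\<U> (j + J))) * 2 powr - (real (j + J) * t))"
        using \<open>c \<ge> 0\<close> by (simp add: powr_mult powr_powr del: of_nat_add)
      also have "\<dots> \<le> c powr t * (K * 2 powr - (\<epsilon> * real (j + J)))"
        by (intro mult_left_mono card) (use J in auto)
      finally show "real (card (\<U> (j + J))) * (c * 2 powr - real (j + J)) powr t \<le> c powr t * K * q ^ (j + J)"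
        using qj[of "j + J"] by simp
    qed
    finally show ?thesis .
  qed
  have "(\<Sum>i. diam_power t (W i)) \<le> (\<Sum>j. ennreal (c powr t * K * q ^ (j + J)))"
    unfolding VW by (intro suminf_le le) auto
  also have "\<dots> = ennreal (L * q ^ J)"
  proof (rule suminf_ennreal_eq)
    have "(\<lambda>j. (c powr t * K * q ^ J) * q ^ j) sums ((c powr t * K * q ^ J) * (1 / (1 - q)))"
      by (intro sums_mult geometric_sums) (use q in auto)
    then show "(\<lambda>j. c powr t * K * q ^ (j + J)) sums (L * q ^ J)"
      by (simp add: L_def power_add mult_ac)
  qed (use assms q in auto)
  also have "\<dots> \<le> ennreal \<eta>" using J by (intro ennreal_leI) auto
  finally have "(\<Sum>i. diam_power t (W i)) \<le> ennreal \<eta>" .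
  moreover have "E \<subseteq> (\<Union>i. W i)"
  proof
    fix x assume "x \<in> E"
    then obtain j U where j: "j \<ge> J" "U \<in> \<U> j" "x \<in> U" using cover by blast
    then obtain i where i: "i < card (\<U> j)" "U = f j i"
      using f[of j] unfolding bij_betw_def by (metis atLeastLessThan_iff imageE)
    then have "x \<in> W (prod_encode (j - J, i))" using j by (simp add: W_def V_def)
    then show "x \<in> (\<Union>i. W i)" by blast
  qed
  moreover have "bounded (W i) \<and> diameter (W i) \<le> \<delta>" for i
  proof -
    obtain j k where jk: "prod_decode i = (j, k)" by force
    show ?thesis
    proof (cases "k < card (\<U> (j + J))")
      case True
      then have "W i \<in> \<U> (j + J)" using fU by (simp add: W_def V_def jk)
      from diam[OF this] have "bounded (W i)" "diameter (W i) \<le> c * (1/2)^(j + J)" by (auto simp: half[symmetric])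
      moreover have "c * (1/2)^(j + J) \<le> c * (1/2)^J"
        using \<open>c \<ge> 0\<close> by (intro mult_left_mono power_decreasing) auto
      ultimately show ?thesis using J by auto
    qed (use \<open>\<delta> > 0\<close> in \<open>simp add: W_def V_def jk\<close>)
  qed
  ultimately show "\<exists>U. E \<subseteq> (\<Union>i. U i) \<and> (\<forall>i. bounded (U i) \<and> diameter (U i) \<le> \<delta>) \<and>
    (\<Sum>i. diam_power t (U i)) \<le> ennreal \<eta>" by blast
qed

text \<open>Only \<open>t > 0\<close> is tested: below every number exceeding \<open>max 0 r\<close>
  there is such a \<open>t\<close>, so the exponent 0, where the measure counts points, never
  arises.\<close>

lemma hausdorff_dim_leI:
  assumes "\<And>t. t > 0 \<Longrightarrow> r < ereal t \<Longrightarrow> hausdorff_measure t A = 0"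
  shows "hausdorff_dim A \<le> max 0 r"
proof (rule dense_ge)
  fix z assume "max 0 r < z"
  then obtain t where t: "max 0 r < ereal t" "ereal t < z"
    using ereal_dense2 by blast
  then have "0 < t" "r < ereal t" by auto
  then have "hausdorff_dim A \<le> ereal t"
    unfolding hausdorff_dim_def using assms by (intro Inf_lower) auto
  with t show "hausdorff_dim A \<le> z" by simp
qed

section \<open>Radial integrals and a reproducing kernel\<close>

lemma dyadic_bracket:
  fixes r :: real
  assumes "1 \<le> r"
  obtains j :: nat where "2 ^ j \<le> r" "r < 2 ^ Suc j"
proof
  have nn: "0 \<le> log 2 r" using assms by simp
  have "real (nat \<lfloor>log 2 r\<rfloor>) \<le> log 2 r" using nn by (simp only: of_nat_nat zero_le_floor of_int_floor_le)
  then show "2 ^ nat \<lfloor>log 2 r\<rfloor> \<le> r"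
    using assms by (simp only: le_log_iff powr_realpow)
  have "log 2 r < real (Suc (nat \<lfloor>log 2 r\<rfloor>))" using nn by linarith
  then show "r < 2 ^ Suc (nat \<lfloor>log 2 r\<rfloor>)"
    using assms by (simp only: log_less_iff powr_realpow)
qed

lemma powr_two_power: "(2 ^ j) powr a = (2 powr a) ^ j" for a :: real
  by (simp add: powr_powr mult.commute flip: powr_realpow)

lemma ennreal_le_suminf: "f j \<le> suminf f" for f :: "nat \<Rightarrow> ennreal"
  using sum_le_suminf[of f "{j}"] by simp

text \<open>Domination by a series of ball indicators, whose integrals are proportional to
  \<open>c j * r j ^ DIM('a)\<close>. The radii may grow or shrink with \<open>j\<close>, which
  covers decay at infinity as well as a singularity at 0; the origin itself is a null set.\<close>

lemma nn_integral_shells_finite: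
  fixes h :: "'a::euclidean_space \<Rightarrow> ennreal"
  assumes h: "h \<in> borel_measurable borel" and q: "0 \<le> q" "q < 1" and C: "0 \<le> C"
    and r: "\<And>j::nat. 0 < r j" and cr: "\<And>j. c j \<ge> 0"
    and geo: "\<And>j. c j * r j ^ DIM('a) \<le> C * q ^ j"
    and shells: "\<And>x. x \<noteq> 0 \<Longrightarrow> \<exists>j. h x \<le> ennreal (c j) * indicator (ball 0 (r j)) x"
  shows "(\<integral>\<^sup>+x. h x \<partial>lborel) < \<infinity>"
proof -
  have [measurable]: "ball (0::'a) \<rho> \<in> sets borel" for \<rho> by simp
  let ?v = "unit_ball_vol (real DIM('a))"
  have "(\<integral>\<^sup>+x. h x \<partial>lborel) \<le> (\<integral>\<^sup>+x. (\<Sum>j. ennreal (c j) * indicator (ball 0 (r j)) (x::'a)) \<partial>lborel)"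
  proof (rule nn_integral_mono_AE)
    show "AE x in lborel. h x \<le> (\<Sum>j. ennreal (c j) * indicator (ball 0 (r j)) (x::'a))"
      using AE_lborel_singleton[of 0]
    proof eventually_elim
      case (elim x)
      then obtain j where "h x \<le> ennreal (c j) * indicator (ball 0 (r j)) x" using shells by blast
      also have "\<dots> \<le> (\<Sum>j. ennreal (c j) * indicator (ball 0 (r j)) x)"
        by (rule ennreal_le_suminf)
      finally show ?case .
    qed
  qed
  also have "\<dots> = (\<Sum>j. \<integral>\<^sup>+x. ennreal (c j) * indicator (ball 0 (r j)) (x::'a) \<partial>lborel)"
    by (intro nn_integral_suminf) measurable
  also have "\<dots> = (\<Sum>j. ennreal (?v * (c j * r j ^ DIM('a))))"
  proof (intro arg_cong[where f=suminf] ext)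
    fix j
    have "(\<integral>\<^sup>+x. ennreal (c j) * indicator (ball 0 (r j)) (x::'a) \<partial>lborel) = ennreal (c j) * emeasure lborel (ball (0::'a) (r j))"
      by (rule nn_integral_cmult_indicator) simp
    also have "\<dots> = ennreal (?v * (c j * r j ^ DIM('a)))"
      using r[of j] cr[of j] by (simp add: emeasure_ball ennreal_mult'[symmetric] mult_ac)
    finally show "(\<integral>\<^sup>+x. ennreal (c j) * indicator (ball 0 (r j)) (x::'a) \<partial>lborel) = ennreal (?v * (c j * r j ^ DIM('a)))" .
  qed
  also have "\<dots> \<le> (\<Sum>j. ennreal (?v * (C * q ^ j)))"
    by (intro suminf_le ennreal_leI mult_left_mono geo) auto
  also have "\<dots> = ennreal (?v * (C * (1 / (1 - q))))"
    by (intro suminf_ennreal_eq sums_mult geometric_sums) (use q C in auto)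
  finally show ?thesis by (simp add: le_less_trans)
qed

lemma nn_integral_one_plus_norm_powr_finite:
  assumes "a < - real DIM('a)"
  shows "(\<integral>\<^sup>+x. ennreal ((1 + norm (x::'a::euclidean_space)) powr a) \<partial>lborel) < \<infinity>"
proof (rule nn_integral_shells_finite[where q = "2 powr (a + DIM('a))" and C = "2 ^ DIM('a)"
      and c = "\<lambda>j. (2 powr a) ^ j" and r = "\<lambda>j. 2 ^ Suc j"])
  show "(2 powr a) ^ j * (2 ^ Suc j) ^ DIM('a) \<le> 2 ^ DIM('a) * (2 powr (a + DIM('a))) ^ j" for j
    by (simp add: powr_add powr_realpow power_mult_distrib mult_ac flip: power_mult)
  show "\<exists>j. ennreal ((1 + norm x) powr a) \<le> ennreal ((2 powr a) ^ j) * indicator (ball 0 (2 ^ Suc j)) x" for x :: 'a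
  proof -
    obtain j where j: "2 ^ j \<le> 1 + norm x" "1 + norm x < 2 ^ Suc j" using dyadic_bracket[of "1 + norm x"] by auto
    have "(1 + norm x) powr a \<le> (2 ^ j) powr a" using j assms by (intro powr_mono2') auto
    then show ?thesis using j by (intro exI[of _ j]) (auto simp: powr_two_power indicator_def)
  qed
  show "2 powr (a + real DIM('a)) < 1" using assms powr_less_mono[of "a + real DIM('a)" 0 2] by simp
qed auto

lemma nn_integral_norm_powr_unit_ball_finite:
  assumes "a > - real DIM('a)"
  shows "(\<integral>\<^sup>+x. ennreal (norm (x::'a::euclidean_space) powr a) * indicator (ball 0 1) x \<partial>lborel) < \<infinity>"
proof -
  \<comment> \<open>A negative exponent makes the power decreasing in the norm, so that it is
    largest at the inner edge of a shell; -1/2 still exceeds minus the dimension.\<close>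
  define b where "b = min a (-1/2)"
  have "1 \<le> real DIM('a)" using DIM_ge_Suc0[where 'a='a] by linarith
  then have b: "b < 0" "b > - real DIM('a)" "b \<le> a" using assms unfolding b_def by linarith+
  show ?thesis
  proof (rule nn_integral_shells_finite[where q = "2 powr - (b + DIM('a))" and C = "2 powr - b * 2 ^ DIM('a)"
        and c = "\<lambda>j. 2 powr - b * (2 powr - b) ^ j" and r = "\<lambda>j. 2 * (1/2) ^ j"])
    show "2 powr - b * (2 powr - b) ^ j * (2 * (1/2) ^ j) ^ DIM('a)
        \<le> 2 powr - b * 2 ^ DIM('a) * (2 powr - (b + DIM('a))) ^ j" for j
    proof -
      have "2 powr - (b + DIM('a)) = 2 powr - b * (1/2) ^ DIM('a)"
        by (simp add: powr_diff powr_realpow power_one_over field_simps)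
      then show ?thesis by (simp add: power_mult_distrib mult_ac flip: power_mult)
    qed
    show "\<exists>j. ennreal (norm x powr a) * indicator (ball 0 1) x
       \<le> ennreal (2 powr - b * (2 powr - b) ^ j) * indicator (ball 0 (2 * (1/2) ^ j)) x" if "x \<noteq> 0" for x :: 'a
    proof (cases "norm x < 1")
      case True
      then have "1 \<le> 1 / norm x" using that by simp
      then obtain j where j: "2 ^ j \<le> 1 / norm x" "1 / norm x < 2 ^ Suc j" using dyadic_bracket by blast
      have n: "norm x \<le> (1/2) ^ j" "(1/2) ^ Suc j < norm x"
        using j that by (auto simp: field_simps power_one_over)
      have "norm x powr a \<le> norm x powr b" using True that b by (intro powr_mono') auto
      also have "\<dots> \<le> ((1/2) ^ Suc j) powr b" using n b by (intro powr_mono2') auto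
      also have "\<dots> = (1 / 2 ^ Suc j) powr b" by (simp add: power_one_over)
      also have "\<dots> = (2 powr - b) ^ Suc j" 
        by (simp only: powr_divide powr_two_power powr_minus) (simp add: power_one_over inverse_eq_divide)
      finally have "norm x powr a \<le> 2 powr - b * (2 powr - b) ^ j" by simp
      moreover have "norm x < 2 * (1/2) ^ j" using n(1) by (rule order_le_less_trans) simp
      ultimately show ?thesis using True by (intro exI[of _ j]) (auto simp: indicator_def)
    qed auto
    show "2 powr - (b + real DIM('a)) < 1" using b powr_less_mono[of "- (b + real DIM('a))" 0 2] by simp
    have [measurable]: "ball (0::'a) 1 \<in> sets borel" by simp
    show "(\<lambda>x::'a. ennreal (norm x powr a) * indicator (ball 0 1) x) \<in> borel_measurable borel"
      by measurable
  qed auto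
qed

section \<open>One-dimensional kernels whose transform is 1 on an interval\<close>

lemma integrable_one_plus_abs_powr:
  assumes "a < -1"
  shows "integrable lborel (\<lambda>x::real. (1 + \<bar>x\<bar>) powr a)"
  using nn_integral_one_plus_norm_powr_finite[where 'a=real, of a] assms
  by (intro integrableI_nonneg) auto

text \<open>The value is pi; it enters as a positive normalising factor of the kernel.\<close>

definition fejer_const :: real where
  "fejer_const = (LINT y|lborel. (1 - cos y) / y\<^sup>2)"

lemma one_minus_cos_le: "1 - cos y \<le> y\<^sup>2 / 2" for y :: real
proof -
  have "1 - cos y = 2 * (sin (y/2))\<^sup>2" using cos_double_sin[of "y/2"] by simp
  also have "(sin (y/2))\<^sup>2 \<le> (y/2)\<^sup>2" using abs_sin_x_le_abs_x[of "y/2"] by (rule abs_le_square_iff[THEN iffD1])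
  finally show ?thesis by (simp add: power_divide)
qed

lemma one_minus_cos_bound:
  "\<bar>(1 - cos (b * y)) / y\<^sup>2\<bar> \<le> 8 * max 1 (b\<^sup>2) * (1 + \<bar>y\<bar>) powr - 2" for b y :: real
proof (cases "y = 0")
  case False
  \<comment> \<open>Near 0 the quadratic bound on 1 - cos gives the factor
    \<open>2 * b\<^sup>2\<close>; away from 0 the bounds 1 - cos \<le> 2 and 1 + |y| \<le> 2|y| give
    8.\<close>
  define D where "D = 8 * max 1 (b\<^sup>2)"
  have p: "(1 + \<bar>y\<bar>) powr - 2 = 1 / (1 + \<bar>y\<bar>)\<^sup>2" "(1 + \<bar>y\<bar>)\<^sup>2 > 0"
    by (simp_all add: powr_minus inverse_eq_divide add_pos_nonneg)
  have "(1 - cos (b*y)) * (1 + \<bar>y\<bar>)\<^sup>2 \<le> D * y\<^sup>2"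
      proof (cases "\<bar>y\<bar> \<le> 1")
        case True
        have "(1 + \<bar>y\<bar>)\<^sup>2 \<le> 2\<^sup>2" using True by (intro power_mono) auto
        then have "(1 - cos (b*y)) * (1 + \<bar>y\<bar>)\<^sup>2 \<le> ((b*y)\<^sup>2/2) * 2\<^sup>2" using one_minus_cos_le[of "b*y"] by (intro mult_mono) auto
        also have "\<dots> = (2 * b\<^sup>2) * y\<^sup>2" by (simp add: power_mult_distrib)
        also have "\<dots> \<le> D * y\<^sup>2" by (intro mult_right_mono) (auto simp: D_def max_def)
        finally show ?thesis .
      next
        case False
        have "(1 + \<bar>y\<bar>)\<^sup>2 \<le> (2 * \<bar>y\<bar>)\<^sup>2" using False by (intro power_mono) auto
        moreover have "1 - cos (b*y) \<le> 2" using cos_ge_minus_one[of "b*y"] by linarith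
        ultimately have "(1 - cos (b*y)) * (1 + \<bar>y\<bar>)\<^sup>2 \<le> 2 * (2 * \<bar>y\<bar>)\<^sup>2" by (intro mult_mono) auto
        also have "\<dots> = 8 * y\<^sup>2" by (simp add: power_mult_distrib)
        also have "\<dots> \<le> D * y\<^sup>2" by (intro mult_right_mono) (auto simp: D_def)
        finally show ?thesis .
      qed
  then have "(1 - cos (b*y)) / y\<^sup>2 \<le> D * (1 + \<bar>y\<bar>) powr - 2"
    unfolding p(1) using p(2) False by (simp add: divide_simps mult_ac)
  then show ?thesis by (simp add: D_def)
qed simp

lemma integrable_one_minus_cos: "integrable lborel (\<lambda>y::real. (1 - cos y) / y\<^sup>2)"
  by (rule Bochner_Integration.integrable_bound[of _ "\<lambda>y. 8 * (1 + \<bar>y\<bar>) powr - 2"])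
    (use one_minus_cos_bound[of 1] in \<open>auto intro!: AE_I2 integrable_mult_right integrable_one_plus_abs_powr\<close>)

text \<open>The integrand is nonnegative and stays above a positive constant on [1, 2].\<close>

lemma fejer_const_pos: "fejer_const > 0"
proof -
  have c: "cos 1 < (1::real)" using cos_monotone_0_pi[of 0 1] pi_gt3 by simp
  have "(1 - cos 1) / 4 = (LINT y|lborel. indicator {1..2::real} y * ((1 - cos 1) / 4 :: real))" by simp
  also have "\<dots> \<le> (LINT y|lborel. (1 - cos y) / y\<^sup>2)"
  proof (rule integral_mono)
    fix y :: real
    show "indicator {1..2} y * ((1 - cos 1) / 4) \<le> (1 - cos y) / y\<^sup>2"
    proof (cases "y \<in> {1..2}")
      case True
      have "cos y \<le> cos 1" using True pi_gt3 by (intro cos_monotone_0_pi_le) auto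
      moreover have "y\<^sup>2 \<le> 2\<^sup>2" using True by (intro power_mono) auto
      ultimately have "(1 - cos 1) / 4 \<le> (1 - cos y) / y\<^sup>2"
        using True c by (intro frac_le) auto
      then show ?thesis using True by simp
    qed simp
  qed (use integrable_one_minus_cos in \<open>auto intro!: integrable_mult_left simp: integrable_indicator_iff\<close>)
  finally have "(1 - cos 1) / 4 \<le> fejer_const" unfolding fejer_const_def .
  moreover have "0 < (1 - cos 1 :: real) / 4" using c by simp
  ultimately show ?thesis by (rule less_le_trans[rotated])
qed

lemma has_bochner_integral_one_minus_cos:
  "has_bochner_integral lborel (\<lambda>y::real. (1 - cos (b * y)) / y\<^sup>2) (\<bar>b\<bar> * fejer_const)"
proof (cases "b = 0")
  case False
  have "has_bochner_integral lborel (\<lambda>y::real. (1 - cos y) / y\<^sup>2) fejer_const"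
    unfolding fejer_const_def by (intro has_bochner_integral_integrable integrable_one_minus_cos)
  then have "has_bochner_integral lborel (\<lambda>y. (1 - cos (0 + b * y)) / (0 + b * y)\<^sup>2) (fejer_const /\<^sub>R \<bar>b\<bar>)"
    using lborel_has_bochner_integral_real_affine_iff[OF False, of "\<lambda>y. (1 - cos y) / y\<^sup>2" fejer_const 0] by simp
  then have "has_bochner_integral lborel (\<lambda>y. b\<^sup>2 * ((1 - cos (0 + b * y)) / (0 + b * y)\<^sup>2)) (b\<^sup>2 * (fejer_const /\<^sub>R \<bar>b\<bar>))"
    by (rule has_bochner_integral_mult_right)
  moreover have "b\<^sup>2 * (fejer_const /\<^sub>R \<bar>b\<bar>) = \<bar>b\<bar> * fejer_const"
    using False by (simp add: field_simps power2_eq_square)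
  moreover have "b\<^sup>2 * ((1 - cos (0 + b * y)) / (0 + b * y)\<^sup>2) = (1 - cos (b * y)) / y\<^sup>2" for y
    using False by (simp add: power_mult_distrib)
  ultimately show ?thesis by (simp only:)
qed (simp add: has_bochner_integral_zero)

text \<open>The trapezoidal kernel. Its transform is identified on the flat part by scaling alone, since
  the integral of \<open>(1 - cos (b y)) / y\<^sup>2\<close> is a constant multiple of \<open>\<bar>b\<bar>\<close>.\<close>

lemma reproducing_kernel_base:
  assumes "R \<ge> 0"
  obtains \<phi> :: "real \<Rightarrow> real" and C where "\<phi> \<in> borel_measurable borel"
    "\<And>y. \<bar>\<phi> y\<bar> \<le> C * (1 + \<bar>y\<bar>) powr - 2"
    "\<And>t. \<bar>t\<bar> \<le> R \<Longrightarrow> (LINT y|lborel. of_real (\<phi> y) * cis (t * y)) = 1"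
proof
  define g where "g = (\<lambda>b y::real. (1 - cos (b * y)) / y\<^sup>2)"
  define \<phi> where "\<phi> = (\<lambda>y. (g (R + 1) y - g R y) / fejer_const)"
  note c = fejer_const_pos
  have hg: "has_bochner_integral lborel (g b) (\<bar>b\<bar> * fejer_const)" for b
    unfolding g_def by (rule has_bochner_integral_one_minus_cos)
  have gm[measurable]: "g b \<in> borel_measurable borel" for b unfolding g_def by measurable
  show phim: "\<phi> \<in> borel_measurable borel" unfolding \<phi>_def by measurable
  define D where "D = (\<lambda>b::real. 8 * max 1 (b\<^sup>2))"
  have gD: "\<bar>g b y\<bar> \<le> D b * (1 + \<bar>y\<bar>) powr - 2" for b y
    unfolding g_def D_def by (rule one_minus_cos_bound)
  show "\<bar>\<phi> y\<bar> \<le> (D (R + 1) + D R) / fejer_const * (1 + \<bar>y\<bar>) powr - 2" for y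
  proof -
    have "\<bar>g (R + 1) y - g R y\<bar> \<le> (D (R + 1) + D R) * (1 + \<bar>y\<bar>) powr - 2"
      using gD[of "R+1" y] gD[of R y] by (simp add: algebra_simps)
    then show ?thesis using c by (simp add: \<phi>_def divide_right_mono)
  qed
  fix t :: real assume t: "\<bar>t\<bar> \<le> R"
  \<comment> \<open>Product-to-sum turns the modulated kernel into four functions \<open>g\<close>.
    For |t| \<le> R their parameters are nonnegative, so the absolute values drop, and the total
    (R+1+t) + (R+1-t) - (R+t) - (R-t) = 2 cancels the denominator.\<close>
  have eqc: "\<phi> y * cos (t * y) = (g (R+1+t) y + g (R+1-t) y - g (R+t) y - g (R-t) y) / (2 * fejer_const)" for y
  proof -
    have "cos (s * y) * cos (t * y) = (cos ((s + t) * y) + cos ((s - t) * y)) / 2" for s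
      by (simp add: cos_times_cos algebra_simps)
    from this[of "R+1"] this[of R]
    have A: "(cos (R * y) - cos ((R+1) * y)) * cos (t * y)
       = (cos ((R+t) * y) + cos ((R-t) * y) - cos ((R+1+t) * y) - cos ((R+1-t) * y)) / 2"
      by (simp add: algebra_simps)
    have "\<phi> y * cos (t * y) = ((cos (R * y) - cos ((R+1) * y)) * cos (t * y)) / y\<^sup>2 / fejer_const"
      by (simp add: \<phi>_def g_def diff_divide_distrib algebra_simps)
    then show ?thesis unfolding A by (simp add: g_def diff_divide_distrib add_divide_distrib)
  qed
  have "has_bochner_integral lborel (\<lambda>y. \<phi> y * cos (t * y))
     ((\<bar>R+1+t\<bar> * fejer_const + \<bar>R+1-t\<bar> * fejer_const - \<bar>R+t\<bar> * fejer_const - \<bar>R-t\<bar> * fejer_const) / (2 * fejer_const))"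
    unfolding eqc by (intro has_bochner_integral_divide has_bochner_integral_diff has_bochner_integral_add hg)
  moreover have "((\<bar>R+1+t\<bar> * fejer_const + \<bar>R+1-t\<bar> * fejer_const - \<bar>R+t\<bar> * fejer_const - \<bar>R-t\<bar> * fejer_const) / (2 * fejer_const)) = 1"
    using t c by (simp add: field_simps)
  ultimately have C: "has_bochner_integral lborel (\<lambda>y. \<phi> y * cos (t * y)) 1" by simp
  have phii: "integrable lborel \<phi>" unfolding \<phi>_def
    using hg by (auto simp: has_bochner_integral_iff)
  have Si: "integrable lborel (\<lambda>y. \<phi> y * sin (t * y))"
    by (rule Bochner_Integration.integrable_bound[OF phii])
      (use phim in \<open>auto simp: abs_mult intro!: AE_I2 mult_left_le\<close>)
  \<comment> \<open>For an even kernel, reflection changes the sign of the sine integral, which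
    therefore vanishes.\<close>
  have "\<phi> (- y) = \<phi> y" for y by (simp add: \<phi>_def g_def)
  then have "(LINT y|lborel. \<phi> y * sin (t * y)) = - (LINT y|lborel. \<phi> y * sin (t * y))"
    using lborel_integral_real_affine[of "-1" "\<lambda>y. \<phi> y * sin (t * y)" 0] by simp
  then have S: "has_bochner_integral lborel (\<lambda>y. \<phi> y * sin (t * y)) 0"
    using Si by (simp add: has_bochner_integral_iff)
  have "has_bochner_integral lborel (\<lambda>y. of_real (\<phi> y * cos (t * y)) + \<i> * of_real (\<phi> y * sin (t * y))) (of_real 1 + \<i> * of_real 0)"
    by (intro has_bochner_integral_add has_bochner_integral_mult_right has_bochner_integral_of_real C S)
  moreover have "of_real (\<phi> y * cos (t * y)) + \<i> * of_real (\<phi> y * sin (t * y)) = of_real (\<phi> y) * cis (t * y)" for y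
    by (simp add: complex_eq_iff)
  ultimately show "(LINT y|lborel. of_real (\<phi> y) * cis (t * y)) = 1"
    by (simp add: has_bochner_integral_iff)
qed

text \<open>Integrability of the kernel, finiteness of \<open>M\<close> and the bound
  \<open>B\<close> give absolute convergence on the product. It is applied with Lebesgue measure on
  an interval when kernels are smoothed, and with the given measure in the convolution
  formula.\<close>

lemma Fubini_bounded_kernel:
  fixes \<phi> :: "'a::euclidean_space \<Rightarrow> real" and g :: "'a \<Rightarrow> 'b \<Rightarrow> complex"
  assumes M: "finite_measure M" and \<phi>: "integrable lborel \<phi>"
    and g: "(\<lambda>(x,y). g x y) \<in> borel_measurable (borel \<Otimes>\<^sub>M M)"
    and B: "\<And>x y. cmod (g x y) \<le> B"
  shows "(LINT y|M. (LINT x|lborel. of_real (\<phi> x) * g x y)) = (LINT x|lborel. of_real (\<phi> x) * (LINT y|M. g x y))"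
proof -
  interpret M: finite_measure M by fact
  interpret pair_sigma_finite lborel M ..
  have [measurable]: "\<phi> \<in> borel_measurable borel" using borel_measurable_integrable[OF \<phi>] by simp
  have g'[measurable]: "(\<lambda>p. g (fst p) (snd p)) \<in> borel_measurable (lborel \<Otimes>\<^sub>M M)"
    using g by (simp add: case_prod_beta cong: measurable_cong_sets)
  have "0 \<le> B" using B[of undefined undefined] norm_ge_zero order_trans by blast
  have gy: "(\<lambda>y. g x y) \<in> borel_measurable M" for x
    using measurable_compose[OF measurable_Pair1'[of x lborel M] g'] by simp
  have igy: "integrable M (\<lambda>y. g x y)" for x
    by (rule M.integrable_const_bound[of _ B]) (use B gy in auto)
  have "integrable (lborel \<Otimes>\<^sub>M M) (\<lambda>p. of_real (\<phi> (fst p)) * g (fst p) (snd p))"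
  proof (rule Fubini_integrable)
    show "integrable lborel (\<lambda>x. LINT y|M. cmod (of_real (\<phi> (fst (x, y))) * g (fst (x, y)) (snd (x, y))))"
    proof (rule Bochner_Integration.integrable_bound[of _ "\<lambda>x. \<phi> x * (B * measure M (space M))"])
      show "AE x in lborel. norm (LINT y|M. cmod (of_real (\<phi> (fst (x, y))) * g (fst (x, y)) (snd (x, y))))
        \<le> norm (\<phi> x * (B * measure M (space M)))"
      proof (intro AE_I2)
        fix x :: 'a
        have "(LINT y|M. cmod (g x y)) \<le> (LINT y|M. B)"
          using igy[of x] B by (intro integral_mono) auto
        then have "\<bar>\<phi> x\<bar> * (LINT y|M. cmod (g x y)) \<le> \<bar>\<phi> x\<bar> * (B * measure M (space M))"
          by (intro mult_left_mono) (auto simp: mult.commute)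
        then show "norm (LINT y|M. cmod (of_real (\<phi> (fst (x, y))) * g (fst (x, y)) (snd (x, y))))
            \<le> norm (\<phi> x * (B * measure M (space M)))"
          using \<open>0 \<le> B\<close> by (simp add: norm_mult abs_mult)
      qed
    qed (use \<phi> in auto)
    show "AE x in lborel. integrable M (\<lambda>y. of_real (\<phi> (fst (x, y))) * g (fst (x, y)) (snd (x, y)))"
      using igy by (intro AE_I2) auto
  qed measurable
  then have "(LINT y|M. LINT x|lborel. of_real (\<phi> x) * g x y) = (LINT x|lborel. LINT y|M. of_real (\<phi> x) * g x y)"
    by (intro Fubini_integral) (simp add: split_beta')
  then show ?thesis by simp
qed

lemma borel_measurable_cis[measurable]: "cis \<in> borel_measurable borel"
  by (intro borel_measurable_continuous_onI continuous_intros)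

lemma kernel_bound_imp_integrable:
  assumes "\<phi> \<in> borel_measurable borel" "\<And>y::real. \<bar>\<phi> y :: real\<bar> \<le> C * (1 + \<bar>y\<bar>) powr - a" "a > 1"
  shows "integrable lborel \<phi>"
proof (rule Bochner_Integration.integrable_bound[of _ "\<lambda>y. C * (1 + \<bar>y\<bar>) powr - a"])
  show "AE x in lborel. norm (\<phi> x) \<le> norm (C * (1 + \<bar>x\<bar>) powr - a)"
    using assms(2) by (intro AE_I2) (metis abs_ge_self order_trans real_norm_def)
qed (use assms in \<open>auto intro!: integrable_mult_right integrable_one_plus_abs_powr\<close>)

text \<open>Multiplying the kernel by \<open>sin y / y\<close>, the mean of \<open>cos (y \<tau>)\<close> over \<open>\<bar>\<tau>\<bar> \<le> 1\<close>, averages its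
  transform over intervals of length 2, so the transform stays equal to 1 on a smaller interval
  while the kernel gains one order of decay.\<close>

lemma reproducing_kernel_improve:
  fixes \<phi> :: "real \<Rightarrow> real"
  assumes \<phi>[measurable]: "\<phi> \<in> borel_measurable borel"
    and bd: "\<And>y. \<bar>\<phi> y\<bar> \<le> C * (1 + \<bar>y\<bar>) powr - a" "a > 1"
    and one: "\<And>t. \<bar>t\<bar> \<le> R + 1 \<Longrightarrow> (LINT y|lborel. of_real (\<phi> y) * cis (t * y)) = 1"
  obtains \<psi> :: "real \<Rightarrow> real" and C' where "\<psi> \<in> borel_measurable borel"
    "\<And>y. \<bar>\<psi> y\<bar> \<le> C' * (1 + \<bar>y\<bar>) powr - (a + 1)"
    "\<And>t. \<bar>t\<bar> \<le> R \<Longrightarrow> (LINT y|lborel. of_real (\<psi> y) * cis (t * y)) = 1"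
proof
  note phii = kernel_bound_imp_integrable[OF \<phi> bd]
  \<comment> \<open>Lebesgue measure on [-1, 1], of mass 2, so that \<open>s\<close> is a mean of
    cosines: \<open>s y\<close> is sin y / y, with value 1 at 0.\<close>
  define M where "M = density lborel (\<lambda>\<tau>. ennreal (indicator {-1..1::real} \<tau>))"
  have [measurable_cong]: "sets M = sets borel" by (simp add: M_def)
  have emM: "emeasure M (space M) = 2" by (simp add: M_def emeasure_density ennreal_indicator)
  then interpret M: finite_measure M by (intro finite_measureI) auto
  define s where "s = (\<lambda>y. (LINT \<tau>|M. cos (y * \<tau>)) / 2)"
  have sm[measurable]: "s \<in> borel_measurable borel" unfolding s_def by measurable
  have mM: "measure M UNIV = 2" using emM by (simp add: measure_def M_def)
  have ic: "integrable M (\<lambda>\<tau>. cos (y * \<tau>))" for y by (rule M.integrable_const_bound[of _ 1]) auto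
  have s1: "\<bar>s y\<bar> \<le> 1" for y
  proof -
    have "norm (LINT \<tau>|M. cos (y * \<tau>)) \<le> (LINT \<tau>|M. 1)"
      by (intro order_trans[OF integral_norm_bound] integral_mono) (use ic in auto)
    then show ?thesis using mM by (simp add: s_def M_def)
  qed
  have s2: "\<bar>y * s y\<bar> \<le> 1" for y
  proof (cases "y = 0")
    case False
    have "(LINT \<tau>|M. cos (y * \<tau>)) = (LINT \<tau>|lborel. cos (y * \<tau>) * indicator {-1..1} \<tau>)"
      unfolding M_def by (subst integral_density) (auto simp: mult.commute)
    also have "\<dots> = sin (y * 1) / y - sin (y * -1) / y"
      by (rule integral_FTC_Icc_real) (use False in \<open>auto intro!: derivative_eq_intros continuous_intros\<close>)
    finally have "y * s y = sin y" using False by (simp add: s_def field_simps)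
    then show ?thesis by simp
  qed simp
  show "(\<lambda>y. \<phi> y * s y) \<in> borel_measurable borel" by measurable
  show "\<bar>\<phi> y * s y\<bar> \<le> (2 * C) * (1 + \<bar>y\<bar>) powr - (a + 1)" for y
  proof -
    \<comment> \<open>The two bounds |s| \<le> 1 and |y s| \<le> 1 add up to the extra order of
      decay.\<close>
    have "(1 + \<bar>y\<bar>) * \<bar>s y\<bar> \<le> 2" using s1[of y] s2[of y] by (simp add: abs_mult algebra_simps)
    then have sb: "\<bar>s y\<bar> \<le> 2 / (1 + \<bar>y\<bar>)" by (simp add: pos_le_divide_eq mult.commute)
    have "0 \<le> C * (1 + \<bar>y\<bar>) powr - a" using bd(1)[of y] by linarith
    then have "\<bar>\<phi> y * s y\<bar> \<le> (C * (1 + \<bar>y\<bar>) powr - a) * (2 / (1 + \<bar>y\<bar>))"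
      unfolding abs_mult using sb bd(1) by (intro mult_mono) auto
    also have "\<dots> = (2 * C) * (1 + \<bar>y\<bar>) powr - (a + 1)"
      by (simp add: powr_diff)
    finally show ?thesis .
  qed
  fix t :: real assume t: "\<bar>t\<bar> \<le> R"
  have ip: "integrable lborel (\<lambda>y. of_real (\<phi> y) * cis (r * y))" for r
    by (rule Bochner_Integration.integrable_bound[OF phii]) (auto simp: norm_mult)
  have "(LINT y|lborel. of_real (\<phi> y * s y) * cis (t * y))
     = (LINT y|lborel. of_real (\<phi> y) * (LINT \<tau>|M. of_real (cos (y * \<tau>) / 2) * cis (t * y)))"
  proof (intro Bochner_Integration.integral_cong refl)
    fix y
    have "(LINT \<tau>|M. of_real (cos (y * \<tau>) / 2) * cis (t * y)) = of_real (LINT \<tau>|M. cos (y * \<tau>) / 2) * cis (t * y)"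
      by (subst integral_mult_left_zero) (simp only: integral_complex_of_real)
    then show "of_real (\<phi> y * s y) * cis (t * y)
       = of_real (\<phi> y) * (LINT \<tau>|M. of_real (cos (y * \<tau>) / 2) * cis (t * y))"
      by (simp add: s_def)
  qed
  also have "\<dots> = (LINT \<tau>|M. (LINT y|lborel. of_real (\<phi> y) * (of_real (cos (y * \<tau>) / 2) * cis (t * y))))"
    by (rule Fubini_bounded_kernel[symmetric, where B = 1])
      (use phii M.finite_measure_axioms in \<open>auto simp: norm_mult intro: order_trans[OF abs_cos_le_one]\<close>)
  also have "\<dots> = (LINT \<tau>|M. 1 / 2)"
  proof (rule integral_cong_AE)
    have "AE \<tau> in M. \<tau> \<in> {-1..1}" unfolding M_def by (subst AE_density) (auto simp: indicator_def)
    then show "AE \<tau> in M. (LINT y|lborel. of_real (\<phi> y) * (of_real (cos (y * \<tau>) / 2) * cis (t * y))) = 1 / 2"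
    proof eventually_elim
      case (elim \<tau>)
      \<comment> \<open>The frequencies t + \<tau> and t - \<tau> stay within R + 1, where the
        transform of \<open>\<phi>\<close> is 1; the resulting constant 1/2 is then integrated over
        mass 2.\<close>
      have "of_real (cos (y * \<tau>) / 2) * cis (t * y) = (cis ((t + \<tau>) * y) + cis ((t - \<tau>) * y)) / 4" for y
        by (simp add: complex_eq_iff cos_add cos_diff sin_add sin_diff algebra_simps)
      then have "of_real (\<phi> y) * (of_real (cos (y * \<tau>) / 2) * cis (t * y))
        = (of_real (\<phi> y) * cis ((t + \<tau>) * y) + of_real (\<phi> y) * cis ((t - \<tau>) * y)) / 4" for y
        by (simp only: distrib_left times_divide_eq_right)
      then have "(LINT y|lborel. of_real (\<phi> y) * (of_real (cos (y * \<tau>) / 2) * cis (t * y)))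
        = (LINT y|lborel. (of_real (\<phi> y) * cis ((t + \<tau>) * y) + of_real (\<phi> y) * cis ((t - \<tau>) * y)) / 4)"
        by (simp only:)
      also have "\<dots> = (1 + 1) / 4"
      proof -
        have "\<bar>t + \<tau>\<bar> \<le> R + 1" "\<bar>t - \<tau>\<bar> \<le> R + 1" using elim t by auto
        then show ?thesis using ip by (simp add: one)
      qed
      finally show ?case by simp
    qed
  qed auto
  also have "\<dots> = 1" using mM by (simp add: M_def scaleR_conv_of_real)
  finally show "(LINT y|lborel. of_real (\<phi> y * s y) * cis (t * y)) = 1" .
qed

text \<open>Each induction step gains one order of decay and costs one unit of radius, hence the
  radius is kept arbitrary; the offset in \<open>N + 2\<close> is the quadratic decay of the
  trapezoidal kernel.\<close>

lemma reproducing_kernel: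
  assumes "R \<ge> 0"
  shows "\<exists>\<phi> C. \<phi> \<in> borel_measurable borel \<and> (\<forall>y::real. \<bar>\<phi> y :: real\<bar> \<le> C * (1 + \<bar>y\<bar>) powr - real (N + 2)) \<and>
    (\<forall>t. \<bar>t\<bar> \<le> R \<longrightarrow> (LINT y|lborel. of_real (\<phi> y) * cis (t * y)) = 1)"
  using assms
proof (induction N arbitrary: R)
  case 0
  obtain \<phi> :: "real \<Rightarrow> real" and C where "\<phi> \<in> borel_measurable borel"
    "\<And>y. \<bar>\<phi> y\<bar> \<le> C * (1 + \<bar>y\<bar>) powr - 2"
    "\<And>t. \<bar>t\<bar> \<le> R \<Longrightarrow> (LINT y|lborel. of_real (\<phi> y) * cis (t * y)) = 1"
    using reproducing_kernel_base[OF 0] by blast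
  then show ?case by (intro exI[of _ \<phi>] exI[of _ C]) auto
next
  case (Suc N)
  have "0 \<le> R + 1" using Suc by simp
  from Suc.IH[OF this] obtain \<phi> :: "real \<Rightarrow> real" and C where *: "\<phi> \<in> borel_measurable borel"
    "\<And>y. \<bar>\<phi> y\<bar> \<le> C * (1 + \<bar>y\<bar>) powr - real (N + 2)"
    "\<And>t. \<bar>t\<bar> \<le> R + 1 \<Longrightarrow> (LINT y|lborel. of_real (\<phi> y) * cis (t * y)) = 1" by blast
  have "1 < real (N + 2)" by simp
  from reproducing_kernel_improve[OF *(1,2) this *(3)]
  obtain \<psi> :: "real \<Rightarrow> real" and C' where **: "\<psi> \<in> borel_measurable borel"
    "\<And>y. \<bar>\<psi> y\<bar> \<le> C' * (1 + \<bar>y\<bar>) powr - (real (N + 2) + 1)"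
    "\<And>t. \<bar>t\<bar> \<le> R \<Longrightarrow> (LINT y|lborel. of_real (\<psi> y) * cis (t * y)) = 1" by blast
  have "real (N + 2) + 1 = real (Suc N + 2)" by simp
  with ** show ?case by metis
qed

text \<open>A tensor-product weight instead of a radial one: it majorises product kernels, and it
  splits over coordinates, so that the rows of a chart matrix can be treated independently.\<close>

definition prod_weight :: "real \<Rightarrow> 'a::euclidean_space \<Rightarrow> real" where
  "prod_weight a x = (\<Prod>b\<in>Basis. (1 + \<bar>x \<bullet> b\<bar>) powr - a)"

lemma prod_weight_nonneg: "0 \<le> prod_weight a x"
  by (simp add: prod_weight_def prod_nonneg)

lemma borel_measurable_prod_weight[measurable]: "prod_weight a \<in> borel_measurable borel"
  unfolding prod_weight_def by measurable

context
begin

interpretation product_sigma_finite "\<lambda>_. lborel :: real measure" ..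

lemma integral_lborel_prod:
  fixes f :: "'a::euclidean_space \<Rightarrow> real \<Rightarrow> _::{real_normed_field,banach,second_countable_topology}"
  assumes "\<And>b. b \<in> Basis \<Longrightarrow> integrable lborel (f b)"
  shows "(LINT x|lborel. (\<Prod>b\<in>Basis. f b (x \<bullet> b))) = (\<Prod>b\<in>Basis. LINT x|lborel. f b x)"
    and "integrable lborel (\<lambda>x. \<Prod>b\<in>Basis. f b (x \<bullet> b))"
proof -
  have [measurable]: "b \<in> Basis \<Longrightarrow> f b \<in> borel_measurable borel" for b
    using borel_measurable_integrable[OF assms] by simp
  have *: "(\<lambda>g. \<Sum>b\<in>Basis. g b *\<^sub>R b) \<in> measurable (\<Pi>\<^sub>M b\<in>(Basis::'a set). lborel) borel" by measurable
  have **: "(\<lambda>x::'a. \<Prod>b\<in>Basis. f b (x \<bullet> b)) \<in> borel_measurable borel" by measurable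
  show "(LINT x|lborel. (\<Prod>b\<in>Basis. f b (x \<bullet> b))) = (\<Prod>b\<in>Basis. LINT x|lborel. f b x)"
    by (subst lborel_eq) (simp add: integral_distr[OF * **] product_integral_prod assms)
  show "integrable lborel (\<lambda>x. \<Prod>b\<in>Basis. f b (x \<bullet> b))"
    by (subst lborel_eq) (simp add: integrable_distr_eq[OF * **] product_integrable_prod assms)
qed

end

section \<open>Local averaging of Fourier transforms of compactly supported measures\<close>

lemma nn_integral_lborel_reflect:
  fixes h :: "'a::euclidean_space \<Rightarrow> ennreal"
  assumes [measurable]: "h \<in> borel_measurable borel"
  shows "(\<integral>\<^sup>+z. h (x - z) \<partial>lborel) = (\<integral>\<^sup>+z. h z \<partial>lborel)"
proof -
  have "(\<integral>\<^sup>+z. h z \<partial>lborel) = (\<integral>\<^sup>+z. h z \<partial>(distr lborel borel (\<lambda>z. x + (-1) *\<^sub>R z)))"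
    using lborel_affine[of "-1" x] by (simp add: density_1)
  also have "\<dots> = (\<integral>\<^sup>+z. h (x - z) \<partial>lborel)" by (subst nn_integral_distr) auto
  finally show ?thesis ..
qed

lemma nn_integral_lborel_translate:
  fixes h :: "'a::euclidean_space \<Rightarrow> ennreal"
  assumes [measurable]: "h \<in> borel_measurable borel"
  shows "(\<integral>\<^sup>+z. h (z - x) \<partial>lborel) = (\<integral>\<^sup>+z. h z \<partial>lborel)"
proof -
  have "(\<integral>\<^sup>+z. h z \<partial>lborel) = (\<integral>\<^sup>+z. h z \<partial>(distr lborel borel ((+) (- x))))"
    by (simp only: lborel_distr_plus)
  also have "\<dots> = (\<integral>\<^sup>+z. h (z - x) \<partial>lborel)" by (subst nn_integral_distr) auto
  finally show ?thesis ..
qed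

lemma fourier_transform_cis:
  "fourier_transform \<mu> z = (LINT x|\<mu>. cis (2 * pi * ((- z) \<bullet> x)))"
  unfolding fourier_transform_def by (intro Bochner_Integration.integral_cong refl) (simp add: cis_conv_exp mult_ac)

lemma borel_measurable_fourier_transform:
  assumes "finite_measure \<mu>" and [measurable_cong]: "sets \<mu> = sets borel"
  shows "fourier_transform \<mu> \<in> borel_measurable borel"
proof -
  interpret finite_measure \<mu> by fact
  show ?thesis unfolding fourier_transform_cis[abs_def] by measurable
qed

lemma norm_fourier_transform_le:
  assumes "finite_measure \<mu>"
  shows "cmod (fourier_transform \<mu> z) \<le> measure \<mu> (space \<mu>)"
  unfolding fourier_transform_cis
  by (rule order_trans[OF integral_norm_bound]) simp

text \<open>On the support of \<open>\<mu>\<close> the product kernel has transform 1, the radius 2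
  pi \<rho> covering every coordinate of 2 pi s with |s| \<le> \<rho>. Multiplying
  \<open>\<mu>\<close> by this transform changes nothing, and on the Fourier side this is a
  convolution.\<close>

lemma fourier_transform_convolution:
  fixes \<mu> :: "'a::euclidean_space measure"
  assumes fin: "finite_measure \<mu>" and s: "sets \<mu> = sets borel"
    and \<rho>: "AE x in \<mu>. norm x \<le> \<rho>"
    and \<phi>: "integrable lborel \<phi>"
    and one: "\<And>t. \<bar>t\<bar> \<le> 2 * pi * \<rho> \<Longrightarrow> (LINT y|lborel. of_real (\<phi> y) * cis (t * y)) = 1"
  shows "(LINT \<tau>|lborel. of_real (\<Prod>b\<in>Basis. \<phi> (\<tau> \<bullet> b)) * fourier_transform \<mu> (x - \<tau>)) = fourier_transform \<mu> x"
proof -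
  interpret finite_measure \<mu> by fact
  note [measurable_cong] = s
  have [measurable]: "\<phi> \<in> borel_measurable borel" using borel_measurable_integrable[OF \<phi>] by simp
  define \<Phi> where "\<Phi> = (\<lambda>\<tau>::'a. \<Prod>b\<in>Basis. \<phi> (\<tau> \<bullet> b))"
  have \<Phi>i: "integrable lborel \<Phi>" unfolding \<Phi>_def by (rule integral_lborel_prod(2)) (rule \<phi>)
  have \<Phi>1: "(LINT \<tau>|lborel. of_real (\<Phi> \<tau>) * cis (2 * pi * (\<tau> \<bullet> s))) = 1" if "norm s \<le> \<rho>" for s
  proof -
    have i: "integrable lborel (\<lambda>y. of_real (\<phi> y) * cis (r * y))" for r
      by (rule Bochner_Integration.integrable_bound[OF \<phi>]) (auto simp: norm_mult)
    have "of_real (\<Phi> \<tau>) * cis (2 * pi * (\<tau> \<bullet> s)) = (\<Prod>b\<in>Basis. of_real (\<phi> (\<tau> \<bullet> b)) * cis ((2 * pi * (s \<bullet> b)) * (\<tau> \<bullet> b)))" for \<tau>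
    proof -
      have "cis (\<Sum>b\<in>B. h b) = (\<Prod>b\<in>B. cis (h b))" if "finite B" for h and B :: "'a set"
        using that by (induction B rule: finite_induct) (auto simp: cis_mult[symmetric])
      moreover have "2 * pi * (\<tau> \<bullet> s) = (\<Sum>b\<in>Basis. (2 * pi * (s \<bullet> b)) * (\<tau> \<bullet> b))"
        by (subst euclidean_inner) (simp add: sum_distrib_left mult_ac)
      ultimately show ?thesis by (simp add: \<Phi>_def prod.distrib)
    qed
    then have "(LINT \<tau>|lborel. of_real (\<Phi> \<tau>) * cis (2 * pi * (\<tau> \<bullet> s)))
       = (\<Prod>b\<in>Basis. LINT y|lborel. of_real (\<phi> y) * cis ((2 * pi * (s \<bullet> b)) * y))"
      using integral_lborel_prod(1)[of "\<lambda>b y. of_real (\<phi> y) * cis ((2 * pi * (s \<bullet> b)) * y)"] i by simp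
    also have "\<dots> = 1"
    proof (intro prod.neutral ballI one)
      fix b :: 'a assume "b \<in> Basis"
      then have "\<bar>s \<bullet> b\<bar> \<le> \<rho>" using that Basis_le_norm order_trans by blast
      then show "\<bar>2 * pi * (s \<bullet> b)\<bar> \<le> 2 * pi * \<rho>" by (simp add: abs_mult)
    qed
    finally show ?thesis .
  qed
  have "(LINT \<tau>|lborel. of_real (\<Phi> \<tau>) * fourier_transform \<mu> (x - \<tau>))
     = (LINT s|\<mu>. (LINT \<tau>|lborel. of_real (\<Phi> \<tau>) * cis (2 * pi * (- (x - \<tau>) \<bullet> s))))"
    unfolding fourier_transform_cis
    by (rule Fubini_bounded_kernel[symmetric, where B = 1]) (use fin \<Phi>i in auto)
  also have "\<dots> = (LINT s|\<mu>. cis (2 * pi * ((- x) \<bullet> s)))"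
  proof (rule integral_cong_AE)
    show "AE s in \<mu>. (LINT \<tau>|lborel. of_real (\<Phi> \<tau>) * cis (2 * pi * (- (x - \<tau>) \<bullet> s))) = cis (2 * pi * ((- x) \<bullet> s))"
      using \<rho>
    proof eventually_elim
      case (elim s)
      have "of_real (\<Phi> \<tau>) * cis (2 * pi * (- (x - \<tau>) \<bullet> s)) = cis (2 * pi * ((- x) \<bullet> s)) * (of_real (\<Phi> \<tau>) * cis (2 * pi * (\<tau> \<bullet> s)))" for \<tau>
        using cis_mult[of "2 * pi * ((- x) \<bullet> s)" "2 * pi * (\<tau> \<bullet> s)"]
        by (simp add: inner_diff_left algebra_simps)
      then have "(LINT \<tau>|lborel. of_real (\<Phi> \<tau>) * cis (2 * pi * (- (x - \<tau>) \<bullet> s)))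
        = cis (2 * pi * ((- x) \<bullet> s)) * (LINT \<tau>|lborel. of_real (\<Phi> \<tau>) * cis (2 * pi * (\<tau> \<bullet> s)))"
        by (simp only: integral_mult_right_zero)
      then show ?case using \<Phi>1[OF elim] by simp
    qed
    have [measurable]: "\<Phi> \<in> borel_measurable borel" using \<Phi>i by simp
    show "(\<lambda>s. LINT \<tau>|lborel. of_real (\<Phi> \<tau>) * cis (2 * pi * (- (x - \<tau>) \<bullet> s))) \<in> borel_measurable \<mu>" by measurable
  qed measurable
  finally show ?thesis by (simp add: fourier_transform_cis \<Phi>_def)
qed

text \<open>Below the level \<open>l\<close> there is nothing to prove; above it, a = a^(1-p) a^p
  and a^(1-p) is at most its value at the level.\<close>

lemma le_level_plus_powr:
  fixes a l p :: real
  assumes "0 \<le> a" "0 < l" "1 \<le> p"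
  shows "a \<le> l + l powr (1 - p) * a powr p"
proof (cases "a \<le> l")
  case False
  then have "a = a powr (1 - p) * a powr p" using assms by (simp flip: powr_add)
  also have "\<dots> \<le> l powr (1 - p) * a powr p"
    using False assms by (intro mult_right_mono powr_mono2') auto
  finally show ?thesis using assms by simp
qed (use assms in \<open>simp add: add_increasing2\<close>)

text \<open>A substitute for Jensen's inequality, obtained by cutting \<open>F\<close> at half of its mean.\<close>

lemma power_mean_le:
  fixes F w :: "'a \<Rightarrow> real"
  assumes [measurable]: "F \<in> borel_measurable M" "w \<in> borel_measurable M"
    and F: "\<And>x. 0 \<le> F x" and w: "\<And>x. 0 \<le> w x"
    and W: "(\<integral>\<^sup>+x. w x \<partial>M) \<le> ennreal W" "0 < W"
    and m: "ennreal m \<le> (\<integral>\<^sup>+x. w x * F x \<partial>M)" "0 \<le> m" and p: "1 \<le> p"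
  shows "ennreal (m powr p) \<le> ennreal (2 * (2 * W) powr (p - 1)) * (\<integral>\<^sup>+x. w x * F x powr p \<partial>M)"
proof (cases "m = 0 \<or> (\<integral>\<^sup>+x. w x * F x powr p \<partial>M) = \<infinity>")
  case False
  then have mp: "m > 0" using m by auto
  define I where "I = enn2real (\<integral>\<^sup>+x. w x * F x powr p \<partial>M)"
  have I: "(\<integral>\<^sup>+x. w x * F x powr p \<partial>M) = ennreal I" "0 \<le> I"
    using False by (auto simp: I_def top.not_eq_extremum)
  \<comment> \<open>With this level the first term \<open>l * W\<close> is half of \<open>m\<close>
    and can be moved to the left-hand side.\<close>
  define l where "l = m / (2 * W)"
  have l: "l > 0" using mp W by (simp add: l_def)
  have "ennreal m \<le> (\<integral>\<^sup>+x. w x * F x \<partial>M)" by fact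
  also have "\<dots> \<le> (\<integral>\<^sup>+x. ennreal l * ennreal (w x) + ennreal (l powr (1 - p)) * ennreal (w x * F x powr p) \<partial>M)"
  proof (intro nn_integral_mono)
    fix x
    have "w x * F x \<le> w x * (l + l powr (1 - p) * F x powr p)"
      by (intro mult_left_mono le_level_plus_powr F w l p)
    then show "ennreal (w x * F x) \<le> ennreal l * ennreal (w x) + ennreal (l powr (1 - p)) * ennreal (w x * F x powr p)"
      using l w by (simp add: algebra_simps flip: ennreal_mult' ennreal_plus)
  qed
  also have "\<dots> = ennreal l * (\<integral>\<^sup>+x. w x \<partial>M) + ennreal (l powr (1 - p)) * ennreal I"
    by (simp add: nn_integral_add nn_integral_cmult I)
  also have "\<dots> \<le> ennreal l * ennreal W + ennreal (l powr (1 - p)) * ennreal I"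
    by (intro add_right_mono mult_left_mono W) auto
  also have "\<dots> = ennreal (l * W + l powr (1 - p) * I)"
    using l W I by (simp flip: ennreal_mult' ennreal_plus)
  finally have "m \<le> l * W + l powr (1 - p) * I"
    using l W I by (subst (asm) ennreal_le_iff) auto
  then have "m \<le> 2 * (l powr (1 - p) * I)" using W by (simp add: l_def)
  then have "m * m powr (p - 1) \<le> 2 * (l powr (1 - p) * I) * m powr (p - 1)" by (intro mult_right_mono) auto
  moreover have "m * m powr (p - 1) = m powr p" using mp by (simp add: powr_mult_base)
  moreover have "l powr (1 - p) * m powr (p - 1) = (2 * W) powr (p - 1)"
  proof -
    have "l powr (1 - p) = (2 * W) powr (p - 1) * m powr (1 - p)"
      using mp W powr_minus_divide[of "2 * W" "p - 1"] by (simp add: l_def powr_divide)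
    then show ?thesis using mp by (simp add: mult.assoc flip: powr_add)
  qed
  ultimately have "m powr p \<le> 2 * (2 * W) powr (p - 1) * I" by (simp add: mult_ac)
  then show ?thesis unfolding I by (simp add: ennreal_leI flip: ennreal_mult')
qed (use W m in \<open>auto simp: ennreal_mult_eq_top_iff ennreal_mult_top\<close>)

lemma prod_kernel_bound:
  assumes "\<And>y::real. \<bar>\<phi> y\<bar> \<le> C * (1 + \<bar>y\<bar>) powr - a"
  shows "\<bar>\<Prod>b\<in>Basis. \<phi> (\<tau> \<bullet> b)\<bar> \<le> C ^ DIM('a) * prod_weight a (\<tau>::'a::euclidean_space)"
proof -
  have "\<bar>\<Prod>b\<in>Basis. \<phi> (\<tau> \<bullet> b)\<bar> = (\<Prod>b\<in>Basis. \<bar>\<phi> (\<tau> \<bullet> b)\<bar>)" by (rule abs_prod)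
  also have "\<dots> \<le> (\<Prod>b\<in>Basis. C * (1 + \<bar>\<tau> \<bullet> b\<bar>) powr - a)"
    by (intro prod_mono) (use assms in auto)
  finally show ?thesis by (simp add: prod_weight_def prod.distrib)
qed

lemma nn_integral_prod_weight_finite:
  assumes "a > 1"
  shows "(\<integral>\<^sup>+x. ennreal (prod_weight a (x::'a::euclidean_space)) \<partial>lborel) < \<infinity>"
proof -
  have "(\<integral>\<^sup>+x. ennreal (prod_weight a (x::'a)) \<partial>lborel) = (\<integral>\<^sup>+x. (\<Prod>b\<in>Basis. ennreal ((1 + \<bar>(x::'a) \<bullet> b\<bar>) powr - a)) \<partial>lborel)"
    by (simp add: prod_weight_def prod_ennreal)
  also have "\<dots> = (\<Prod>b\<in>(Basis::'a set). \<integral>\<^sup>+y. ennreal ((1 + \<bar>y\<bar>) powr - a) \<partial>lborel)"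
    by (rule nn_integral_lborel_prod) auto
  also have "\<dots> < \<infinity>"
    using nn_integral_one_plus_norm_powr_finite[where 'a=real, of "-a"] assms
    by (simp add: power_less_top_ennreal)
  finally show ?thesis .
qed

text \<open>The reproducing formula writes the transform at \<open>x\<close> as an average against a
  kernel \<Phi> of finite mass, to which the power mean inequality applies; the decay of \<Phi> then
  lets \<open>prod_weight\<close> replace it. The constant does not depend on
  \<open>x\<close>.\<close>

theorem fourier_transform_locally_constant:
  fixes \<mu> :: "'a::euclidean_space measure"
  assumes fin: "finite_measure \<mu>" and s: "sets \<mu> = sets borel"
    and \<rho>: "AE x in \<mu>. norm x \<le> \<rho>" "0 \<le> \<rho>" and p: "1 \<le> p"
  obtains C where "0 \<le> C"
    "\<And>x. ennreal (cmod (fourier_transform \<mu> x) powr p) \<le>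
      ennreal C * (\<integral>\<^sup>+z. ennreal (cmod (fourier_transform \<mu> z) powr p * prod_weight (real (N + 2)) (x - z)) \<partial>lborel)"
proof -
  let ?f = "fourier_transform \<mu>" and ?a = "real (N + 2)"
  note [measurable] = borel_measurable_fourier_transform[OF fin s]
  have "0 \<le> 2 * pi * \<rho>" using \<rho> by simp
  from reproducing_kernel[OF this, of N] obtain \<phi> :: "real \<Rightarrow> real" and c where
    \<phi>[measurable]: "\<phi> \<in> borel_measurable borel" and c: "\<And>y. \<bar>\<phi> y\<bar> \<le> c * (1 + \<bar>y\<bar>) powr - ?a"
    and one: "\<And>t. \<bar>t\<bar> \<le> 2 * pi * \<rho> \<Longrightarrow> (LINT y|lborel. of_real (\<phi> y) * cis (t * y)) = 1" by blast
  have phii: "integrable lborel \<phi>" using kernel_bound_imp_integrable[OF \<phi> c] by simp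
  have c0: "0 \<le> c" using c[of 0] by simp
  define \<Phi> where "\<Phi> = (\<lambda>\<tau>::'a. \<Prod>b\<in>Basis. \<phi> (\<tau> \<bullet> b))"
  have \<Phi>i: "integrable lborel \<Phi>" unfolding \<Phi>_def by (rule integral_lborel_prod(2)) (rule phii)
  have [measurable]: "\<Phi> \<in> borel_measurable borel" using \<Phi>i by simp
  \<comment> \<open>The summand 1 makes \<open>W\<close> positive, as the power mean inequality
    demands.\<close>
  define W where "W = enn2real (\<integral>\<^sup>+\<tau>. \<bar>\<Phi> \<tau>\<bar> \<partial>lborel) + 1"
  have "(\<integral>\<^sup>+\<tau>. \<bar>\<Phi> \<tau>\<bar> \<partial>lborel) < \<infinity>" using \<Phi>i unfolding integrable_iff_bounded by simp
  then have W: "(\<integral>\<^sup>+\<tau>. \<bar>\<Phi> \<tau>\<bar> \<partial>lborel) \<le> ennreal W" "0 < W"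
    by (auto simp: W_def add_nonneg_pos ennreal_plus)
  let ?C = "2 * (2 * W) powr (p - 1) * c ^ DIM('a)"
  show ?thesis
  proof (rule that[of ?C])
    fix x
    have Fi: "integrable lborel (\<lambda>\<tau>. of_real (\<Phi> \<tau>) * ?f (x - \<tau>))"
    proof (rule Bochner_Integration.integrable_bound[of _ "\<lambda>\<tau>. measure \<mu> (space \<mu>) * \<Phi> \<tau>"])
      show "AE \<tau> in lborel. norm (of_real (\<Phi> \<tau>) * ?f (x - \<tau>)) \<le> norm (measure \<mu> (space \<mu>) * \<Phi> \<tau>)"
        by (intro AE_I2) (simp add: norm_mult abs_mult mult_left_mono norm_fourier_transform_le[OF fin] mult.commute)
    qed (use \<Phi>i in auto)
    have "ennreal (cmod (?f x)) = ennreal (cmod (LINT \<tau>|lborel. of_real (\<Phi> \<tau>) * ?f (x - \<tau>)))"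
      using fourier_transform_convolution[OF fin s \<rho>(1) phii one] by (simp add: \<Phi>_def)
    also have "\<dots> \<le> (\<integral>\<^sup>+\<tau>. norm (of_real (\<Phi> \<tau>) * ?f (x - \<tau>)) \<partial>lborel)"
      by (rule integral_norm_bound_ennreal[OF Fi])
    also have "\<dots> = (\<integral>\<^sup>+\<tau>. \<bar>\<Phi> \<tau>\<bar> * cmod (?f (x - \<tau>)) \<partial>lborel)" by (simp add: norm_mult)
    finally have "ennreal (cmod (?f x) powr p)
       \<le> ennreal (2 * (2 * W) powr (p - 1)) * (\<integral>\<^sup>+\<tau>. \<bar>\<Phi> \<tau>\<bar> * cmod (?f (x - \<tau>)) powr p \<partial>lborel)"
      by (intro power_mean_le) (use W p in auto)
    also have "(\<integral>\<^sup>+\<tau>. \<bar>\<Phi> \<tau>\<bar> * cmod (?f (x - \<tau>)) powr p \<partial>lborel)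
       \<le> (\<integral>\<^sup>+\<tau>. ennreal (c ^ DIM('a)) * ennreal (cmod (?f (x - \<tau>)) powr p * prod_weight ?a (x - (x - \<tau>))) \<partial>lborel)"
    proof (intro nn_integral_mono)
      fix \<tau> :: 'a
      have "\<bar>\<Phi> \<tau>\<bar> * cmod (?f (x - \<tau>)) powr p \<le> (c ^ DIM('a) * prod_weight ?a \<tau>) * cmod (?f (x - \<tau>)) powr p"
        unfolding \<Phi>_def by (intro mult_right_mono prod_kernel_bound c) auto
      then show "ennreal (\<bar>\<Phi> \<tau>\<bar> * cmod (?f (x - \<tau>)) powr p)
        \<le> ennreal (c ^ DIM('a)) * ennreal (cmod (?f (x - \<tau>)) powr p * prod_weight ?a (x - (x - \<tau>)))"
        using c0 by (simp add: mult_ac ennreal_leI flip: ennreal_mult')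
    qed
    also have "\<dots> = ennreal (c ^ DIM('a)) * (\<integral>\<^sup>+\<tau>. ennreal (cmod (?f (x - \<tau>)) powr p * prod_weight ?a (x - (x - \<tau>))) \<partial>lborel)"
      by (rule nn_integral_cmult) measurable
    also have "(\<integral>\<^sup>+\<tau>. ennreal (cmod (?f (x - \<tau>)) powr p * prod_weight ?a (x - (x - \<tau>))) \<partial>lborel)
       = (\<integral>\<^sup>+z. ennreal (cmod (?f z) powr p * prod_weight ?a (x - z)) \<partial>lborel)"
      by (rule nn_integral_lborel_reflect[where h = "\<lambda>z. ennreal (cmod (?f z) powr p * prod_weight ?a (x - z))"]) measurable
    finally show "ennreal (cmod (?f x) powr p) \<le> ennreal ?C * (\<integral>\<^sup>+z. ennreal (cmod (?f z) powr p * prod_weight ?a (x - z)) \<partial>lborel)"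
      using c0 by (simp add: ennreal_mult' mult.assoc mult_left_mono)
  qed (use c0 in auto)
qed

section \<open>Counting cells in a chart of the Grassmannian\<close>

lemma sum_int_inverse_square_bound:
  fixes Q :: "int set"
  assumes "finite Q"
  shows "(\<Sum>q\<in>Q. (1 + \<bar>real_of_int q\<bar>) powr - 2) \<le> 2 * (\<Sum>n. (1 + real n) powr - 2)"
proof -
  have sm: "summable (\<lambda>n. (1 + real n) powr - 2)"
    using summable_ignore_initial_segment[of "\<lambda>n. real n powr -2" 1] by (simp add: summable_real_powr_iff add.commute)
  have half: "(\<Sum>q\<in>T. (1 + \<bar>real_of_int q\<bar>) powr - 2) \<le> (\<Sum>n. (1 + real n) powr - 2)"
    if T: "finite T" "inj_on (\<lambda>q. nat \<bar>q\<bar>) T" for T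
  proof -
    have "(\<Sum>q\<in>T. (1 + \<bar>real_of_int q\<bar>) powr - 2) = (\<Sum>n\<in>(\<lambda>q. nat \<bar>q\<bar>) ` T. (1 + real n) powr - 2)"
      by (subst sum.reindex[OF T(2)]) simp
    also have "\<dots> \<le> (\<Sum>n. (1 + real n) powr - 2)"
      by (rule sum_le_suminf) (use T sm in auto)
    finally show ?thesis .
  qed
  have "Q = (Q \<inter> {0..}) \<union> (Q \<inter> {..<0})" by auto
  then have "(\<Sum>q\<in>Q. (1 + \<bar>real_of_int q\<bar>) powr - 2)
     = (\<Sum>q\<in>Q \<inter> {0..}. (1 + \<bar>real_of_int q\<bar>) powr - 2) + (\<Sum>q\<in>Q \<inter> {..<0}. (1 + \<bar>real_of_int q\<bar>) powr - 2)"
    using assms by (subst sum.union_disjoint[symmetric]) auto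
  also have "\<dots> \<le> (\<Sum>n. (1 + real n) powr - 2) + (\<Sum>n. (1 + real n) powr - 2)"
    by (intro add_mono half) (use assms in \<open>auto simp: inj_on_def\<close>)
  finally show ?thesis by simp
qed

text \<open>The points c q + b are spaced by at least \<open>c0\<close>, so after a shift to the
  zero of the affine function the sum is comparable to one of inverse squares, uniformly in
  \<open>b\<close>, \<open>c\<close> and \<open>Q\<close>.\<close>

lemma sum_int_affine_bound:
  assumes "c0 > 0"
  obtains C where "0 \<le> C" "\<And>c b (Q::int set). finite Q \<Longrightarrow> c0 \<le> \<bar>c\<bar> \<Longrightarrow> (\<Sum>q\<in>Q. (1 + \<bar>c * real_of_int q + b\<bar>) powr - 2) \<le> C"
proof
  \<comment> \<open>The halving pays for rounding the zero -b/c to an integer; the minimum with 1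
    takes care of the constant term, \<open>c0\<close> of the slope.\<close>
  define k where "k = min 1 c0 / 2"
  have k: "0 < k" "2 * k \<le> 1" "2 * k \<le> c0" using assms by (auto simp: k_def)
  let ?C = "k powr - 2 * (2 * (\<Sum>n. (1 + real n) powr - 2))"
  show "0 \<le> ?C" using sum_int_inverse_square_bound[of "{}"] by simp
  fix c b :: real and Q :: "int set" assume Q: "finite Q" and c: "c0 \<le> \<bar>c\<bar>"
  define m where "m = \<lfloor>- b / c\<rfloor>"
  have "c \<noteq> 0" using c assms by auto
  have le: "k * (1 + \<bar>real_of_int (q - m)\<bar>) \<le> 1 + \<bar>c * real_of_int q + b\<bar>" for q
  proof -
    have "\<bar>real_of_int (q - m)\<bar> \<le> \<bar>real_of_int q + b / c\<bar> + 1" unfolding m_def by linarith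
    then have "1 + \<bar>real_of_int (q - m)\<bar> \<le> 2 + 2 * \<bar>real_of_int q + b / c\<bar>"
      by (rule order_trans[OF add_left_mono]) simp
    then have "k * (1 + \<bar>real_of_int (q - m)\<bar>) \<le> k * (2 + 2 * \<bar>real_of_int q + b / c\<bar>)"
      using k by (intro mult_left_mono) simp_all
    also have "\<dots> = 2 * k + (2 * k) * \<bar>real_of_int q + b / c\<bar>" by (simp add: algebra_simps)
    also have "\<dots> \<le> 1 + \<bar>c\<bar> * \<bar>real_of_int q + b / c\<bar>"
      using k c by (intro add_mono mult_right_mono) auto
    also have "\<bar>c\<bar> * \<bar>real_of_int q + b / c\<bar> = \<bar>c * real_of_int q + b\<bar>"
      using \<open>c \<noteq> 0\<close> by (simp add: abs_mult[symmetric] distrib_left)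
    finally show ?thesis .
  qed
  have "(\<Sum>q\<in>Q. (1 + \<bar>c * real_of_int q + b\<bar>) powr - 2) \<le> (\<Sum>q\<in>Q. k powr - 2 * (1 + \<bar>real_of_int (q - m)\<bar>) powr - 2)"
  proof (rule sum_mono)
    fix q
    have "(1 + \<bar>c * real_of_int q + b\<bar>) powr - 2 \<le> (k * (1 + \<bar>real_of_int (q - m)\<bar>)) powr - 2"
      using le[of q] k by (intro powr_mono2') (auto intro!: mult_pos_pos)
    then show "(1 + \<bar>c * real_of_int q + b\<bar>) powr - 2 \<le> k powr - 2 * (1 + \<bar>real_of_int (q - m)\<bar>) powr - 2"
      using k by (simp add: powr_mult)
  qed
  also have "\<dots> = k powr - 2 * (\<Sum>q\<in>(\<lambda>q. q - m) ` Q. (1 + \<bar>real_of_int q\<bar>) powr - 2)"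
    by (subst sum.reindex) (auto simp: inj_on_def sum_distrib_left)
  also have "\<dots> \<le> ?C"
    by (intro mult_left_mono sum_int_inverse_square_bound) (use Q in auto)
  finally show "(\<Sum>q\<in>Q. (1 + \<bar>c * real_of_int q + b\<bar>) powr - 2) \<le> ?C" .
qed

text \<open>The sum over the coordinate \<open>m0\<close> alone is bounded, since there the slope is
  bounded below; the other coordinates are merely counted. This is the source of the factor k - 1 in
  the overlap exponent.\<close>

lemma sum_lattice_strip_bound:
  assumes "c0 > 0"
  obtains C where "0 \<le> C" "\<And>(z::'k::finite \<Rightarrow> real) b (M::nat) m0. c0 \<le> \<bar>z m0\<bar> \<Longrightarrow>
    (\<Sum>q\<in>PiE UNIV (\<lambda>_. {- int M..int M}). (1 + \<bar>(\<Sum>m\<in>UNIV. real_of_int (q m) * z m) + b\<bar>) powr - 2)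
      \<le> C * real (2 * M + 1) ^ (CARD('k) - 1)"
proof -
  obtain C where C: "0 \<le> C" "\<And>c b (Q::int set). finite Q \<Longrightarrow> c0 \<le> \<bar>c\<bar> \<Longrightarrow> (\<Sum>q\<in>Q. (1 + \<bar>c * real_of_int q + b\<bar>) powr - 2) \<le> C"
    using sum_int_affine_bound[OF assms] by blast
  show ?thesis
  proof (rule that[OF C(1)])
    fix z :: "'k \<Rightarrow> real" and b :: real and M :: nat and m0
    assume z: "c0 \<le> \<bar>z m0\<bar>"
    let ?I = "{- int M..int M}" and ?S = "UNIV - {m0}"
    have ins: "UNIV = insert m0 ?S" by auto
    have "(\<Sum>q\<in>PiE UNIV (\<lambda>_. ?I). (1 + \<bar>(\<Sum>m\<in>UNIV. real_of_int (q m) * z m) + b\<bar>) powr - 2)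
      = (\<Sum>q\<in>(\<lambda>(y, g). g(m0 := y)) ` (?I \<times> PiE ?S (\<lambda>_. ?I)). (1 + \<bar>(\<Sum>m\<in>UNIV. real_of_int (q m) * z m) + b\<bar>) powr - 2)"
      using PiE_insert_eq[of m0 ?S "\<lambda>_. ?I"] ins by simp
    also have "\<dots> = (\<Sum>(y, g)\<in>?I \<times> PiE ?S (\<lambda>_. ?I). (1 + \<bar>(\<Sum>m\<in>UNIV. real_of_int ((g(m0 := y)) m) * z m) + b\<bar>) powr - 2)"
      by (subst sum.reindex[OF inj_combinator]) (auto simp: case_prod_beta)
    also have "\<dots> = (\<Sum>g\<in>PiE ?S (\<lambda>_. ?I). \<Sum>y\<in>?I. (1 + \<bar>(\<Sum>m\<in>UNIV. real_of_int ((g(m0 := y)) m) * z m) + b\<bar>) powr - 2)"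
      by (simp add: sum.cartesian_product[symmetric]) (rule sum.swap)
    also have "\<dots> \<le> (\<Sum>g\<in>PiE ?S (\<lambda>_. ?I). C)"
    proof (rule sum_mono)
      fix g :: "'k \<Rightarrow> int"
      have "(\<Sum>m\<in>UNIV. real_of_int ((g(m0 := y)) m) * z m) = z m0 * real_of_int y + (\<Sum>m\<in>?S. real_of_int (g m) * z m)" for y
        by (subst ins, subst sum.insert) (auto intro: sum.cong)
      then show "(\<Sum>y\<in>?I. (1 + \<bar>(\<Sum>m\<in>UNIV. real_of_int ((g(m0 := y)) m) * z m) + b\<bar>) powr - 2) \<le> C"
        using C(2)[OF _ z, of ?I "(\<Sum>m\<in>?S. real_of_int (g m) * z m) + b"] by (simp add: add.assoc)
    qed
    also have "\<dots> = C * real (2 * M + 1) ^ (CARD('k) - 1)"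
      by (simp add: card_PiE add.commute mult.commute)
    finally show "(\<Sum>q\<in>PiE UNIV (\<lambda>_. ?I). (1 + \<bar>(\<Sum>m\<in>UNIV. real_of_int (q m) * z m) + b\<bar>) powr - 2)
      \<le> C * real (2 * M + 1) ^ (CARD('k) - 1)" .
  qed
qed

lemma prod_weight_vec: "prod_weight a (x :: real ^ 'n) = (\<Prod>i\<in>UNIV. (1 + \<bar>x $ i\<bar>) powr - a)"
proof -
  have B: "(Basis :: (real ^ 'n) set) = (\<lambda>i. axis i 1) ` UNIV" by (auto simp: Basis_vec_def)
  have "inj (\<lambda>i::'n. axis i (1::real))" by (auto simp: inj_on_def axis_eq_axis)
  then show ?thesis unfolding prod_weight_def B
    by (subst prod.reindex) (auto simp: inner_axis)
qed

text \<open>The range of such a matrix is a graph over the coordinate plane selected by \<open>e\<close>, so this is a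
  bounded piece of an affine chart of the Grassmannian.\<close>

definition graph_chart :: "('k \<Rightarrow> 'd) \<Rightarrow> nat \<Rightarrow> (real ^ 'k ^ 'd) set" where
  "graph_chart e n = {A. (\<forall>m. A $ e m = axis m 1) \<and> (\<forall>i m. \<bar>A $ i $ m\<bar> \<le> real n)}"

lemma graph_chart_mult_vec:
  fixes A :: "real ^ 'k ^ 'd"
  assumes "A \<in> graph_chart e n"
  shows "(A *v y) $ e m = y $ m"
proof -
  have "A $ e m = axis m 1" using assms by (simp add: graph_chart_def)
  then show ?thesis by (simp add: matrix_vector_mul_component inner_axis' )
qed

text \<open>The weight factors over the rows. Those in \<open>range e\<close> copy \<open>y\<close>
  and are the same for all cells; each of the remaining d - k rows is, up to a bounded error, an
  integer combination of the numbers \<open>y $ m / 2 ^ j\<close> and falls under the lattice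
  bound.\<close>

lemma sum_cells_prod_weight_bound:
  fixes e :: "'k::finite \<Rightarrow> 'd::finite"
  assumes e: "inj e"
  obtains K where "0 \<le> K"
    "\<And>j M Q A (y :: real ^ 'k) (x :: real ^ 'd). j \<ge> 1 \<Longrightarrow> 2 ^ j \<le> 1 + norm y \<Longrightarrow> 1 + norm y < 2 ^ Suc j \<Longrightarrow>
      Q \<subseteq> PiE (- range e) (\<lambda>_. PiE UNIV (\<lambda>_. {- int M..int M})) \<Longrightarrow>
      (\<And>q. q \<in> Q \<Longrightarrow> A q \<in> graph_chart e n) \<Longrightarrow>
      (\<And>q i m. q \<in> Q \<Longrightarrow> i \<notin> range e \<Longrightarrow> \<bar>A q $ i $ m - real_of_int (q i m) / 2 ^ j\<bar> \<le> 1 / 2 ^ j) \<Longrightarrow>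
      (\<Sum>q\<in>Q. prod_weight 2 (A q *v y - x)) \<le>
        K * real (2 * M + 1) ^ ((CARD('k) - 1) * (CARD('d) - CARD('k))) * prod_weight 2 (y - (\<chi> m. x $ e m))"
proof -
  let ?k = "real CARD('k)" and ?D = "CARD('d) - CARD('k)"
  have kpos: "?k \<ge> 1" by (simp add: Suc_leI)
  then have "1 / (2 * ?k) > 0" by simp
  from sum_lattice_strip_bound[OF this] obtain C where C: "0 \<le> C"
    "\<And>(z::'k::finite \<Rightarrow> real) b (M::nat) m0. 1 / (2 * ?k) \<le> \<bar>z m0\<bar> \<Longrightarrow>
    (\<Sum>q\<in>PiE UNIV (\<lambda>_. {- int M..int M}). (1 + \<bar>(\<Sum>m\<in>UNIV. real_of_int (q m) * z m) + b\<bar>) powr - 2)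
      \<le> C * real (2 * M + 1) ^ (CARD('k) - 1)" by blast
  \<comment> \<open>Replacing the entries by \<open>q i m / 2 ^ j\<close> moves a coordinate of A y
    by at most k 2^(-j) 2^(j+1) = 2k, which \<open>?L\<close> absorbs.\<close>
  let ?L = "1 + 2 * ?k"
  let ?K = "(?L powr 2 * C) ^ ?D"
  show ?thesis
  proof (rule that[of ?K])
    show "0 \<le> ?K" using C by simp
    fix j :: nat and M Q A and y :: "real ^ 'k" and x :: "real ^ 'd"
    assume j: "j \<ge> 1" "2 ^ j \<le> 1 + norm y" "1 + norm y < 2 ^ Suc j"
      and Q: "Q \<subseteq> PiE (- range e) (\<lambda>_. PiE UNIV (\<lambda>_. {- int M..int M}))"
      and A: "\<And>q. q \<in> Q \<Longrightarrow> A q \<in> graph_chart e n"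
      and Aq: "\<And>q i m. q \<in> Q \<Longrightarrow> i \<notin> range e \<Longrightarrow> \<bar>A q $ i $ m - real_of_int (q i m) / 2 ^ j\<bar> \<le> 1 / 2 ^ j"
    let ?P = "PiE UNIV (\<lambda>_::'k. {- int M..int M})"
    have finP: "finite ?P" by (intro finite_PiE) auto
    have cardc: "card (- range e) = ?D" using e by (simp add: Compl_eq_Diff_UNIV card_Diff_subset card_image)
    \<comment> \<open>Scaled to unit size. For \<open>j \<ge> 1\<close> the norm of \<open>y\<close>
      is at least 2^j - 1 \<ge> 2^j / 2, so some coordinate of \<open>z\<close> has modulus at least
      1 / (2k); for \<open>j = 0\<close> the point \<open>y\<close> could be 0.\<close>
    define z where "z = (\<lambda>m. y $ m / 2 ^ j)"
    have "\<exists>m0. 1 / (2 * ?k) \<le> \<bar>z m0\<bar>"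
    proof (rule ccontr)
      assume "\<not> ?thesis"
      then have lt: "\<bar>y $ m\<bar> < 2 ^ j / (2 * ?k)" for m
        using kpos by (auto simp: z_def not_le field_simps)
      have "norm y \<le> (\<Sum>m\<in>UNIV. \<bar>y $ m\<bar>)" by (rule norm_le_l1_cart)
      also have "\<dots> < (\<Sum>m\<in>(UNIV::'k set). 2 ^ j / (2 * ?k))" by (intro sum_strict_mono lt) auto
      also have "\<dots> = 2 ^ j / 2" using kpos by simp
      finally have "2 ^ j < 1 + 2 ^ j / (2::real)" using j by linarith
      then have "2 ^ j < (2::real)" by linarith
      moreover have "(2::real) ^ 1 \<le> 2 ^ j" using j by (intro power_increasing) auto
      ultimately show False by simp
    qed
    then obtain m0 where m0: "1 / (2 * ?k) \<le> \<bar>z m0\<bar>" by blast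
    define h where "h = (\<lambda>i q. (1 + \<bar>(\<Sum>m\<in>UNIV. real_of_int (q m) * z m) + - x $ i\<bar>) powr - 2)"
    have summand: "prod_weight 2 (A q *v y - x) \<le> prod_weight 2 (y - (\<chi> m. x $ e m)) * (\<Prod>i\<in>- range e. ?L powr 2 * h i (q i))"
      if q: "q \<in> Q" for q
    proof -
      have "prod_weight 2 (A q *v y - x) = (\<Prod>i\<in>range e. (1 + \<bar>(A q *v y - x) $ i\<bar>) powr - 2) * (\<Prod>i\<in>- range e. (1 + \<bar>(A q *v y - x) $ i\<bar>) powr - 2)"
        unfolding prod_weight_vec by (subst prod.union_disjoint[symmetric]) (auto simp: Un_commute)
      also have "(\<Prod>i\<in>range e. (1 + \<bar>(A q *v y - x) $ i\<bar>) powr - 2) = prod_weight 2 (y - (\<chi> m. x $ e m))"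
        unfolding prod_weight_vec using graph_chart_mult_vec[OF A[OF q]] by (simp add: prod.reindex[OF e])
      also have "prod_weight 2 (y - (\<chi> m. x $ e m)) * (\<Prod>i\<in>- range e. (1 + \<bar>(A q *v y - x) $ i\<bar>) powr - 2)
         \<le> prod_weight 2 (y - (\<chi> m. x $ e m)) * (\<Prod>i\<in>- range e. ?L powr 2 * h i (q i))"
      proof (intro mult_left_mono prod_mono conjI prod_weight_nonneg)
        fix i assume i: "i \<in> - range e"
        have ym: "\<bar>y $ m\<bar> \<le> 2 * 2 ^ j" for m using component_le_norm_cart[of y m] j by simp
        have "\<bar>(A q *v y) $ i - (\<Sum>m\<in>UNIV. real_of_int (q i m) * z m)\<bar>
            = \<bar>\<Sum>m\<in>UNIV. (A q $ i $ m - real_of_int (q i m) / 2 ^ j) * y $ m\<bar>"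
          by (simp add: matrix_vector_mult_def z_def sum_subtractf[symmetric] algebra_simps)
        also have "\<dots> \<le> (\<Sum>m\<in>UNIV. \<bar>A q $ i $ m - real_of_int (q i m) / 2 ^ j\<bar> * \<bar>y $ m\<bar>)"
          by (rule order_trans[OF sum_abs]) (simp add: abs_mult)
        also have "\<dots> \<le> (\<Sum>m\<in>(UNIV::'k set). (1 / 2 ^ j) * (2 * 2 ^ j))"
          by (intro sum_mono mult_mono Aq q ym) (use i in auto)
        also have "\<dots> = 2 * ?k" by simp
        finally have "1 + \<bar>(\<Sum>m\<in>UNIV. real_of_int (q i m) * z m) + - x $ i\<bar> \<le> 1 + \<bar>(A q *v y - x) $ i\<bar> + 2 * ?k"
          by simp
        also have "\<dots> \<le> ?L * (1 + \<bar>(A q *v y - x) $ i\<bar>)" using kpos by (simp add: algebra_simps)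
        finally have "(1 + \<bar>(\<Sum>m\<in>UNIV. real_of_int (q i m) * z m) + - x $ i\<bar>) / ?L \<le> 1 + \<bar>(A q *v y - x) $ i\<bar>"
          using kpos by (simp add: pos_divide_le_eq mult.commute)
        then have "(1 + \<bar>(A q *v y - x) $ i\<bar>) powr - 2 \<le> ((1 + \<bar>(\<Sum>m\<in>UNIV. real_of_int (q i m) * z m) + - x $ i\<bar>) / ?L) powr - 2"
          using kpos by (intro powr_mono2') (auto intro!: divide_pos_pos)
        also have "\<dots> = ?L powr 2 * h i (q i)"
          unfolding h_def using kpos by (subst powr_divide) (auto simp: powr_minus_divide)
        finally show "(1 + \<bar>(A q *v y - x) $ i\<bar>) powr - 2 \<le> ?L powr 2 * h i (q i)" .
      qed auto
      finally show ?thesis .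
    qed
    have hn: "0 \<le> h i q" for i q by (simp add: h_def)
    have "(\<Sum>q\<in>Q. prod_weight 2 (A q *v y - x))
       \<le> (\<Sum>q\<in>Q. prod_weight 2 (y - (\<chi> m. x $ e m)) * (\<Prod>i\<in>- range e. ?L powr 2 * h i (q i)))"
      by (intro sum_mono summand)
    also have "\<dots> \<le> (\<Sum>q\<in>PiE (- range e) (\<lambda>_. ?P). prod_weight 2 (y - (\<chi> m. x $ e m)) * (\<Prod>i\<in>- range e. ?L powr 2 * h i (q i)))"
      using Q finP by (intro sum_mono2 finite_PiE mult_nonneg_nonneg prod_nonneg prod_weight_nonneg hn ballI) auto
    \<comment> \<open>The rows of \<open>q\<close> range independently, so the sum of products is
      the product over the free rows of the row sums.\<close>
    also have "\<dots> = prod_weight 2 (y - (\<chi> m. x $ e m)) * (\<Prod>i\<in>- range e. \<Sum>q\<in>?P. ?L powr 2 * h i q)"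
      by (subst prod_sum_PiE) (use finP in \<open>auto simp: sum_distrib_left\<close>)
    also have "\<dots> \<le> prod_weight 2 (y - (\<chi> m. x $ e m)) * (\<Prod>i\<in>- range e. ?L powr 2 * (C * real (2 * M + 1) ^ (CARD('k) - 1)))"
    proof (intro mult_left_mono prod_mono conjI prod_weight_nonneg)
      fix i
      show "0 \<le> (\<Sum>q\<in>?P. ?L powr 2 * h i q)" by (intro sum_nonneg mult_nonneg_nonneg hn) auto
      show "(\<Sum>q\<in>?P. ?L powr 2 * h i q) \<le> ?L powr 2 * (C * real (2 * M + 1) ^ (CARD('k) - 1))"
        unfolding sum_distrib_left[symmetric] h_def by (rule mult_left_mono[OF C(2)[of z m0, OF m0]]) simp
    qed
    also have "\<dots> = ?K * real (2 * M + 1) ^ ((CARD('k) - 1) * ?D) * prod_weight 2 (y - (\<chi> m. x $ e m))"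
      by (simp only: prod_constant cardc power_mult_distrib power_mult mult_ac)
    finally show "(\<Sum>q\<in>Q. prod_weight 2 (A q *v y - x)) \<le>
        ?K * real (2 * M + 1) ^ ((CARD('k) - 1) * ?D) * prod_weight 2 (y - (\<chi> m. x $ e m))" .
  qed
qed

section \<open>Comparison of weights\<close>

lemma powr_comparable:
  fixes p q L s :: real
  assumes "0 < p" "0 < q" "p \<le> L * q" "q \<le> L * p" "1 \<le> L"
  shows "p powr s \<le> L powr \<bar>s\<bar> * q powr s"
proof (cases "s \<ge> 0")
  case True
  have "p powr s \<le> (L * q) powr s" using assms True by (intro powr_mono2) auto
  then show ?thesis using True assms by (simp add: powr_mult)
next
  case False
  have "q / L \<le> p" using assms by (simp add: divide_le_eq mult.commute)
  then have "p powr s \<le> (q / L) powr s" using assms False by (intro powr_mono2') auto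
  then show ?thesis using False assms by (simp add: powr_divide powr_minus_divide)
qed

text \<open>Both signs of \<open>a\<close> rest on 1 + |u| \<le> (1 + |v|)(1 + |u - v|); for
  negative \<open>a\<close> the roles of \<open>u\<close> and \<open>v\<close> are
  exchanged.\<close>

lemma peetre_inequality:
  fixes u v :: "'a::real_normed_vector"
  shows "(1 + norm u) powr a \<le> (1 + norm v) powr a * (1 + norm (u - v)) powr \<bar>a\<bar>"
proof -
  have 1: "1 + norm u \<le> (1 + norm v) * (1 + norm (u - v))" for u v :: 'a
  proof -
    have "norm u \<le> norm v + norm (u - v)" using norm_triangle_sub by blast
    moreover have "0 \<le> norm v * norm (u - v)" by simp
    moreover have "(1 + norm v) * (1 + norm (u - v)) = 1 + norm v + norm (u - v) + norm v * norm (u - v)"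
      by (simp add: algebra_simps)
    ultimately show ?thesis by linarith
  qed
  show ?thesis
  proof (cases "a \<ge> 0")
    case True
    have "(1 + norm u) powr a \<le> ((1 + norm v) * (1 + norm (u - v))) powr a"
      using True 1 by (intro powr_mono2) auto
    then show ?thesis using True by (simp add: powr_mult)
  next
    case False
    have "(1 + norm v) / (1 + norm (u - v)) \<le> 1 + norm u"
      using 1[of v u] by (simp add: divide_le_eq norm_minus_commute add_pos_nonneg)
    then have "(1 + norm u) powr a \<le> ((1 + norm v) / (1 + norm (u - v))) powr a"
      using False by (intro powr_mono2') (auto intro!: divide_pos_pos add_pos_nonneg)
    also have "\<dots> = (1 + norm v) powr a * (1 + norm (u - v)) powr \<bar>a\<bar>"
      using False by (simp add: powr_divide powr_minus_divide)
    finally show ?thesis .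
  qed
qed

lemma powr_dyadic_le:
  fixes r s :: real
  assumes "2 ^ j \<le> r" "r < 2 ^ Suc j"
  shows "r powr s \<le> 2 powr \<bar>s\<bar> * 2 powr (s * real j)"
proof -
  have r: "1 \<le> r / 2 ^ j" "r / 2 ^ j \<le> 2" using assms by (auto simp: field_simps)
  then have r0: "0 \<le> r / 2 ^ j" by linarith
  have "(r / 2 ^ j) powr s \<le> (r / 2 ^ j) powr \<bar>s\<bar>" using r by (intro powr_mono) auto
  also have "\<dots> \<le> 2 powr \<bar>s\<bar>" using r r0 by (intro powr_mono2) auto
  finally have "(r / 2 ^ j) powr s \<le> 2 powr \<bar>s\<bar>" .
  moreover have "0 < r" using assms by (intro less_le_trans[of 0 "2 ^ j" r]) auto
  moreover have "(2 ^ j) powr s = 2 powr (s * real j)" by (simp add: powr_powr mult.commute flip: powr_realpow)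
  ultimately show ?thesis by (simp add: powr_divide divide_le_eq)
qed

lemma one_plus_sum_le_prod:
  fixes h :: "'b \<Rightarrow> real"
  assumes "finite B" "\<And>b. b \<in> B \<Longrightarrow> 0 \<le> h b"
  shows "1 + (\<Sum>b\<in>B. h b) \<le> (\<Prod>b\<in>B. 1 + h b)"
  using assms
proof (induction B rule: finite_induct)
  case (insert b B)
  have "1 + (h b + sum h B) \<le> (1 + h b) * (1 + sum h B)"
    using insert.prems by (simp add: algebra_simps sum_nonneg)
  also have "\<dots> \<le> (1 + h b) * (\<Prod>b\<in>B. 1 + h b)"
    using insert by (intro mult_left_mono) auto
  finally show ?case using insert by simp
qed simp

text \<open>1 + |v| is at most the product of the factors 1 + |v . b|, so the power \<open>c\<close>
  can be charged to every coordinate. This pays for the Peetre factor: the exponent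
  \<open>N + 2\<close> with \<open>N\<close> at least |a| leaves 2.\<close>

lemma prod_weight_absorb:
  fixes v :: "'a::euclidean_space"
  assumes "0 \<le> c" "b + c \<le> a"
  shows "prod_weight a v * (1 + norm v) powr c \<le> prod_weight b v"
proof -
  have "1 + norm v \<le> 1 + (\<Sum>b\<in>Basis. \<bar>v \<bullet> b\<bar>)" using norm_le_l1[of v] by simp
  also have "\<dots> \<le> (\<Prod>b\<in>Basis. 1 + \<bar>v \<bullet> b\<bar>)" by (rule one_plus_sum_le_prod) auto
  finally have "(1 + norm v) powr c \<le> (\<Prod>b\<in>Basis. 1 + \<bar>v \<bullet> b\<bar>) powr c"
    using assms by (intro powr_mono2) auto
  also have "\<dots> = (\<Prod>b\<in>Basis. (1 + \<bar>v \<bullet> b\<bar>) powr c)" by (rule prod_powr_distrib)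
  finally have "prod_weight a v * (1 + norm v) powr c \<le> prod_weight a v * (\<Prod>b\<in>Basis. (1 + \<bar>v \<bullet> b\<bar>) powr c)"
    by (intro mult_left_mono prod_weight_nonneg)
  also have "\<dots> = (\<Prod>b\<in>Basis. (1 + \<bar>v \<bullet> b\<bar>) powr (c - a))"
    by (simp add: prod_weight_def powr_add[symmetric] flip: prod.distrib)
  also have "\<dots> \<le> prod_weight b v"
    unfolding prod_weight_def using assms by (intro prod_mono) (auto intro!: powr_mono)
  finally show ?thesis .
qed

text \<open>The entries of \<open>A *v y\<close> selected by \<open>e\<close> are those of
  \<open>y\<close>.\<close>

lemma norm_le_graph_chart:
  fixes A :: "real ^ 'k ^ 'd"
  assumes "inj e" "A \<in> graph_chart e n"
  shows "norm y \<le> norm (A *v y)"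
proof -
  have "(\<Sum>m\<in>UNIV. (y $ m)\<^sup>2) = (\<Sum>i\<in>range e. ((A *v y) $ i)\<^sup>2)"
    using graph_chart_mult_vec[OF assms(2)] by (simp add: sum.reindex[OF assms(1)])
  also have "\<dots> \<le> (\<Sum>i\<in>UNIV. ((A *v y) $ i)\<^sup>2)" by (intro sum_mono2) auto
  finally show ?thesis by (simp add: norm_vec_def L2_set_def)
qed

lemma graph_chart_norm_le:
  fixes A :: "real ^ 'k ^ 'd"
  assumes "A \<in> graph_chart e n"
  shows "norm (A *v y) \<le> (real CARD('d) * real CARD('k) * real n) * norm y"
proof -
  have "norm (A *v y) \<le> (\<Sum>i\<in>UNIV. \<bar>(A *v y) $ i\<bar>)" by (rule norm_le_l1_cart)
  also have "\<dots> \<le> (\<Sum>i\<in>(UNIV::'d set). \<Sum>m\<in>(UNIV::'k set). real n * norm y)"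
  proof (rule sum_mono)
    fix i :: 'd
    have "\<bar>(A *v y) $ i\<bar> \<le> (\<Sum>m\<in>UNIV. \<bar>A $ i $ m * y $ m\<bar>)"
      by (simp add: matrix_vector_mult_def)
    also have "\<dots> \<le> (\<Sum>m\<in>(UNIV::'k set). real n * norm y)"
      using assms component_le_norm_cart[of y]
      by (intro sum_mono) (auto simp: abs_mult graph_chart_def intro!: mult_mono)
    finally show "\<bar>(A *v y) $ i\<bar> \<le> (\<Sum>m\<in>(UNIV::'k set). real n * norm y)" .
  qed
  finally show ?thesis by (simp add: mult_ac)
qed

text \<open>With 1 + norm in place of norm the shells start at \<open>j = 0\<close> with the open
  unit ball and cover the whole space.\<close>

definition shell :: "nat \<Rightarrow> 'a::real_normed_vector set" where
  "shell j = {y. 2 ^ j \<le> 1 + norm y \<and> 1 + norm y < 2 ^ Suc j}"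

lemma shell_borel[measurable]: "shell j \<in> sets (borel :: 'a::euclidean_space measure)"
  unfolding shell_def by measurable

text \<open>The cells, of side length \<open>2\<^sup>-\<^sup>j\<close>, are indexed by the integer parts of the free entries; \<open>A q\<close>
  is any member of the cell \<open>q\<close>.\<close>

lemma sum_shell_integrals_bound:
  fixes F :: "real ^ 'd \<Rightarrow> real" and e :: "'k::finite \<Rightarrow> 'd::finite"
  assumes e: "inj e" and F[measurable]: "F \<in> borel_measurable borel" and F0: "\<And>x. 0 \<le> F x"
    and C: "0 \<le> C" "\<bar>a\<bar> \<le> real N"
      "\<And>x. ennreal (F x) \<le> ennreal C * (\<integral>\<^sup>+z. ennreal (F z * prod_weight (real (N + 2)) (x - z)) \<partial>lborel)"
    and fin: "(\<integral>\<^sup>+z. ennreal (F z * (1 + norm z) powr a) \<partial>lborel) < \<infinity>"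
  obtains K where "0 \<le> K"
    "\<And>j Q A. j \<ge> 1 \<Longrightarrow>
      Q \<subseteq> PiE (- range e) (\<lambda>_. PiE UNIV (\<lambda>_. {- int (n * 2 ^ j)..int (n * 2 ^ j)})) \<Longrightarrow>
      (\<And>q. q \<in> Q \<Longrightarrow> A q \<in> graph_chart e n) \<Longrightarrow>
      (\<And>q i m. q \<in> Q \<Longrightarrow> i \<notin> range e \<Longrightarrow> \<bar>A q $ i $ m - real_of_int (q i m) / 2 ^ j\<bar> \<le> 1 / 2 ^ j) \<Longrightarrow>
      (\<Sum>q\<in>Q. \<integral>\<^sup>+y. ennreal (F (A q *v y) * (1 + norm y) powr \<sigma>) * indicator (shell j) y \<partial>lborel)
      \<le> ennreal (K * 2 powr (real j * (\<sigma> - a + (real CARD('k) - 1) * (real CARD('d) - real CARD('k)))))"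
proof -
  let ?D = "(CARD('k) - 1) * (CARD('d) - CARD('k))"
  obtain K2 where K2: "0 \<le> K2"
    "\<And>j M Q A (y :: real ^ 'k) (x :: real ^ 'd). j \<ge> 1 \<Longrightarrow> 2 ^ j \<le> 1 + norm y \<Longrightarrow> 1 + norm y < 2 ^ Suc j \<Longrightarrow>
      Q \<subseteq> PiE (- range e) (\<lambda>_. PiE UNIV (\<lambda>_. {- int M..int M})) \<Longrightarrow>
      (\<And>q. q \<in> Q \<Longrightarrow> A q \<in> graph_chart e n) \<Longrightarrow>
      (\<And>q i m. q \<in> Q \<Longrightarrow> i \<notin> range e \<Longrightarrow> \<bar>A q $ i $ m - real_of_int (q i m) / 2 ^ j\<bar> \<le> 1 / 2 ^ j) \<Longrightarrow>
      (\<Sum>q\<in>Q. prod_weight 2 (A q *v y - x)) \<le>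
        K2 * real (2 * M + 1) ^ ?D * prod_weight 2 (y - (\<chi> m. x $ e m))"
    using sum_cells_prod_weight_bound[OF e, of n] by blast
  define I where "I = enn2real (\<integral>\<^sup>+z. ennreal (F z * (1 + norm z) powr a) \<partial>lborel)"
  have I: "(\<integral>\<^sup>+z. ennreal (F z * (1 + norm z) powr a) \<partial>lborel) = ennreal I" "0 \<le> I"
    using fin by (auto simp: I_def)
  define W where "W = enn2real (\<integral>\<^sup>+y. ennreal (prod_weight 2 (y::real^'k)) \<partial>lborel)"
  have W: "(\<integral>\<^sup>+y. ennreal (prod_weight 2 (y::real^'k)) \<partial>lborel) = ennreal W" "0 \<le> W"
    using nn_integral_prod_weight_finite[of 2, where 'a="real^'k"] by (auto simp: W_def)
  \<comment> \<open>One more than a bound for |A y| / |y| on the chart; as also |A y| \<ge> |y|, the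
    weights at y and at A y are comparable with this constant.\<close>
  define L where "L = 1 + real CARD('d) * real CARD('k) * real n"
  have L: "1 \<le> L" by (simp add: L_def)
  define K1 where "K1 = 2 powr \<bar>\<sigma> - a\<bar> * L powr \<bar>a\<bar> * C"
  have K1: "0 \<le> K1" using C L by (simp add: K1_def)
  define K where "K = K1 * (K2 * (2 * real n + 1) ^ ?D) * (W * I)"
  show ?thesis
  proof (rule that[of K])
    show "0 \<le> K" using K1 K2 W I by (simp add: K_def)
    fix j :: nat and Q and A :: "('d \<Rightarrow> 'k \<Rightarrow> int) \<Rightarrow> real ^ 'k ^ 'd"
    assume j: "j \<ge> 1"
      and Q: "Q \<subseteq> PiE (- range e) (\<lambda>_. PiE UNIV (\<lambda>_. {- int (n * 2 ^ j)..int (n * 2 ^ j)}))"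
      and A: "\<And>q. q \<in> Q \<Longrightarrow> A q \<in> graph_chart e n"
      and Aq: "\<And>q i m. q \<in> Q \<Longrightarrow> i \<notin> range e \<Longrightarrow> \<bar>A q $ i $ m - real_of_int (q i m) / 2 ^ j\<bar> \<le> 1 / 2 ^ j"
    let ?w = "\<lambda>z. F z * (1 + norm z) powr a"
    let ?P = "2 powr ((\<sigma> - a) * real j)"
    have finQ: "finite Q" by (rule finite_subset[OF Q]) (intro finite_PiE; auto)+
    have cont: "continuous_on UNIV (\<lambda>y. B *v y)" for B :: "real ^ 'k ^ 'd"
      by (intro linear_continuous_on linear_linear[THEN iffD2]) (rule matrix_vector_mul_linear)
    have [measurable]: "(\<lambda>y. B *v y) \<in> borel_measurable borel" for B :: "real ^ 'k ^ 'd"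
      using cont by (rule borel_measurable_continuous_onI)
    have [measurable]: "(\<lambda>z::real^'d. \<chi> m. z $ e m) \<in> borel_measurable borel"
      by (intro borel_measurable_continuous_onI continuous_intros)
    \<comment> \<open>Three estimates in one: on the shell the exponent \<sigma> is traded for
      \<open>a\<close> at the cost \<open>?P\<close>; local averaging replaces \<open>F\<close> at A
      y by an average over z; Peetre's inequality moves the weight from A y to z.\<close>
    have pw: "ennreal (F (A q *v y) * (1 + norm y) powr \<sigma>) * indicator (shell j) y
       \<le> ennreal (K1 * ?P) * (\<integral>\<^sup>+z. ennreal (?w z * prod_weight 2 (A q *v y - z)) \<partial>lborel) * indicator (shell j) y"
      if q: "q \<in> Q" for q y
    proof (cases "y \<in> shell j")
      case True
      then have yj: "2 ^ j \<le> 1 + norm y" "1 + norm y < 2 ^ Suc j" by (auto simp: shell_def)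
      let ?u = "A q *v y"
      have sc: "(1 + norm y) powr a \<le> L powr \<bar>a\<bar> * (1 + norm ?u) powr a"
      proof -
        have "norm ?u \<le> (L - 1) * norm y" using graph_chart_norm_le[OF A[OF q], of y] by (simp add: L_def)
        also have "\<dots> \<le> L * norm y" by (intro mult_right_mono) auto
        finally have u: "norm y \<le> norm ?u" "1 + norm ?u \<le> L * (1 + norm y)"
          using norm_le_graph_chart[OF e A[OF q]] L by (simp, simp add: distrib_left)
        have "1 * (1 + norm y) \<le> L * (1 + norm ?u)"
          using u(1) L by (intro mult_mono) auto
        then show ?thesis
          using u(2) L by (intro powr_comparable) (auto simp: add_pos_nonneg)
      qed
      have "(1 + norm y) powr \<sigma> = (1 + norm y) powr (\<sigma> - a) * (1 + norm y) powr a"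
        by (simp flip: powr_add)
      also have "\<dots> \<le> (2 powr \<bar>\<sigma> - a\<bar> * ?P) * (L powr \<bar>a\<bar> * (1 + norm ?u) powr a)"
        by (intro mult_mono powr_dyadic_le yj sc) auto
      finally have s: "(1 + norm y) powr \<sigma> \<le> (2 powr \<bar>\<sigma> - a\<bar> * ?P * L powr \<bar>a\<bar>) * (1 + norm ?u) powr a"
        by (simp add: mult_ac)
      have "ennreal (F ?u * (1 + norm y) powr \<sigma>) = ennreal ((1 + norm y) powr \<sigma>) * ennreal (F ?u)"
        using F0 by (simp add: mult.commute flip: ennreal_mult')
      also have "\<dots> \<le> ennreal ((2 powr \<bar>\<sigma> - a\<bar> * ?P * L powr \<bar>a\<bar>) * (1 + norm ?u) powr a) *
         (ennreal C * (\<integral>\<^sup>+z. ennreal (F z * prod_weight (real (N + 2)) (?u - z)) \<partial>lborel))"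
        by (intro mult_mono ennreal_leI s C(3)) auto
      also have "\<dots> = ennreal (K1 * ?P) * (ennreal ((1 + norm ?u) powr a) * (\<integral>\<^sup>+z. ennreal (F z * prod_weight (real (N + 2)) (?u - z)) \<partial>lborel))"
        using C by (simp add: K1_def ennreal_mult' mult_ac)
      also have "ennreal ((1 + norm ?u) powr a) * (\<integral>\<^sup>+z. ennreal (F z * prod_weight (real (N + 2)) (?u - z)) \<partial>lborel)
         = (\<integral>\<^sup>+z. ennreal ((1 + norm ?u) powr a) * ennreal (F z * prod_weight (real (N + 2)) (?u - z)) \<partial>lborel)"
        by (rule nn_integral_cmult[symmetric]) measurable
      also have "\<dots> \<le> (\<integral>\<^sup>+z. ennreal (?w z * prod_weight 2 (?u - z)) \<partial>lborel)"
      proof (intro nn_integral_mono)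
        fix z
        have "(1 + norm ?u) powr a * (F z * prod_weight (real (N + 2)) (?u - z))
           \<le> ((1 + norm z) powr a * (1 + norm (?u - z)) powr \<bar>a\<bar>) * (F z * prod_weight (real (N + 2)) (?u - z))"
          by (intro mult_right_mono peetre_inequality mult_nonneg_nonneg F0 prod_weight_nonneg)
        also have "\<dots> = ?w z * (prod_weight (real (N + 2)) (?u - z) * (1 + norm (?u - z)) powr \<bar>a\<bar>)" by (simp add: mult_ac)
        also have "\<dots> \<le> ?w z * prod_weight 2 (?u - z)"
          using C(2) F0 by (intro mult_left_mono prod_weight_absorb) auto
        finally show "ennreal ((1 + norm ?u) powr a) * ennreal (F z * prod_weight (real (N + 2)) (?u - z)) \<le> ennreal (?w z * prod_weight 2 (?u - z))"
          by (simp add: ennreal_leI flip: ennreal_mult')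
      qed
      finally show ?thesis using True by (simp add: mult_left_mono)
    qed simp
    have "(\<Sum>q\<in>Q. \<integral>\<^sup>+y. ennreal (F (A q *v y) * (1 + norm y) powr \<sigma>) * indicator (shell j) y \<partial>lborel)
       \<le> (\<Sum>q\<in>Q. \<integral>\<^sup>+y. ennreal (K1 * ?P) * (\<integral>\<^sup>+z. ennreal (?w z * prod_weight 2 (A q *v y - z)) \<partial>lborel) * indicator (shell j) y \<partial>lborel)"
      by (intro sum_mono nn_integral_mono pw)
    also have "\<dots> = (\<integral>\<^sup>+y. (\<Sum>q\<in>Q. ennreal (K1 * ?P) * (\<integral>\<^sup>+z. ennreal (?w z * prod_weight 2 (A q *v y - z)) \<partial>lborel) * indicator (shell j) y) \<partial>lborel)"
      by (rule nn_integral_sum[symmetric]) measurable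
    \<comment> \<open>Entries of chart matrices are at most \<open>n\<close> in modulus, so cells of
      side 2^(-j) are numbered up to M = n 2^j. The sum over cells is taken under the
      z-integral.\<close>
    also have "\<dots> \<le> (\<integral>\<^sup>+y. ennreal (K1 * ?P * (K2 * real (2 * (n * 2 ^ j) + 1) ^ ?D)) * (\<integral>\<^sup>+z. ennreal (?w z) * ennreal (prod_weight 2 (y - (\<chi> m. z $ e m))) \<partial>lborel) \<partial>lborel)"
    proof (intro nn_integral_mono)
      fix y :: "real ^ 'k"
      show "(\<Sum>q\<in>Q. ennreal (K1 * ?P) * (\<integral>\<^sup>+z. ennreal (?w z * prod_weight 2 (A q *v y - z)) \<partial>lborel) * indicator (shell j) y)
        \<le> ennreal (K1 * ?P * (K2 * real (2 * (n * 2 ^ j) + 1) ^ ?D)) * (\<integral>\<^sup>+z. ennreal (?w z) * ennreal (prod_weight 2 (y - (\<chi> m. z $ e m))) \<partial>lborel)"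
      proof (cases "y \<in> shell j")
        case True
        then have yj: "2 ^ j \<le> 1 + norm y" "1 + norm y < 2 ^ Suc j" by (auto simp: shell_def)
        have "(\<Sum>q\<in>Q. ennreal (K1 * ?P) * (\<integral>\<^sup>+z. ennreal (?w z * prod_weight 2 (A q *v y - z)) \<partial>lborel) * indicator (shell j) y)
           = ennreal (K1 * ?P) * (\<Sum>q\<in>Q. (\<integral>\<^sup>+z. ennreal (?w z * prod_weight 2 (A q *v y - z)) \<partial>lborel))"
          using True by (simp add: sum_distrib_left)
        also have "(\<Sum>q\<in>Q. (\<integral>\<^sup>+z. ennreal (?w z * prod_weight 2 (A q *v y - z)) \<partial>lborel))
           = (\<integral>\<^sup>+z. (\<Sum>q\<in>Q. ennreal (?w z * prod_weight 2 (A q *v y - z))) \<partial>lborel)"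
          by (rule nn_integral_sum[symmetric]) measurable
        also have "\<dots> \<le> (\<integral>\<^sup>+z. ennreal (K2 * real (2 * (n * 2 ^ j) + 1) ^ ?D) * (ennreal (?w z) * ennreal (prod_weight 2 (y - (\<chi> m. z $ e m)))) \<partial>lborel)"
        proof (intro nn_integral_mono)
          fix z
          have "(\<Sum>q\<in>Q. ennreal (?w z * prod_weight 2 (A q *v y - z))) = ennreal (\<Sum>q\<in>Q. ?w z * prod_weight 2 (A q *v y - z))"
            using F0 by (intro sum_ennreal) (auto simp: prod_weight_nonneg)
          also have "(\<Sum>q\<in>Q. ?w z * prod_weight 2 (A q *v y - z)) = ?w z * (\<Sum>q\<in>Q. prod_weight 2 (A q *v y - z))"
            by (simp add: sum_distrib_left)
          also have "ennreal \<dots> \<le> ennreal (?w z * (K2 * real (2 * (n * 2 ^ j) + 1) ^ ?D * prod_weight 2 (y - (\<chi> m. z $ e m))))"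
            using F0 by (intro ennreal_leI mult_left_mono K2(2)[OF j yj Q A Aq]) auto
          also have "\<dots> = ennreal (K2 * real (2 * (n * 2 ^ j) + 1) ^ ?D) * (ennreal (?w z) * ennreal (prod_weight 2 (y - (\<chi> m. z $ e m))))"
            using F0 K2(1) by (simp add: mult_ac prod_weight_nonneg flip: ennreal_mult')
          finally show "(\<Sum>q\<in>Q. ennreal (?w z * prod_weight 2 (A q *v y - z)))
            \<le> ennreal (K2 * real (2 * (n * 2 ^ j) + 1) ^ ?D) * (ennreal (?w z) * ennreal (prod_weight 2 (y - (\<chi> m. z $ e m))))" .
        qed
        also have "\<dots> = ennreal (K2 * real (2 * (n * 2 ^ j) + 1) ^ ?D) * (\<integral>\<^sup>+z. ennreal (?w z) * ennreal (prod_weight 2 (y - (\<chi> m. z $ e m))) \<partial>lborel)"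
          by (rule nn_integral_cmult) measurable
        finally show ?thesis using K1 K2(1) by (simp add: mult_left_mono ennreal_mult' mult.assoc)
      qed simp
    qed
    also have "\<dots> = ennreal (K1 * ?P * (K2 * real (2 * (n * 2 ^ j) + 1) ^ ?D)) * (\<integral>\<^sup>+y. (\<integral>\<^sup>+z. ennreal (?w z) * ennreal (prod_weight 2 (y - (\<chi> m. z $ e m))) \<partial>lborel) \<partial>lborel)"
      by (rule nn_integral_cmult) measurable
    \<comment> \<open>After the exchange the y-integral of the weight does not depend on z, by
      translation invariance, and equals \<open>W\<close>; what remains is the integral assumed
      finite.\<close>
    also have "(\<integral>\<^sup>+y. (\<integral>\<^sup>+z. ennreal (?w z) * ennreal (prod_weight 2 (y - (\<chi> m. z $ e m))) \<partial>lborel) \<partial>lborel)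
       = (\<integral>\<^sup>+z. (\<integral>\<^sup>+y. ennreal (?w z) * ennreal (prod_weight 2 (y - (\<chi> m. z $ e m))) \<partial>lborel) \<partial>lborel)"
      by (rule lborel_pair.Fubini') measurable
    also have "\<dots> = (\<integral>\<^sup>+z. ennreal (?w z) * ennreal W \<partial>lborel)"
    proof (intro nn_integral_cong)
      fix z :: "real ^ 'd"
      have "(\<integral>\<^sup>+y. ennreal (?w z) * ennreal (prod_weight 2 (y - (\<chi> m. z $ e m))) \<partial>lborel)
        = ennreal (?w z) * (\<integral>\<^sup>+y. ennreal (prod_weight 2 (y - (\<chi> m. z $ e m))) \<partial>lborel)"
        by (rule nn_integral_cmult) measurable
      also have "(\<integral>\<^sup>+y. ennreal (prod_weight 2 (y - (\<chi> m. z $ e m))) \<partial>lborel) = ennreal W"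
        using nn_integral_lborel_translate[of "\<lambda>y. ennreal (prod_weight 2 y)" "\<chi> m. z $ e m"] W by simp
      finally show "(\<integral>\<^sup>+y. ennreal (?w z) * ennreal (prod_weight 2 (y - (\<chi> m. z $ e m))) \<partial>lborel) = ennreal (?w z) * ennreal W" .
    qed
    also have "\<dots> = ennreal (W * I)"
      using I W by (subst nn_integral_multc) (auto simp: ennreal_mult' mult.commute)
    also have "ennreal (K1 * ?P * (K2 * real (2 * (n * 2 ^ j) + 1) ^ ?D)) * ennreal (W * I)
       = ennreal (K1 * ?P * (K2 * real (2 * (n * 2 ^ j) + 1) ^ ?D) * (W * I))"
      using I W by (intro ennreal_mult''[symmetric] mult_nonneg_nonneg)
    also have "\<dots> \<le> ennreal (K * 2 powr (real j * (\<sigma> - a + (real CARD('k) - 1) * (real CARD('d) - real CARD('k)))))"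
    proof (rule ennreal_leI)
      have ineq: "real (2 * (n * 2 ^ j) + 1) ^ ?D \<le> ((2 * real n + 1) * 2 ^ j) ^ ?D"
        by (intro power_mono) (auto simp: algebra_simps)
      have "CARD('k) \<le> CARD('d)" using e by (metis card_inj_on_le finite top_greatest)
      then have D: "real ?D = (real CARD('k) - 1) * (real CARD('d) - real CARD('k))"
        by (simp add: of_nat_diff Suc_leI)
      have P: "?P * (2 ^ j) ^ ?D = 2 powr (real j * (\<sigma> - a + (real CARD('k) - 1) * (real CARD('d) - real CARD('k))))"
      proof -
        have "((2::real) ^ j) ^ ?D = 2 ^ (j * ?D)" by (rule power_mult[symmetric])
        also have "\<dots> = 2 powr real (j * ?D)" by (rule powr_realpow[symmetric]) simp
        also have "real (j * ?D) = real j * real ?D" by (rule of_nat_mult)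
        finally have "((2::real) ^ j) ^ ?D = 2 powr (real j * real ?D)" .
        then have "?P * (2 ^ j) ^ ?D = 2 powr ((\<sigma> - a) * real j + real j * ((real CARD('k) - 1) * (real CARD('d) - real CARD('k))))"
          by (simp only: D powr_add)
        then show ?thesis by (simp only: distrib_left mult.commute)
      qed
      have "K1 * ?P * (K2 * real (2 * (n * 2 ^ j) + 1) ^ ?D) * (W * I)
        \<le> K1 * ?P * (K2 * ((2 * real n + 1) * 2 ^ j) ^ ?D) * (W * I)"
        using K1 K2(1) W I by (intro mult_right_mono mult_left_mono ineq) auto
      also have "\<dots> = K * (?P * (2 ^ j) ^ ?D)" by (simp add: K_def power_mult_distrib mult_ac)
      finally show "K1 * ?P * (K2 * real (2 * (n * 2 ^ j) + 1) ^ ?D) * (W * I)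
        \<le> K * 2 powr (real j * (\<sigma> - a + (real CARD('k) - 1) * (real CARD('d) - real CARD('k))))" unfolding P .
    qed
    finally show "(\<Sum>q\<in>Q. \<integral>\<^sup>+y. ennreal (F (A q *v y) * (1 + norm y) powr \<sigma>) * indicator (shell j) y \<partial>lborel)
      \<le> ennreal (K * 2 powr (real j * (\<sigma> - a + (real CARD('k) - 1) * (real CARD('d) - real CARD('k)))))" .
  qed
qed

section \<open>Exceptional sets in a chart\<close>

lemma orth_proj_closest:
  assumes "subspace V" "v \<in> V"
  shows "norm (x - orth_proj V x) \<le> norm (x - v)"
proof -
  have "orthogonal (x - orth_proj V x) (orth_proj V x - v)"
    using orth_proj_props[OF assms(1)] assms by (intro orth_proj_props(2) subspace_diff)
  then have "norm ((x - orth_proj V x) + (orth_proj V x - v)) ^ 2 = norm (x - orth_proj V x) ^ 2 + norm (orth_proj V x - v) ^ 2"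
    by (rule norm_add_Pythagorean)
  then have "norm (x - orth_proj V x) ^ 2 \<le> norm (x - v) ^ 2" by simp
  then show ?thesis by (rule power2_le_imp_le) simp
qed

lemma norm_orth_proj:
  assumes "subspace V"
  shows "norm (orth_proj V x) \<le> norm x" "norm (x - orth_proj V x) \<le> norm x"
proof -
  have "orthogonal (x - orth_proj V x) (orth_proj V x)"
    using orth_proj_props[OF assms] by blast
  then have "norm ((x - orth_proj V x) + orth_proj V x) ^ 2 = norm (x - orth_proj V x) ^ 2 + norm (orth_proj V x) ^ 2"
    by (rule norm_add_Pythagorean)
  then have "norm (orth_proj V x) ^ 2 \<le> norm x ^ 2" by simp
  then show "norm (orth_proj V x) \<le> norm x" by (rule power2_le_imp_le) simp
  show "norm (x - orth_proj V x) \<le> norm x"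
    using orth_proj_closest[OF assms subspace_0[OF assms], of x] by simp
qed

text \<open>With w = P_W x and u = x - w one has P_V x - P_W x = (P_V w - w) + P_V u. The first term
  is small because vectors of \<open>W\<close> are near \<open>V\<close>, the second, by duality,
  because vectors of \<open>V\<close> are near \<open>W\<close>.\<close>

lemma dist_proj_op_le:
  assumes V: "subspace V" and W: "subspace W" and L: "0 \<le> L"
    and VW: "\<And>v. v \<in> V \<Longrightarrow> \<exists>w\<in>W. norm (v - w) \<le> L * norm v"
    and WV: "\<And>w. w \<in> W \<Longrightarrow> \<exists>v\<in>V. norm (w - v) \<le> L * norm w"
  shows "dist (proj_op V) (proj_op W) \<le> 2 * L"
proof -
  note pV = orth_proj_props[OF V] and pW = orth_proj_props[OF W]
  have add: "orth_proj V (x + y) = orth_proj V x + orth_proj V y" for x y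
    using bounded_linear_orth_proj[OF V] by (simp add: linear_add bounded_linear.linear)
  \<comment> \<open>For u orthogonal to \<open>W\<close> and v = P_V u one has |v|^2 = v . u = (v -
    P_W v) . u, and v - P_W v is short.\<close>
  have far: "norm (orth_proj V u) \<le> L * norm u" if u: "\<And>w. w \<in> W \<Longrightarrow> orthogonal u w" for u
  proof (cases "orth_proj V u = 0")
    case False
    let ?v = "orth_proj V u"
    have "norm ?v * norm ?v = ?v \<bullet> u"
      using pV(2)[OF pV(1), of u u] by (simp add: orthogonal_def inner_diff_left inner_diff_right inner_commute power2_norm_eq_inner flip: power2_eq_square)
    also have "\<dots> = (?v - orth_proj W ?v) \<bullet> u"
      using u[OF pW(1)[of ?v]] by (simp add: orthogonal_def inner_diff_left inner_diff_right inner_commute)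
    also have "\<dots> \<le> norm (?v - orth_proj W ?v) * norm u" by (rule norm_cauchy_schwarz)
    also have "norm (?v - orth_proj W ?v) \<le> L * norm ?v"
      using VW[OF pV(1)] orth_proj_closest[OF W] order_trans by blast
    finally have "norm ?v * norm ?v \<le> norm ?v * (L * norm u)" by (simp add: mult_right_mono mult_ac)
    then show ?thesis using False by simp
  qed (use L in simp)
  show ?thesis unfolding dist_proj_op[OF V W]
  proof (rule onorm_le)
    fix x
    define w u where "w = orth_proj W x" and "u = x - orth_proj W x"
    have "w \<in> W" using pW by (simp add: w_def)
    have "norm (w - orth_proj V w) \<le> L * norm w"
      using WV[OF \<open>w \<in> W\<close>] orth_proj_closest[OF V] order_trans by blast
    moreover have "norm (orth_proj V u) \<le> L * norm u"
      using pW(2) by (intro far) (simp add: u_def)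
    moreover have "L * norm w \<le> L * norm x" "L * norm u \<le> L * norm x"
      using norm_orth_proj[OF W, of x] L by (auto simp: w_def u_def intro: mult_left_mono)
    moreover have "orth_proj V x - orth_proj W x = - (w - orth_proj V w) + orth_proj V u"
      using add[of w u] by (simp add: w_def u_def)
    then have "norm (orth_proj V x - orth_proj W x) \<le> norm (w - orth_proj V w) + norm (orth_proj V u)"
      by (metis norm_triangle_ineq norm_minus_cancel)
    ultimately show "norm (orth_proj V x - orth_proj W x) \<le> 2 * L * norm x" by linarith
  qed
qed

lemma subspace_range_matrix: "subspace (range ((*v) (A :: real ^ 'k ^ 'd)))"
  by (intro linear_subspace_image subspace_UNIV matrix_vector_mul_linear)

text \<open>Points with the same parameter y are compared; the error is relative to |y|, which is at
  most the norm of either point. Hence the chart is Lipschitz, and cells of side 2^(-j) have images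
  of diameter of that order.\<close>

lemma dist_proj_op_graph_chart:
  fixes A B :: "real ^ 'k ^ 'd"
  assumes e: "inj e" and A: "A \<in> graph_chart e n" and B: "B \<in> graph_chart e n"
    and \<delta>: "\<And>i m. \<bar>A $ i $ m - B $ i $ m\<bar> \<le> \<delta>"
  shows "dist (proj_op (range ((*v) A))) (proj_op (range ((*v) B))) \<le> 2 * (real CARD('d) * real CARD('k) * \<delta>)"
proof (rule dist_proj_op_le[OF subspace_range_matrix subspace_range_matrix])
  let ?L = "real CARD('d) * real CARD('k) * \<delta>"
  have d0: "0 \<le> \<delta>" using \<delta>[of undefined undefined] by linarith
  then show "0 \<le> ?L" by simp
  have diff: "norm (A *v y - B *v y) \<le> ?L * norm y" for y
  proof -
    have "norm (A *v y - B *v y) \<le> (\<Sum>i\<in>UNIV. \<bar>(A *v y - B *v y) $ i\<bar>)" by (rule norm_le_l1_cart)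
    also have "\<dots> \<le> (\<Sum>i\<in>(UNIV::'d set). \<Sum>m\<in>(UNIV::'k set). \<delta> * norm y)"
    proof (rule sum_mono)
      fix i :: 'd
      have "\<bar>(A *v y - B *v y) $ i\<bar> = \<bar>\<Sum>m\<in>UNIV. (A $ i $ m - B $ i $ m) * y $ m\<bar>"
        by (simp add: matrix_vector_mult_def sum_subtractf left_diff_distrib)
      also have "\<dots> \<le> (\<Sum>m\<in>UNIV. \<bar>(A $ i $ m - B $ i $ m) * y $ m\<bar>)" by (rule sum_abs)
      also have "\<dots> \<le> (\<Sum>m\<in>(UNIV::'k set). \<delta> * norm y)"
        unfolding abs_mult using d0 by (intro sum_mono mult_mono \<delta> component_le_norm_cart) auto
      finally show "\<bar>(A *v y - B *v y) $ i\<bar> \<le> (\<Sum>m\<in>(UNIV::'k set). \<delta> * norm y)" .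
    qed
    finally show ?thesis by (simp add: mult_ac)
  qed
  show "\<exists>w\<in>range ((*v) B). norm (v - w) \<le> ?L * norm v" if v: "v \<in> range ((*v) A)" for v
  proof -
    obtain y where y: "v = A *v y" using v by (rule rangeE)
    have "norm y \<le> norm v" unfolding y by (rule norm_le_graph_chart[OF e A])
    then have "norm (v - B *v y) \<le> ?L * norm v"
      using diff[of y] mult_left_mono[OF _ \<open>0 \<le> ?L\<close>] unfolding y by (blast intro: order_trans)
    then show ?thesis by blast
  qed
  show "\<exists>v\<in>range ((*v) A). norm (w - v) \<le> ?L * norm w" if w: "w \<in> range ((*v) B)" for w
  proof -
    obtain y where y: "w = B *v y" using w by (rule rangeE)
    have "norm y \<le> norm w" unfolding y by (rule norm_le_graph_chart[OF e B])
    then have "norm (w - A *v y) \<le> ?L * norm w"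
      using diff[of y] mult_left_mono[OF _ \<open>0 \<le> ?L\<close>] unfolding y norm_minus_commute[of "B *v y"]
      by (blast intro: order_trans)
    then show ?thesis by blast
  qed
qed

lemma floor_dyadic_bound:
  assumes "\<bar>a\<bar> \<le> real n"
  shows "\<lfloor>2 ^ j * a\<rfloor> \<in> {- int (n * 2 ^ j)..int (n * 2 ^ j)}"
proof -
  have "\<bar>2 ^ j * a\<bar> \<le> 2 ^ j * real n" using assms by (simp add: abs_mult)
  then have "- real (n * 2 ^ j) \<le> 2 ^ j * a" "2 ^ j * a \<le> real (n * 2 ^ j)" by (auto simp: abs_le_iff mult.commute)
  then have "- int (n * 2 ^ j) \<le> \<lfloor>2 ^ j * a\<rfloor>" "\<lfloor>2 ^ j * a\<rfloor> \<le> int (n * 2 ^ j)"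
    by (simp_all only: le_floor_iff of_int_minus of_int_of_nat_eq) (metis floor_mono floor_of_nat)
  then show ?thesis by simp
qed

text \<open>The number that \<open>t\<close> has to exceed is the growth exponent of the shell
  integrals summed over one matrix per cell. If each of these is at least 2^(-\<epsilon> j), the
  number of cells is at most K 2^(j(R + \<epsilon>)) with R that exponent, and their images form
  covers whose \<open>t\<close>-sums are summable in j.\<close>

theorem hausdorff_measure_exceptional_chart:
  fixes F :: "real ^ 'd \<Rightarrow> real" and e :: "'k::finite \<Rightarrow> 'd::finite"
  assumes e: "inj e" and F[measurable]: "F \<in> borel_measurable borel" and F0: "\<And>x. 0 \<le> F x"
    and FB: "\<And>x. F x \<le> B"
    and loc: "\<And>N. \<exists>C\<ge>0. \<forall>x. ennreal (F x) \<le> ennreal C * (\<integral>\<^sup>+z. ennreal (F z * prod_weight (real (N + 2)) (x - z)) \<partial>lborel)"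
    and fin: "(\<integral>\<^sup>+z. ennreal (F z * (1 + norm z) powr a) \<partial>lborel) < \<infinity>"
    and t: "0 < t" "\<sigma> - a + (real CARD('k) - 1) * (real CARD('d) - real CARD('k)) < t"
  shows "hausdorff_measure t ((\<lambda>A. proj_op (range ((*v) A))) `
     {A \<in> graph_chart e n. (\<integral>\<^sup>+y. ennreal (F (A *v y) * (1 + norm y) powr \<sigma>) \<partial>lborel) = \<infinity>}) = 0"
proof -
  let ?R = "\<sigma> - a + (real CARD('k) - 1) * (real CARD('d) - real CARD('k))"
  let ?P = "\<lambda>A :: real ^ 'k ^ 'd. proj_op (range ((*v) A))"
  \<comment> \<open>Half of the gap between \<open>t\<close> and \<open>?R\<close>: one half is lost
    to the threshold that defines \<open>big\<close>, the other makes the cover sums decay like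
    2^(-\<epsilon> j).\<close>
  define \<epsilon> where "\<epsilon> = (t - ?R) / 2"
  have \<epsilon>: "0 < \<epsilon>" using t by (simp add: \<epsilon>_def)
  define N where "N = nat \<lceil>\<bar>a\<bar>\<rceil>"
  have N: "\<bar>a\<bar> \<le> real N" unfolding N_def by linarith
  obtain C where C: "0 \<le> C"
    "\<And>x. ennreal (F x) \<le> ennreal C * (\<integral>\<^sup>+z. ennreal (F z * prod_weight (real (N + 2)) (x - z)) \<partial>lborel)"
    using loc[of N] by blast
  define G where "G = (\<lambda>j (A::real^'k^'d). \<integral>\<^sup>+y. ennreal (F (A *v y) * (1 + norm y) powr \<sigma>) * indicator (shell j) y \<partial>lborel)"
  obtain K where K: "0 \<le> K" "\<And>j Q A. j \<ge> 1 \<Longrightarrow>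
      Q \<subseteq> PiE (- range e) (\<lambda>_. PiE UNIV (\<lambda>_. {- int (n * 2 ^ j)..int (n * 2 ^ j)})) \<Longrightarrow>
      (\<And>q. q \<in> Q \<Longrightarrow> A q \<in> graph_chart e n) \<Longrightarrow>
      (\<And>q i m. q \<in> Q \<Longrightarrow> i \<notin> range e \<Longrightarrow> \<bar>A q $ i $ m - real_of_int (q i m) / 2 ^ j\<bar> \<le> 1 / 2 ^ j) \<Longrightarrow>
      (\<Sum>q\<in>Q. G j (A q)) \<le> ennreal (K * 2 powr (real j * ?R))"
    unfolding G_def using sum_shell_integrals_bound[OF e F F0 C(1) N C(2) fin, of n \<sigma>] by blast
  define cell where "cell = (\<lambda>j (A::real^'k^'d). restrict (\<lambda>i m. \<lfloor>2 ^ j * A $ i $ m\<rfloor>) (- range e))"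
  define big where "big = (\<lambda>j. {A \<in> graph_chart e n. ennreal (2 powr - (\<epsilon> * real j)) \<le> G j A})"
  define Q where "Q = (\<lambda>j. cell j ` big j)"
  \<comment> \<open>A covering set is the image of all chart matrices in a cell that contains a
    \<open>big\<close> one; for the counting, one \<open>big\<close> member per cell is
    chosen.\<close>
  define \<U> where "\<U> = (\<lambda>j. (\<lambda>q. ?P ` {A \<in> graph_chart e n. cell j A = q}) ` Q j)"
  have Qsub: "Q j \<subseteq> PiE (- range e) (\<lambda>_. PiE UNIV (\<lambda>_. {- int (n * 2 ^ j)..int (n * 2 ^ j)}))" for j
  proof -
    have "\<lfloor>2 ^ j * A $ i $ m\<rfloor> \<in> {- int (n * 2 ^ j)..int (n * 2 ^ j)}" if "A \<in> graph_chart e n" for A :: "real^'k^'d" and i m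
      using that by (intro floor_dyadic_bound) (simp add: graph_chart_def)
    then show ?thesis by (auto simp: Q_def big_def cell_def PiE_iff simp del: atLeastAtMost_iff)
  qed
  have Qfin: "finite (Q j)" for j by (rule finite_subset[OF Qsub]) (intro finite_PiE; auto)+
  have cellD: "\<bar>A $ i $ m - real_of_int (q i m) / 2 ^ j\<bar> \<le> 1 / 2 ^ j" if "cell j A = q" "i \<notin> range e" for j A q i m
  proof -
    have "q i m = \<lfloor>2 ^ j * A $ i $ m\<rfloor>" using that by (auto simp: cell_def)
    then have "\<bar>2 ^ j * A $ i $ m - real_of_int (q i m)\<bar> \<le> 1" by linarith
    moreover have "A $ i $ m - real_of_int (q i m) / 2 ^ j = (2 ^ j * A $ i $ m - real_of_int (q i m)) / 2 ^ j"
      by (simp add: diff_divide_distrib)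
    ultimately show ?thesis by (simp add: abs_divide divide_right_mono)
  qed
  \<comment> \<open>Entries of two matrices in one cell differ by at most 2 / 2^j, each being within
    1 / 2^j of \<open>q i m / 2 ^ j\<close>; the Lipschitz bound contributes the other factor 2 and
    the two cardinalities.\<close>
  define c where "c = 4 * (real CARD('d) * real CARD('k))"
  have celldist: "dist (?P A) (?P B) \<le> c * 2 powr - real j"
    if "A \<in> graph_chart e n" "B \<in> graph_chart e n" "cell j A = cell j B" for A B j
  proof -
    have "\<bar>A $ i $ m - B $ i $ m\<bar> \<le> 2 / 2 ^ j" for i m
    proof (cases "i \<in> range e")
      case True then show ?thesis using that by (auto simp: graph_chart_def)
    next
      case False
      from cellD[OF that(3) False, of m] cellD[OF refl False, of B m j] show ?thesis by (simp add: field_simps abs_le_iff)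
    qed
    from dist_proj_op_graph_chart[OF e that(1,2) this]
    show ?thesis by (simp add: c_def powr_minus powr_realpow divide_inverse mult_ac)
  qed
  show ?thesis
  proof (rule hausdorff_measure_zero_limsup[where \<U> = \<U> and \<epsilon> = \<epsilon> and c = c and K = K])
    show "t > 0" "\<epsilon> > 0" "0 \<le> K" using t \<epsilon> K by auto
    show "0 \<le> c" by (simp add: c_def)
    show "finite (\<U> j)" for j using Qfin by (simp add: \<U>_def)
    show "bounded U \<and> diameter U \<le> c * 2 powr - real j" if U: "U \<in> \<U> j" for j U
    proof -
      obtain q where q: "U = ?P ` {A \<in> graph_chart e n. cell j A = q}" using U by (auto simp: \<U>_def)
      have d: "dist x y \<le> c * 2 powr - real j" if "x \<in> U" "y \<in> U" for x y
        using that unfolding q by (auto intro!: celldist)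
      show ?thesis
      proof
        show "bounded U"
        proof (cases "U = {}")
          case False
          then obtain x where "x \<in> U" by blast
          then show ?thesis unfolding bounded_def using d by blast
        qed simp
        show "diameter U \<le> c * 2 powr - real j"
        proof (rule diameter_le)
          show "U \<noteq> {} \<or> 0 \<le> c * 2 powr - real j" by (simp add: c_def)
        qed (use d in \<open>auto simp: dist_norm\<close>)
      qed
    qed
    show "real (card (\<U> j)) * 2 powr - (real j * t) \<le> K * 2 powr - (\<epsilon> * real j)" if j: "j \<ge> 1" for j
    proof -
      have "\<exists>A. A \<in> big j \<and> cell j A = q" if "q \<in> Q j" for q using that by (auto simp: Q_def)
      then obtain A where A: "\<And>q. q \<in> Q j \<Longrightarrow> A q \<in> big j \<and> cell j (A q) = q" by metis
      have "ennreal (real (card (Q j)) * 2 powr - (\<epsilon> * real j)) = (\<Sum>q\<in>Q j. ennreal (2 powr - (\<epsilon> * real j)))"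
        by (simp add: ennreal_mult' flip: ennreal_of_nat_eq_real_of_nat)
      also have "\<dots> \<le> (\<Sum>q\<in>Q j. G j (A q))"
        using A by (intro sum_mono) (auto simp: big_def)
      also have "\<dots> \<le> ennreal (K * 2 powr (real j * ?R))"
        using A by (intro K(2)[OF j Qsub] cellD) (auto simp: big_def)
      finally have "real (card (Q j)) * 2 powr - (\<epsilon> * real j) \<le> K * 2 powr (real j * ?R)"
        using K(1) by (subst (asm) ennreal_le_iff) auto
      then have "real (card (Q j)) * 2 powr - (\<epsilon> * real j) * 2 powr (\<epsilon> * real j - real j * t)
         \<le> K * 2 powr (real j * ?R) * 2 powr (\<epsilon> * real j - real j * t)" by (intro mult_right_mono) auto
      moreover have "real (card (Q j)) * 2 powr - (\<epsilon> * real j) * 2 powr (\<epsilon> * real j - real j * t) = real (card (Q j)) * 2 powr - (real j * t)"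
        by (simp add: mult.assoc flip: powr_add)
      moreover have "K * 2 powr (real j * ?R) * 2 powr (\<epsilon> * real j - real j * t) = K * 2 powr - (\<epsilon> * real j)"
      proof -
        have "t = r + 2 * ((t - r) / 2)" for r by (simp add: field_simps)
        then have "t = ?R + 2 * \<epsilon>" unfolding \<epsilon>_def .
        then have "real j * ?R + (\<epsilon> * real j - real j * t) = - (\<epsilon> * real j)" by (simp only: distrib_left) simp
        then show ?thesis by (simp only: mult.assoc powr_add[symmetric])
      qed
      moreover have "real (card (\<U> j)) * 2 powr - (real j * t) \<le> real (card (Q j)) * 2 powr - (real j * t)"
        using card_image_le[OF Qfin[of j]] by (intro mult_right_mono) (auto simp: \<U>_def)
      ultimately show ?thesis by linarith
    qed
    show "\<exists>j\<ge>J. x \<in> \<Union> (\<U> j)"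
      if x: "x \<in> ?P ` {A \<in> graph_chart e n. (\<integral>\<^sup>+y. ennreal (F (A *v y) * (1 + norm y) powr \<sigma>) \<partial>lborel) = \<infinity>}" for x J
    proof -
      obtain A where A: "A \<in> graph_chart e n" "x = ?P A" and inf: "(\<integral>\<^sup>+y. ennreal (F (A *v y) * (1 + norm y) powr \<sigma>) \<partial>lborel) = \<infinity>"
        using x by auto
      have [measurable]: "(\<lambda>y. A *v y) \<in> borel_measurable borel"
        by (intro borel_measurable_continuous_onI linear_continuous_on linear_linear[THEN iffD2]) (rule matrix_vector_mul_linear)
      \<comment> \<open>If \<open>A\<close> were \<open>big\<close> for no \<open>j \<ge> J\<close>,
        the shell integrals would decay geometrically from \<open>J\<close> on, and their sum, which
        dominates the divergent integral, would be finite.\<close>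
      have "\<exists>j\<ge>J. A \<in> big j"
      proof (rule ccontr)
        assume "\<not> ?thesis"
        then have small: "G j A \<le> ennreal (2 powr - (\<epsilon> * real j))" if "j \<ge> J" for j
          using A that by (fastforce simp: big_def not_le)
        \<comment> \<open>The finitely many shells below \<open>J\<close> are not controlled by the
          threshold; there finiteness follows from the bound \<open>B\<close> on
          \<open>F\<close>.\<close>
        have Gfin: "G j A < \<infinity>" for j
        proof -
          have "G j A \<le> (\<integral>\<^sup>+y. ennreal (B * (2 powr \<bar>\<sigma>\<bar> * 2 powr (\<sigma> * real j))) * indicator (ball 0 (2 ^ Suc j)) (y::real^'k) \<partial>lborel)"
            unfolding G_def
          proof (intro nn_integral_mono)
            fix y :: "real ^ 'k"
            show "ennreal (F (A *v y) * (1 + norm y) powr \<sigma>) * indicator (shell j) y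
               \<le> ennreal (B * (2 powr \<bar>\<sigma>\<bar> * 2 powr (\<sigma> * real j))) * indicator (ball 0 (2 ^ Suc j)) y"
            proof (cases "y \<in> shell j")
              case True
              then have yj: "2 ^ j \<le> 1 + norm y" "1 + norm y < 2 ^ Suc j" by (auto simp: shell_def)
              have "F (A *v y) * (1 + norm y) powr \<sigma> \<le> B * (2 powr \<bar>\<sigma>\<bar> * 2 powr (\<sigma> * real j))"
                using order_trans[OF F0 FB] by (intro mult_mono FB powr_dyadic_le[OF yj]) auto
              then show ?thesis using True yj by (simp add: ennreal_leI)
            qed simp
          qed
          also have "\<dots> = ennreal (B * (2 powr \<bar>\<sigma>\<bar> * 2 powr (\<sigma> * real j))) * emeasure lborel (ball (0::real^'k) (2 ^ Suc j))"
            by (rule nn_integral_cmult_indicator) simp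
          also have "\<dots> < \<infinity>" using emeasure_lborel_ball_finite[of "0::real^'k" "2 ^ Suc j"] by (simp add: ennreal_mult_less_top del: power_Suc)
          finally show ?thesis .
        qed
        define b where "b = (\<lambda>j. enn2real (G j A))"
        have b: "G j A = ennreal (b j)" for j using Gfin[of j] by (simp add: b_def)
        have "summable b"
        proof (rule summable_comparison_test')
          define r where "r = 2 powr - \<epsilon>"
          have r: "0 < r" "r < 1" using \<epsilon> powr_less_mono[of "- \<epsilon>" 0 2] by (auto simp: r_def)
          have "r ^ j = 2 powr - (\<epsilon> * real j)" for j by (simp add: r_def powr_powr flip: powr_realpow)
          then show "norm (b j) \<le> r ^ j" if "j \<ge> J" for j
            using small[OF that] unfolding b by (simp add: b_def)
          show "summable ((^) r)" using r by (intro summable_geometric) auto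
        qed
        then have "(\<Sum>j. G j A) = ennreal (\<Sum>j. b j)"
          unfolding b by (intro suminf_ennreal2) (auto simp: b_def)
        moreover have "\<infinity> \<le> (\<Sum>j. G j A)"
        proof -
          have "(\<integral>\<^sup>+y. ennreal (F (A *v y) * (1 + norm y) powr \<sigma>) \<partial>lborel)
            \<le> (\<integral>\<^sup>+y. (\<Sum>j. ennreal (F (A *v y) * (1 + norm y) powr \<sigma>) * indicator (shell j) y) \<partial>lborel)"
          proof (intro nn_integral_mono)
            fix y :: "real ^ 'k"
            obtain j where "2 ^ j \<le> 1 + norm y" "1 + norm y < 2 ^ Suc j" using dyadic_bracket[of "1 + norm y"] by auto
            then have "y \<in> shell j" by (simp add: shell_def)
            then show "ennreal (F (A *v y) * (1 + norm y) powr \<sigma>)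
               \<le> (\<Sum>j. ennreal (F (A *v y) * (1 + norm y) powr \<sigma>) * indicator (shell j) y)"
              using ennreal_le_suminf[of "\<lambda>j. ennreal (F (A *v y) * (1 + norm y) powr \<sigma>) * indicator (shell j) y" j] by simp
          qed
          also have "\<dots> = (\<Sum>j. G j A)" unfolding G_def by (rule nn_integral_suminf) measurable
          finally show ?thesis unfolding inf .
        qed
        ultimately show False by (simp add: top_unique)
      qed
      then obtain j where j: "j \<ge> J" "A \<in> big j" by blast
      then have "x \<in> ?P ` {B \<in> graph_chart e n. cell j B = cell j A}" using A by auto
      moreover have "?P ` {B \<in> graph_chart e n. cell j B = cell j A} \<in> \<U> j" using j by (auto simp: \<U>_def Q_def)
      ultimately show ?thesis using j by blast
    qed
  qed
qed

section \<open>Charts, coordinates and supports\<close>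

lemma borel_measurable_matrix_mult[measurable]:
  "(\<lambda>y. (A :: real ^ 'k ^ 'd) *v y) \<in> borel_measurable borel"
  by (intro borel_measurable_continuous_onI linear_continuous_on linear_linear[THEN iffD2])
    (rule matrix_vector_mul_linear)

text \<open>Rows of \<open>M\<close> forming a basis of the row space select the coordinate plane over which the range
  of \<open>M\<close> is a graph.\<close>

lemma injective_matrix_graph_chart:
  fixes M :: "real ^ 'k ^ 'd"
  assumes "inj ((*v) M)"
  obtains e :: "'k \<Rightarrow> 'd" and n A and T T' :: "real ^ 'k ^ 'k"
  where "inj e" "A \<in> graph_chart e n" "T ** T' = mat 1" "T' ** T = mat 1" "M = A ** T"
proof -
  have dimr: "dim (rows M) = CARD('k)" using assms full_rank_injective row_rank_def by metis
  obtain B where B: "B \<subseteq> rows M" "independent B" "rows M \<subseteq> span B" "card B = CARD('k)"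
    using basis_exists[of "rows M"] dimr by metis
  have finB: "finite B" using B(4) by (metis card.infinite zero_less_card_finite less_irrefl)
  obtain f where f: "bij_betw f (UNIV :: 'k set) B"
    using finite_same_card_bij[OF _ finB, of "UNIV :: 'k set"] B(4) by auto
  have "\<exists>i. row i M = f m" for m
  proof -
    have "f m \<in> rows M" using f B(1) by (auto simp: bij_betw_def)
    then show ?thesis by (auto simp: rows_def)
  qed
  then obtain e where e: "\<And>m. row (e m) M = f m" by metis
  have inje: "inj e" using f e unfolding bij_betw_def inj_on_def by metis
  \<comment> \<open>The rows of \<open>M\<close> picked by \<open>e\<close> form an invertible
    matrix; multiplying \<open>M\<close> on the right by its inverse keeps the range and turns those
    rows into unit vectors.\<close>
  define T where "T = (\<chi> m. M $ e m)"
  have rowT: "row m T = f m" for m using e[of m] by (simp add: T_def row_def)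
  then have "rows T = B" using f by (auto simp: rows_def bij_betw_def)
  have "span B = UNIV"
  proof -
    have "dim (span B) = CARD('k)" using B(2,4) by (simp add: dim_eq_card_independent dim_span)
    then show ?thesis using dim_eq_full[of "span B"] by (simp add: span_span)
  qed
  then obtain T' where T': "T' ** T = mat 1"
    using matrix_left_invertible_span_rows[of T] \<open>rows T = B\<close> by blast
  then have TT': "T ** T' = mat 1" using matrix_left_right_inverse by blast
  define A where "A = M ** T'"
  define n where "n = nat \<lceil>\<Sum>i\<in>UNIV. \<Sum>m\<in>UNIV. \<bar>A $ i $ m\<bar>\<rceil>"
  have "\<bar>A $ i $ m\<bar> \<le> real n" for i m
  proof -
    have "\<bar>A $ i $ m\<bar> \<le> (\<Sum>m\<in>UNIV. \<bar>A $ i $ m\<bar>)" by (rule member_le_sum) auto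
    also have "\<dots> \<le> (\<Sum>i\<in>UNIV. \<Sum>m\<in>UNIV. \<bar>A $ i $ m\<bar>)"
      by (rule member_le_sum[of i _ "\<lambda>i. \<Sum>m\<in>UNIV. \<bar>A $ i $ m\<bar>"]) (auto intro: sum_nonneg)
    also have "\<dots> \<le> real n" unfolding n_def by linarith
    finally show ?thesis .
  qed
  moreover have "A $ e m = axis m 1" for m
  proof -
    have "A $ e m $ l = (T ** T') $ m $ l" for l
      by (simp add: A_def T_def matrix_matrix_mult_def)
    then show ?thesis by (simp add: TT' vec_eq_iff mat_def axis_def eq_commute)
  qed
  ultimately have "A \<in> graph_chart e n" by (simp add: graph_chart_def)
  moreover have "M = A ** T" by (simp add: A_def matrix_mul_assoc[symmetric] T')
  ultimately show ?thesis using that inje TT' T' by blast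
qed

lemma matrix_norm_bound:
  obtains L where "1 \<le> L" "\<And>y. norm ((A :: real ^ 'k ^ 'd) *v y) \<le> L * norm y"
proof -
  obtain K where K: "\<And>y. norm (A *v y) \<le> norm y * K" 
    using bounded_linear.bounded[OF linear_linear[THEN iffD2, OF matrix_vector_mul_linear[of A]]] by blast
  show ?thesis
  proof (rule that[of "max 1 K"])
    show "norm (A *v y) \<le> max 1 K * norm y" for y
      using K[of y] mult_left_mono[of K "max 1 K" "norm y"] by (simp add: mult.commute)
  qed simp
qed

text \<open>Uniqueness of translation-invariant measures, applied to the image of Lebesgue measure under \<open>T\<close>;
  the change-of-variables theorem of the library needs a well-ordered index type.\<close>

lemma nn_integral_lborel_matrix_infinite:
  fixes T T' :: "real ^ 'k ^ 'k"
  assumes TT': "T ** T' = mat 1" and h[measurable]: "h \<in> borel_measurable borel"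
    and inf: "(\<integral>\<^sup>+x. h (T *v x) \<partial>lborel) = \<infinity>"
  shows "(\<integral>\<^sup>+y. h y \<partial>lborel) = \<infinity>"
proof -
  have inv: "T *v (T' *v y) = y" "T' *v (T *v y) = y" for y
    using TT' matrix_left_right_inverse[of T T'] by (auto simp: matrix_vector_mul_assoc)
  obtain L where L: "1 \<le> L" "\<And>y. norm (T' *v y) \<le> L * norm y"
    using matrix_norm_bound[of T'] by blast
  let ?b = "indicator (ball (0::real^'k) 1) :: real^'k \<Rightarrow> ennreal"
  have [measurable]: "ball (0::real^'k) 1 \<in> sets borel" by simp
  have lam: "(\<integral>\<^sup>+y. ?b y \<partial>lborel) \<noteq> 0"
    by (simp add: emeasure_ball less_imp_neq[OF unit_ball_vol_pos, symmetric])
  have "(\<integral>\<^sup>+x. ?b (T *v x) \<partial>lborel) \<le> (\<integral>\<^sup>+x. indicator (ball 0 (L + 1)) (x::real^'k) \<partial>lborel)"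
  proof (intro nn_integral_mono)
    fix x :: "real ^ 'k"
    have "norm x < L + 1" if "norm (T *v x) < 1"
    proof -
      have "norm x \<le> L * norm (T *v x)" using L(2)[of "T *v x"] by (simp add: inv)
      also have "\<dots> \<le> L * 1" using that L by (intro mult_left_mono) auto
      finally show ?thesis by simp
    qed
    then show "?b (T *v x) \<le> indicator (ball 0 (L + 1)) x" by (auto simp: indicator_def)
  qed
  also have "\<dots> < \<infinity>" using emeasure_lborel_ball_finite[of "0::real^'k" "L + 1"] by simp
  finally have fin: "(\<integral>\<^sup>+x. ?b (T *v x) \<partial>lborel) < \<infinity>" .
  \<comment> \<open>The chain evaluates one double integral in two ways: the integral of h o T times
    that of \<open>?b\<close> equals the integral of h times that of \<open>?b\<close> o T. The
    translations by T x and T' y under Tonelli give this; \<open>?b\<close> has nonzero integral and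
    \<open>?b\<close> o T a finite one.\<close>
  have "(\<integral>\<^sup>+x. h (T *v x) \<partial>lborel) * (\<integral>\<^sup>+y. ?b y \<partial>lborel) = (\<integral>\<^sup>+x. h (T *v x) * (\<integral>\<^sup>+y. ?b y \<partial>lborel) \<partial>lborel)"
    by (rule nn_integral_multc[symmetric]) measurable
  also have "\<dots> = (\<integral>\<^sup>+x. (\<integral>\<^sup>+y. h (T *v x) * ?b (y + T *v x) \<partial>lborel) \<partial>lborel)"
  proof (rule nn_integral_cong)
    fix x :: "real ^ 'k"
    have "(\<integral>\<^sup>+y. ?b y \<partial>lborel) = (\<integral>\<^sup>+y. ?b (y + T *v x) \<partial>lborel)"
      using nn_integral_lborel_translate[of ?b "- (T *v x)"] by simp
    then show "h (T *v x) * (\<integral>\<^sup>+y. ?b y \<partial>lborel) = (\<integral>\<^sup>+y. h (T *v x) * ?b (y + T *v x) \<partial>lborel)"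
      by (subst nn_integral_cmult) auto
  qed
  also have "\<dots> = (\<integral>\<^sup>+y. (\<integral>\<^sup>+x. h (T *v x) * ?b (y + T *v x) \<partial>lborel) \<partial>lborel)"
    by (rule lborel_pair.Fubini') measurable
  also have "\<dots> = (\<integral>\<^sup>+y. (\<integral>\<^sup>+x. h (T *v x - y) * ?b (T *v x) \<partial>lborel) \<partial>lborel)"
  proof (rule nn_integral_cong)
    fix y :: "real ^ 'k"
    have "T *v (x - T' *v y) = T *v x - y" for x by (simp add: matrix_vector_mult_diff_distrib inv)
    then show "(\<integral>\<^sup>+x. h (T *v x) * ?b (y + T *v x) \<partial>lborel) = (\<integral>\<^sup>+x. h (T *v x - y) * ?b (T *v x) \<partial>lborel)"
      using nn_integral_lborel_translate[of "\<lambda>x. h (T *v x) * ?b (y + T *v x)" "T' *v y"] by simp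
  qed
  also have "\<dots> = (\<integral>\<^sup>+x. (\<integral>\<^sup>+y. h (T *v x - y) * ?b (T *v x) \<partial>lborel) \<partial>lborel)"
    by (rule lborel_pair.Fubini') measurable
  also have "\<dots> = (\<integral>\<^sup>+x. (\<integral>\<^sup>+y. h y \<partial>lborel) * ?b (T *v x) \<partial>lborel)"
    by (simp add: nn_integral_multc nn_integral_lborel_reflect)
  also have "\<dots> = (\<integral>\<^sup>+y. h y \<partial>lborel) * (\<integral>\<^sup>+x. ?b (T *v x) \<partial>lborel)"
    by (rule nn_integral_cmult) measurable
  finally have "(\<integral>\<^sup>+y. h y \<partial>lborel) * (\<integral>\<^sup>+x. ?b (T *v x) \<partial>lborel) = \<infinity>"
    using lam unfolding inf by (simp add: ennreal_top_mult)
  then show ?thesis using fin by (auto simp: ennreal_mult_eq_top_iff)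
qed

section \<open>Coordinates on a subspace and transforms of projected measures\<close>

lemma isometric_coords_inner:
  assumes "isometric_coords f V"
  shows "f x \<bullet> f y = x \<bullet> y"
proof -
  have l: "linear f" and n: "\<And>x. norm (f x) = norm x" using assms by (auto simp: isometric_coords_def)
  have "f x \<bullet> f y = ((norm (f x + f y))\<^sup>2 - (norm (f x))\<^sup>2 - (norm (f y))\<^sup>2) / 2" by (rule dot_norm)
  also have "f x + f y = f (x + y)" using l by (simp add: linear_add)
  finally show ?thesis unfolding n by (simp add: dot_norm)
qed

lemma isometric_coords_inj: "isometric_coords f V \<Longrightarrow> inj f"
  unfolding isometric_coords_def by (metis linear_injective_0 norm_eq_zero)

lemma coord_proj_eq:
  assumes f: "isometric_coords f V"
  shows "f (coord_proj f V x) = orth_proj V x"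
proof -
  have "subspace V" using f unfolding isometric_coords_def by (metis linear_subspace_image subspace_UNIV)
  then have "orth_proj V x \<in> range f" using orth_proj_props(1) f by (auto simp: isometric_coords_def)
  then show ?thesis unfolding coord_proj_def by (rule f_inv_into_f)
qed

text \<open>The projection in coordinates is the adjoint of the isometry \<open>f\<close>; its
  linearity and the slice formula are read off from this.\<close>

lemma coord_proj_inner:
  assumes f: "isometric_coords f V"
  shows "y \<bullet> coord_proj f V x = f y \<bullet> x"
proof -
  have sub: "subspace V" using f unfolding isometric_coords_def by (metis linear_subspace_image subspace_UNIV)
  have "f y \<in> V" using f by (auto simp: isometric_coords_def)
  then have "orthogonal (x - orth_proj V x) (f y)" by (rule orth_proj_props(2)[OF sub])
  then have "f y \<bullet> x = f y \<bullet> orth_proj V x" by (simp add: orthogonal_def inner_diff_left inner_diff_right inner_commute)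
  then show ?thesis using isometric_coords_inner[OF f, of y "coord_proj f V x"] coord_proj_eq[OF f] by simp
qed

lemma continuous_on_coord_proj:
  assumes f: "isometric_coords f V"
  shows "continuous_on A (coord_proj f V)"
proof -
  have "linear (coord_proj f V)"
    by (rule linearI) (auto simp: vector_eq_rdot[symmetric] inner_add_left inner_commute[of _ "_ :: 'a"]
        coord_proj_inner[OF f] inner_add_right inner_commute[of "coord_proj f V _"])
  then show ?thesis by (rule linear_continuous_on[OF linear_linear[THEN iffD2]])
qed

text \<open>By adjointness the phase at y against the projected point is the phase at f y against
  the point itself. This projection-slice formula identifies the transform of the projected measure
  with the restriction of the transform to \<open>V\<close>.\<close>

lemma fourier_transform_coord_proj:
  fixes \<mu> :: "'a::euclidean_space measure" and f :: "'b::euclidean_space \<Rightarrow> 'a"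
  assumes f: "isometric_coords f V" and s: "sets \<mu> = sets borel"
  shows "fourier_transform (distr \<mu> borel (coord_proj f V)) y = fourier_transform \<mu> (f y)"
proof -
  have m: "coord_proj f V \<in> measurable \<mu> borel"
    using borel_measurable_continuous_onI[OF continuous_on_coord_proj[OF f]] s by (simp cong: measurable_cong_sets)
  show ?thesis unfolding fourier_transform_cis
    using f by (subst integral_distr[OF m]) (auto simp: coord_proj_inner[OF f] isometric_coords_def linear_neg)
qed

section \<open>Supports and push-forwards\<close>

lemma closed_msupport: "closed (msupport \<mu>)"
  unfolding closed_def
proof (subst open_subopen, intro ballI)
  fix x assume "x \<in> - msupport \<mu>"
  then obtain U where "open U" "x \<in> U" "emeasure \<mu> U = 0" by (auto simp: msupport_def)
  then show "\<exists>T. open T \<and> x \<in> T \<and> T \<subseteq> - msupport \<mu>" by (intro exI[of _ U]) (auto simp: msupport_def)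
qed

text \<open>The complement is covered by those members of a countable basis that have measure
  0.\<close>

lemma null_sets_Compl_msupport:
  fixes \<mu> :: "'a::second_countable_topology measure"
  assumes s: "sets \<mu> = sets borel"
  shows "- msupport \<mu> \<in> null_sets \<mu>"
proof -
  obtain B :: "'a set set" where B: "countable B" "topological_basis B" using ex_countable_basis by blast
  define N where "N = {U \<in> B. emeasure \<mu> U = 0}"
  have "countable N" using B by (simp add: N_def)
  have "(\<Union>U\<in>N. U) \<in> null_sets \<mu>"
  proof (rule null_sets_UN')
    fix U assume "U \<in> N"
    then have "open U" using B(2) by (auto simp: N_def topological_basis_open)
    then show "U \<in> null_sets \<mu>" using \<open>U \<in> N\<close> s by (auto simp: N_def)
  qed fact
  moreover have "- msupport \<mu> \<subseteq> (\<Union>U\<in>N. U)"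
  proof
    fix x assume "x \<in> - msupport \<mu>"
    then obtain U where U: "open U" "x \<in> U" "emeasure \<mu> U = 0" by (auto simp: msupport_def)
    then obtain W where W: "W \<in> B" "x \<in> W" "W \<subseteq> U" using topological_basisE[OF B(2)] by blast
    have "emeasure \<mu> W \<le> emeasure \<mu> U" using U W s by (intro emeasure_mono) auto
    then show "x \<in> (\<Union>U\<in>N. U)" using W U by (auto simp: N_def)
  qed
  moreover have "- msupport \<mu> \<in> sets \<mu>" using closed_msupport[of \<mu>] s by auto
  ultimately show ?thesis by (meson null_sets_subset)
qed

lemma compact_measures_finite:
  fixes \<mu> :: "'a::euclidean_space measure"
  assumes "\<mu> \<in> compact_measures X"
  shows "finite_measure \<mu>" "sets \<mu> = sets borel" "0 < measure \<mu> (space \<mu>)"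
    "\<exists>\<rho>\<ge>0. AE x in \<mu>. norm x \<le> \<rho>"
proof -
  show s: "sets \<mu> = sets borel" using assms by (simp add: compact_measures_def)
  then have sp: "space \<mu> = UNIV" by (metis sets_eq_imp_space_eq space_borel)
  show fin: "finite_measure \<mu>" using assms sp by (intro finite_measureI) (auto simp: compact_measures_def)
  then interpret finite_measure \<mu> .
  show "0 < measure \<mu> (space \<mu>)" using assms by (simp add: compact_measures_def sp emeasure_eq_measure)
  have "compact (msupport \<mu>)" using assms by (simp add: compact_measures_def)
  then obtain r where r: "\<And>x. x \<in> msupport \<mu> \<Longrightarrow> norm x \<le> r" using compact_imp_bounded bounded_iff by metis
  have "AE x in \<mu>. x \<in> msupport \<mu>"
    using AE_not_in[OF null_sets_Compl_msupport[OF s]] by simp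
  then have "AE x in \<mu>. norm x \<le> max 0 r" using r by (auto simp: le_max_iff_disj elim!: eventually_mono)
  then show "\<exists>\<rho>\<ge>0. AE x in \<mu>. norm x \<le> \<rho>" by (intro exI[of _ "max 0 r"]) auto
qed

lemma distr_compact_measures:
  fixes \<mu> :: "'a::euclidean_space measure" and g :: "'a \<Rightarrow> 'b::euclidean_space"
  assumes \<mu>: "\<mu> \<in> compact_measures X" and g: "continuous_on UNIV g"
  shows "distr \<mu> borel g \<in> compact_measures (g ` X)"
proof -
  have s: "sets \<mu> = sets borel" using \<mu> by (simp add: compact_measures_def)
  then have sp: "space \<mu> = UNIV" by (metis sets_eq_imp_space_eq space_borel)
  have gm: "g \<in> measurable \<mu> borel" using borel_measurable_continuous_onI[OF g] s by (simp cong: measurable_cong_sets)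
  let ?S = "g ` msupport \<mu>"
  have cS: "compact ?S" using \<mu> g by (intro compact_continuous_image) (auto simp: compact_measures_def intro: continuous_on_subset)
  have "msupport (distr \<mu> borel g) \<subseteq> ?S"
  proof
    fix y assume y: "y \<in> msupport (distr \<mu> borel g)"
    show "y \<in> ?S"
    proof (rule ccontr)
      assume "y \<notin> ?S"
      moreover have "open (- ?S)" using cS compact_imp_closed by blast
      ultimately have "0 < emeasure (distr \<mu> borel g) (- ?S)" using y by (auto simp: msupport_def)
      also have "emeasure (distr \<mu> borel g) (- ?S) = emeasure \<mu> (g -` (- ?S) \<inter> space \<mu>)"
        using \<open>open (- ?S)\<close> by (intro emeasure_distr gm) auto
      also have "\<dots> \<le> emeasure \<mu> (- msupport \<mu>)"
        using null_sets_Compl_msupport[OF s] by (intro emeasure_mono) auto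
      also have "\<dots> = 0" using null_sets_Compl_msupport[OF s] by auto
      finally show False by simp
    qed
  qed
  moreover have "compact (msupport (distr \<mu> borel g))"
    using closed_msupport calculation cS by (metis Int_absorb2 closed_Int_compact)
  moreover have "emeasure (distr \<mu> borel g) UNIV = emeasure \<mu> UNIV"
    using gm sp by (subst emeasure_distr) auto
  moreover have "g ` msupport \<mu> \<subseteq> g ` X" using \<mu> by (auto simp: compact_measures_def)
  ultimately show ?thesis using \<mu> by (simp add: compact_measures_def)
qed

section \<open>Exceptional sets of subspaces\<close>

lemma J_energy_finite_iff:
  fixes \<mu> :: "'a::euclidean_space measure"
  shows "J_energy s \<theta> \<mu> < \<infinity> \<longleftrightarrow>
    (\<integral>\<^sup>+z. ennreal (cmod (fourier_transform \<mu> z) powr (2 / \<theta>) * norm z powr (s / \<theta> - real DIM('a))) \<partial>lborel) < \<infinity>"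
  by (simp add: J_energy_def ennreal_powr_def top.not_eq_extremum)

text \<open>For \<sigma> above minus the dimension the singular weight is integrable over the unit
  ball, where \<open>H\<close> is bounded, and outside the two weights are comparable; so the
  divergence sits at infinity.\<close>

lemma nn_integral_power_weight_infinite:
  fixes H :: "'a::euclidean_space \<Rightarrow> real"
  assumes [measurable]: "H \<in> borel_measurable borel" and H: "\<And>y. 0 \<le> H y" "\<And>y. H y \<le> B"
    and \<sigma>: "\<sigma> > - real DIM('a)"
    and inf: "(\<integral>\<^sup>+y. ennreal (H y * norm y powr \<sigma>) \<partial>lborel) = \<infinity>"
  shows "(\<integral>\<^sup>+y. ennreal (H y * (1 + norm y) powr \<sigma>) \<partial>lborel) = \<infinity>"
proof (rule ccontr)
  assume fin: "\<not> ?thesis"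
  have [measurable]: "ball (0::'a) 1 \<in> sets borel" by simp
  have B: "0 \<le> B" using order_trans[OF H] .
  have "(\<integral>\<^sup>+y. ennreal (H y * norm y powr \<sigma>) \<partial>lborel)
    \<le> (\<integral>\<^sup>+y. ennreal B * (ennreal (norm y powr \<sigma>) * indicator (ball 0 1) y)
        + ennreal (2 powr \<bar>\<sigma>\<bar>) * ennreal (H y * (1 + norm y) powr \<sigma>) \<partial>lborel)"
  proof (intro nn_integral_mono)
    fix y :: 'a
    show "ennreal (H y * norm y powr \<sigma>) \<le> ennreal B * (ennreal (norm y powr \<sigma>) * indicator (ball 0 1) y)
        + ennreal (2 powr \<bar>\<sigma>\<bar>) * ennreal (H y * (1 + norm y) powr \<sigma>)"
    proof (cases "norm y < 1")
      case True
      have "ennreal (H y * norm y powr \<sigma>) \<le> ennreal (B * norm y powr \<sigma>)"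
        by (intro ennreal_leI mult_right_mono H) auto
      also have "\<dots> = ennreal B * (ennreal (norm y powr \<sigma>) * indicator (ball 0 1) y)"
        using True B by (simp add: ennreal_mult')
      finally show ?thesis by (simp add: add_increasing2)
    next
      case False
      then have "norm y powr \<sigma> \<le> 2 powr \<bar>\<sigma>\<bar> * (1 + norm y) powr \<sigma>"
        by (intro powr_comparable) auto
      then have "H y * norm y powr \<sigma> \<le> H y * (2 powr \<bar>\<sigma>\<bar> * (1 + norm y) powr \<sigma>)"
        by (rule mult_left_mono) (rule H)
      then have "ennreal (H y * norm y powr \<sigma>) \<le> ennreal (2 powr \<bar>\<sigma>\<bar>) * ennreal (H y * (1 + norm y) powr \<sigma>)"
        by (simp add: mult_ac ennreal_leI flip: ennreal_mult')
      then show ?thesis by (simp add: add_increasing)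
    qed
  qed
  also have "\<dots> = ennreal B * (\<integral>\<^sup>+y. ennreal (norm (y::'a) powr \<sigma>) * indicator (ball 0 1) y \<partial>lborel)
        + ennreal (2 powr \<bar>\<sigma>\<bar>) * (\<integral>\<^sup>+y. ennreal (H y * (1 + norm y) powr \<sigma>) \<partial>lborel)"
    by (subst nn_integral_add) (auto simp: nn_integral_cmult)
  also have "\<dots> < \<infinity>"
    using fin nn_integral_norm_powr_unit_ball_finite[OF \<sigma>]
    by (simp add: ennreal_mult_less_top top.not_eq_extremum)
  finally show False using inf by simp
qed

text \<open>The regular weight is bounded on the unit ball for either sign of \<open>a\<close>, and
  comparable to the singular one outside, so finiteness passes to it for every
  \<open>a\<close>.\<close>

lemma nn_integral_one_plus_weight_finite:
  fixes H :: "'a::euclidean_space \<Rightarrow> real"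
  assumes [measurable]: "H \<in> borel_measurable borel" and H: "\<And>y. 0 \<le> H y" "\<And>y. H y \<le> B"
    and fin: "(\<integral>\<^sup>+y. ennreal (H y * norm y powr a) \<partial>lborel) < \<infinity>"
  shows "(\<integral>\<^sup>+y. ennreal (H y * (1 + norm y) powr a) \<partial>lborel) < \<infinity>"
proof -
  have [measurable]: "ball (0::'a) 1 \<in> sets borel" by simp
  have B: "0 \<le> B" using order_trans[OF H] .
  have "(\<integral>\<^sup>+y. ennreal (H y * (1 + norm y) powr a) \<partial>lborel)
    \<le> (\<integral>\<^sup>+y. ennreal (B * 2 powr \<bar>a\<bar>) * indicator (ball 0 1) y
        + ennreal (2 powr \<bar>a\<bar>) * ennreal (H y * norm y powr a) \<partial>lborel)"
  proof (intro nn_integral_mono)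
    fix y :: 'a
    show "ennreal (H y * (1 + norm y) powr a) \<le> ennreal (B * 2 powr \<bar>a\<bar>) * indicator (ball 0 1) y
        + ennreal (2 powr \<bar>a\<bar>) * ennreal (H y * norm y powr a)"
    proof (cases "norm y < 1")
      case True
      have "(1 + norm y) powr a \<le> 2 powr \<bar>a\<bar> * 1 powr a"
        using True by (intro powr_comparable) (auto simp: add_pos_nonneg)
      then have "ennreal (H y * (1 + norm y) powr a) \<le> ennreal (B * 2 powr \<bar>a\<bar>)"
        using B by (intro ennreal_leI mult_mono H) auto
      then show ?thesis using True by (simp add: add_increasing2)
    next
      case False
      then have "(1 + norm y) powr a \<le> 2 powr \<bar>a\<bar> * norm y powr a"
        by (intro powr_comparable) auto
      then have "H y * (1 + norm y) powr a \<le> H y * (2 powr \<bar>a\<bar> * norm y powr a)"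
        by (rule mult_left_mono) (rule H)
      then have "ennreal (H y * (1 + norm y) powr a) \<le> ennreal (2 powr \<bar>a\<bar>) * ennreal (H y * norm y powr a)"
        by (simp add: mult_ac ennreal_leI flip: ennreal_mult')
      then show ?thesis by (simp add: add_increasing)
    qed
  qed
  also have "\<dots> = ennreal (B * 2 powr \<bar>a\<bar>) * emeasure lborel (ball (0::'a) 1)
        + ennreal (2 powr \<bar>a\<bar>) * (\<integral>\<^sup>+y. ennreal (H y * norm y powr a) \<partial>lborel)"
    by (subst nn_integral_add) (auto simp: nn_integral_cmult)
  also have "\<dots> < \<infinity>"
    using fin emeasure_lborel_ball_finite[of "0::'a" 1] by (simp add: ennreal_mult_less_top)
  finally show ?thesis .
qed

lemma matrix_isometric_coords:
  fixes f :: "real ^ 'k \<Rightarrow> real ^ 'd"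
  assumes "isometric_coords f V"
  obtains M where "f = (*v) M" "inj ((*v) M)"
proof
  have "linear f" using assms by (simp add: isometric_coords_def)
  then show eq: "f = (*v) (matrix f)" by (rule matrix_vector_mul(2)[symmetric])
  show "inj ((*v) (matrix f))" using isometric_coords_inj[OF assms] unfolding eq[symmetric] .
qed

text \<open>The exponent u/\<theta> - k is that of the energy in dimension k, and
  \<open>u > 0\<close> makes it exceed -k, so the singularity at the origin is harmless. Each V lies
  in one of countably many pieces (e, n); the isometry onto V and the chart matrix differ by an
  invertible T, which preserves divergence and, up to constants, the weight.\<close>

theorem exceptional_subspaces_null:
  fixes \<mu> :: "(real ^ 'd) measure" and \<iota> :: "(real ^ 'd) set \<Rightarrow> real ^ 'k \<Rightarrow> real ^ 'd"
  assumes \<mu>: "\<mu> \<in> compact_measures UNIV" and \<theta>: "0 < \<theta>" "\<theta> \<le> 1" and u: "0 < u"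
    and \<iota>: "\<And>V. V \<in> grassmannian CARD('k) \<Longrightarrow> isometric_coords (\<iota> V) V"
    and fin: "(\<integral>\<^sup>+z. ennreal (cmod (fourier_transform \<mu> z) powr (2 / \<theta>) * (1 + norm z) powr a) \<partial>lborel) < \<infinity>"
    and t: "0 < t" "u / \<theta> - real CARD('k) - a + (real CARD('k) - 1) * (real CARD('d) - real CARD('k)) < t"
  shows "hausdorff_measure t (proj_op ` {V \<in> grassmannian CARD('k).
           \<not> J_energy u \<theta> (distr \<mu> borel (coord_proj (\<iota> V) V)) < \<infinity>}) = 0"
proof -
  note fm = compact_measures_finite[OF \<mu>]
  obtain \<rho> where \<rho>: "0 \<le> \<rho>" "AE x in \<mu>. norm x \<le> \<rho>" using fm(4) by blast
  define F where "F = (\<lambda>z. cmod (fourier_transform \<mu> z) powr (2 / \<theta>))"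
  have ft[measurable]: "fourier_transform \<mu> \<in> borel_measurable borel"
    by (rule borel_measurable_fourier_transform[OF fm(1,2)])
  have F[measurable]: "F \<in> borel_measurable borel" unfolding F_def by measurable
  have F0: "0 \<le> F x" for x by (simp add: F_def)
  let ?B = "measure \<mu> (space \<mu>) powr (2 / \<theta>)"
  have FB: "F x \<le> ?B" for x
    unfolding F_def using \<theta> by (intro powr_mono2 norm_fourier_transform_le fm(1)) auto
  have finF: "(\<integral>\<^sup>+z. ennreal (F z * (1 + norm z) powr a) \<partial>lborel) < \<infinity>"
    unfolding F_def by (rule fin)
  have p: "1 \<le> 2 / \<theta>" using \<theta> by simp
  have loc: "\<exists>C\<ge>0. \<forall>x. ennreal (F x) \<le> ennreal C * (\<integral>\<^sup>+z. ennreal (F z * prod_weight (real (N + 2)) (x - z)) \<partial>lborel)" for N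
  proof -
    obtain C where "0 \<le> C" "\<And>x. ennreal (F x) \<le> ennreal C * (\<integral>\<^sup>+z. ennreal (F z * prod_weight (real (N + 2)) (x - z)) \<partial>lborel)"
      using fourier_transform_locally_constant[OF fm(1,2) \<rho>(2,1) p, of N] unfolding F_def by blast
    then show ?thesis by blast
  qed
  let ?\<sigma> = "u / \<theta> - real CARD('k)"
  let ?E = "\<lambda>(e::'k \<Rightarrow> 'd, n). (\<lambda>A. proj_op (range ((*v) A))) `
     {A \<in> graph_chart e n. (\<integral>\<^sup>+y. ennreal (F (A *v y) * (1 + norm y) powr ?\<sigma>) \<partial>lborel) = \<infinity>}"
  have "hausdorff_measure t (\<Union>p\<in>{e. inj e} \<times> UNIV. ?E p) = 0"
  proof (rule hausdorff_measure_zero_UN)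
    show "countable ({e :: 'k \<Rightarrow> 'd. inj e} \<times> (UNIV :: nat set))"
      by (rule countable_SIGMA) (auto intro: countable_finite)
    fix p assume "p \<in> {e :: 'k \<Rightarrow> 'd. inj e} \<times> (UNIV :: nat set)"
    then obtain e n where p: "p = (e, n)" "inj e" by auto
    show "hausdorff_measure t (?E p) = 0"
      unfolding p case_prod_conv
      by (rule hausdorff_measure_exceptional_chart[OF p(2) F F0 FB loc finF t])
  qed
  moreover have "proj_op ` {V \<in> grassmannian CARD('k). \<not> J_energy u \<theta> (distr \<mu> borel (coord_proj (\<iota> V) V)) < \<infinity>}
     \<subseteq> (\<Union>p\<in>{e. inj e} \<times> UNIV. ?E p)"
  proof
    fix P assume "P \<in> proj_op ` {V \<in> grassmannian CARD('k). \<not> J_energy u \<theta> (distr \<mu> borel (coord_proj (\<iota> V) V)) < \<infinity>}"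
    then obtain V where V: "P = proj_op V" "V \<in> grassmannian CARD('k)"
      and J: "\<not> J_energy u \<theta> (distr \<mu> borel (coord_proj (\<iota> V) V)) < \<infinity>" by blast
    note iso = \<iota>[OF V(2)]
    obtain M where M: "\<iota> V = (*v) M" "inj ((*v) M)" using matrix_isometric_coords[OF iso] .
    obtain e :: "'k \<Rightarrow> 'd" and n A and T T' :: "real ^ 'k ^ 'k" where
      T: "inj e" "A \<in> graph_chart e n" "T ** T' = mat 1" "T' ** T = mat 1" "M = A ** T"
      using injective_matrix_graph_chart[OF M(2)] .
    have MA: "M *v y = A *v (T *v y)" for y by (simp add: T(5) matrix_vector_mul_assoc)
    have AM: "A *v y = M *v (T' *v y)" for y unfolding MA by (simp only: matrix_vector_mul_assoc[of T] T(3) matrix_vector_mul_lid)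
    have "range ((*v) A) = range ((*v) M)"
    proof (intro equalityI subsetI)
      fix x assume "x \<in> range ((*v) A)"
      then show "x \<in> range ((*v) M)" by (auto simp: AM)
    next
      fix x assume "x \<in> range ((*v) M)"
      then show "x \<in> range ((*v) A)" by (auto simp: MA)
    qed
    moreover have "range ((*v) M) = V" using iso M(1) by (simp add: isometric_coords_def)
    ultimately have range: "V = range ((*v) A)" by simp
    have inf1: "(\<integral>\<^sup>+y. ennreal (F (M *v y) * norm y powr ?\<sigma>) \<partial>lborel) = \<infinity>"
      using J unfolding J_energy_finite_iff fourier_transform_coord_proj[OF iso fm(2)]
      by (simp add: F_def M(1) less_top[symmetric])
    have inf2: "(\<integral>\<^sup>+y. ennreal (F (M *v y) * (1 + norm y) powr ?\<sigma>) \<partial>lborel) = \<infinity>"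
      by (rule nn_integral_power_weight_infinite[OF _ F0 FB _ inf1]) (use u \<theta> in auto)
    obtain L1 where L1: "1 \<le> L1" "\<And>y. norm (T *v y) \<le> L1 * norm y" using matrix_norm_bound[of T] by blast
    obtain L2 where L2: "1 \<le> L2" "\<And>y. norm (T' *v y) \<le> L2 * norm y" using matrix_norm_bound[of T'] by blast
    define L where "L = max L1 L2"
    have L: "1 \<le> L" using L1 by (simp add: L_def)
    have comp: "(1 + norm y) powr ?\<sigma> \<le> L powr \<bar>?\<sigma>\<bar> * (1 + norm (T *v y)) powr ?\<sigma>" for y
    proof (rule powr_comparable)
      have "norm y \<le> L2 * norm (T *v y)" using L2(2)[of "T *v y"] by (simp add: matrix_vector_mul_assoc T(4))
      also have "\<dots> \<le> L * norm (T *v y)" by (intro mult_right_mono) (auto simp: L_def)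
      finally show "1 + norm y \<le> L * (1 + norm (T *v y))" using L by (simp add: distrib_left)
      have "norm (T *v y) \<le> L1 * norm y" by (rule L1)
      also have "\<dots> \<le> L * norm y" by (intro mult_right_mono) (auto simp: L_def)
      finally show "1 + norm (T *v y) \<le> L * (1 + norm y)" using L by (simp add: distrib_left)
    qed (auto simp: L add_pos_nonneg)
    have "(\<integral>\<^sup>+y. ennreal (F (M *v y) * (1 + norm y) powr ?\<sigma>) \<partial>lborel)
       \<le> (\<integral>\<^sup>+y. ennreal (L powr \<bar>?\<sigma>\<bar>) * ennreal (F (A *v (T *v y)) * (1 + norm (T *v y)) powr ?\<sigma>) \<partial>lborel)"
    proof (intro nn_integral_mono)
      fix y
      have "F (M *v y) * (1 + norm y) powr ?\<sigma> \<le> F (M *v y) * (L powr \<bar>?\<sigma>\<bar> * (1 + norm (T *v y)) powr ?\<sigma>)"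
        by (intro mult_left_mono comp F0)
      then show "ennreal (F (M *v y) * (1 + norm y) powr ?\<sigma>)
        \<le> ennreal (L powr \<bar>?\<sigma>\<bar>) * ennreal (F (A *v (T *v y)) * (1 + norm (T *v y)) powr ?\<sigma>)"
        unfolding MA by (simp add: mult_ac ennreal_leI flip: ennreal_mult')
    qed
    also have "\<dots> = ennreal (L powr \<bar>?\<sigma>\<bar>) * (\<integral>\<^sup>+y. ennreal (F (A *v (T *v y)) * (1 + norm (T *v y)) powr ?\<sigma>) \<partial>lborel)"
      by (rule nn_integral_cmult) measurable
    finally have "(\<integral>\<^sup>+y. ennreal (F (A *v (T *v y)) * (1 + norm (T *v y)) powr ?\<sigma>) \<partial>lborel) = \<infinity>"
      unfolding inf2 by (auto simp: top_unique ennreal_mult_eq_top_iff)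
    then have "(\<integral>\<^sup>+y. ennreal (F (A *v y) * (1 + norm y) powr ?\<sigma>) \<partial>lborel) = \<infinity>"
      by (rule nn_integral_lborel_matrix_infinite[OF T(3), rotated]) measurable
    then have "P \<in> ?E (e, n)" using T(2) V(1) range by auto
    then show "P \<in> (\<Union>p\<in>{e. inj e} \<times> UNIV. ?E p)" using T(1) by blast
  qed
  ultimately show ?thesis by (rule hausdorff_measure_zero_subset)
qed

section \<open>Nonnegativity of the Fourier spectrum\<close>

lemma norm_cis_minus_one_le: "cmod (cis t - 1) \<le> \<bar>t\<bar>"
proof -
  have "(cmod (cis t - 1))\<^sup>2 = 2 * (1 - cos t)"
  proof -
    have "(cos t - 1)\<^sup>2 + (sin t)\<^sup>2 = 2 * (1 - cos t)"
      using sin_cos_squared_add[of t] by (simp add: power2_eq_square algebra_simps)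
    then show ?thesis by (simp add: cmod_power2)
  qed
  also have "\<dots> \<le> \<bar>t\<bar>\<^sup>2" using one_minus_cos_le[of t] by simp
  finally show ?thesis by (rule power2_le_imp_le) simp
qed

text \<open>At 0 the transform is the total mass, and a point x of the support changes its
  contribution by at most 2 pi |z| |x| per unit of mass.\<close>

lemma fourier_transform_near_zero:
  fixes \<mu> :: "'a::euclidean_space measure"
  assumes \<mu>: "\<mu> \<in> compact_measures X"
  obtains r where "0 < r" "\<And>z. norm z < r \<Longrightarrow> measure \<mu> (space \<mu>) / 2 \<le> cmod (fourier_transform \<mu> z)"
proof -
  note fm = compact_measures_finite[OF \<mu>]
  interpret finite_measure \<mu> by (rule fm)
  note [measurable_cong] = fm(2)
  obtain \<rho> where \<rho>: "0 \<le> \<rho>" "AE x in \<mu>. norm x \<le> \<rho>" using fm(4) by blast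
  let ?m = "measure \<mu> (space \<mu>)"
  \<comment> \<open>Chosen so that 2 pi r (\<rho> + 1) = 1/2; the summand 1 avoids division by zero
    when \<rho> = 0.\<close>
  define r where "r = 1 / (4 * pi * (\<rho> + 1))"
  show ?thesis
  proof (rule that[of r])
    show r0: "0 < r" using \<rho> by (simp add: r_def)
    fix z :: 'a assume z: "norm z < r"
    have i: "integrable \<mu> (\<lambda>x. cis (2 * pi * ((- z) \<bullet> x)))"
      by (rule integrable_const_bound[of _ 1]) auto
    have "fourier_transform \<mu> z - of_real ?m = (LINT x|\<mu>. cis (2 * pi * ((- z) \<bullet> x)) - 1)"
      unfolding fourier_transform_cis using i by (simp add: scaleR_conv_of_real)
    also have "cmod \<dots> \<le> (LINT x|\<mu>. cmod (cis (2 * pi * ((- z) \<bullet> x)) - 1))" by (rule integral_norm_bound)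
    also have "\<dots> \<le> (LINT x|\<mu>. 1 / 2)"
    proof (rule integral_mono_AE)
      show "AE x in \<mu>. cmod (cis (2 * pi * ((- z) \<bullet> x)) - 1) \<le> 1 / 2" using \<rho>(2)
      proof eventually_elim
        case (elim x)
        have "cmod (cis (2 * pi * ((- z) \<bullet> x)) - 1) \<le> \<bar>2 * pi * ((- z) \<bullet> x)\<bar>" by (rule norm_cis_minus_one_le)
        also have "\<dots> = 2 * pi * \<bar>z \<bullet> x\<bar>" by (simp add: abs_mult)
        also have "\<dots> \<le> 2 * pi * (norm z * norm x)" by (intro mult_left_mono Cauchy_Schwarz_ineq2) auto
        also have "\<dots> \<le> 2 * pi * (r * (\<rho> + 1))"
          using z elim \<rho> r0 by (intro mult_left_mono mult_mono) auto
        also have "\<dots> = 1 / 2" using \<rho> by (simp add: r_def)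
        finally show ?case .
      qed
    qed (use i in auto)
    also have "\<dots> = ?m / 2" by simp
    finally have "cmod (fourier_transform \<mu> z - of_real ?m) \<le> ?m / 2" .
    moreover have "?m \<le> cmod (fourier_transform \<mu> z) + cmod (fourier_transform \<mu> z - of_real ?m)"
      using norm_triangle_ineq4[of "fourier_transform \<mu> z" "fourier_transform \<mu> z - of_real ?m"] by simp
    ultimately show "?m / 2 \<le> cmod (fourier_transform \<mu> z)" by simp
  qed
qed

text \<open>For a nonpositive exponent the integrand on the ball is at least its boundary value.
  According as \<sigma> plus the dimension is negative or positive, small or large \<open>q\<close>
  makes the bound arbitrarily large.\<close>

lemma nn_integral_norm_powr_ball_ge:
  assumes "\<sigma> \<le> 0" "0 < q"
  shows "ennreal (unit_ball_vol (real DIM('a)) * q powr (\<sigma> + real DIM('a)))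
    \<le> (\<integral>\<^sup>+z. ennreal (norm (z :: 'a::euclidean_space) powr \<sigma>) * indicator (ball 0 q) z \<partial>lborel)"
proof -
  have [measurable]: "ball (0::'a) q \<in> sets borel" by simp
  have "q powr (\<sigma> + real DIM('a)) = q powr \<sigma> * q ^ DIM('a)"
    using assms by (simp add: powr_add powr_realpow)
  then have "ennreal (unit_ball_vol (real DIM('a)) * q powr (\<sigma> + real DIM('a))) = ennreal (q powr \<sigma>) * emeasure lborel (ball (0::'a) q)"
    using assms by (simp add: emeasure_ball mult_ac flip: ennreal_mult')
  also have "\<dots> = (\<integral>\<^sup>+z. ennreal (q powr \<sigma>) * indicator (ball (0::'a) q) z \<partial>lborel)"
    by (rule nn_integral_cmult_indicator[symmetric]) simp
  also have "\<dots> \<le> (\<integral>\<^sup>+z. ennreal (norm (z :: 'a) powr \<sigma>) * indicator (ball 0 q) z \<partial>lborel)"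
  proof (rule nn_integral_mono_AE)
    show "AE z in lborel. ennreal (q powr \<sigma>) * indicator (ball (0::'a) q) z
        \<le> ennreal (norm z powr \<sigma>) * indicator (ball 0 q) z"
      using AE_lborel_singleton[of 0]
    proof eventually_elim
      case (elim z)
      have "q powr \<sigma> \<le> norm z powr \<sigma>" if "norm z < q" using that elim assms by (intro powr_mono2') auto
      then show ?case by (auto simp: indicator_def intro: ennreal_leI)
    qed
  qed
  finally show ?thesis .
qed

text \<open>For negative \<open>s\<close> the weight is not integrable at the origin, near which the
  transform stays above half of the total mass.\<close>

lemma J_energy_finite_imp_nonneg:
  fixes \<mu> :: "'a::euclidean_space measure"
  assumes \<mu>: "\<mu> \<in> compact_measures X" and \<theta>: "0 < \<theta>" and J: "J_energy s \<theta> \<mu> < \<infinity>"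
  shows "0 \<le> s"
proof (rule ccontr)
  assume "\<not> 0 \<le> s"
  then have s: "s < 0" by simp
  note fm = compact_measures_finite[OF \<mu>]
  obtain r where r: "0 < r" "\<And>z. norm z < r \<Longrightarrow> measure \<mu> (space \<mu>) / 2 \<le> cmod (fourier_transform \<mu> z)"
    using fourier_transform_near_zero[OF \<mu>] by blast
  let ?d = "real DIM('a)" and ?f = "fourier_transform \<mu>"
  define m where "m = (measure \<mu> (space \<mu>) / 2) powr (2 / \<theta>)"
  have m: "0 < m" using fm(3) by (simp add: m_def)
  define I where "I = enn2real (\<integral>\<^sup>+z. ennreal (cmod (?f z) powr (2 / \<theta>) * norm z powr (s / \<theta> - ?d)) \<partial>lborel)"
  have I: "(\<integral>\<^sup>+z. ennreal (cmod (?f z) powr (2 / \<theta>) * norm z powr (s / \<theta> - ?d)) \<partial>lborel) = ennreal I" "0 \<le> I"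
    using J unfolding J_energy_finite_iff by (auto simp: I_def)
  define v where "v = unit_ball_vol ?d"
  have v: "0 < v" by (simp add: v_def)
  have le: "m * v * q powr (s / \<theta>) \<le> I" if q: "0 < q" "q < r" for q
  proof -
    have [measurable]: "ball (0::'a) q \<in> sets borel" by simp
    have "s / \<theta> < 0" using s \<theta> by (simp add: divide_neg_pos)
    then have "s / \<theta> - ?d \<le> 0" using of_nat_0_le_iff[of "DIM('a)", where 'a=real] by linarith
    from nn_integral_norm_powr_ball_ge[OF this q(1), where 'a='a]
    have "ennreal m * ennreal (v * q powr (s / \<theta>))
      \<le> ennreal m * (\<integral>\<^sup>+z. ennreal (norm (z::'a) powr (s / \<theta> - ?d)) * indicator (ball 0 q) z \<partial>lborel)"
      by (intro mult_left_mono) (simp_all add: v_def)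
    then have "ennreal (m * v * q powr (s / \<theta>))
      \<le> ennreal m * (\<integral>\<^sup>+z. ennreal (norm (z::'a) powr (s / \<theta> - ?d)) * indicator (ball 0 q) z \<partial>lborel)"
      using m v by (simp add: mult.assoc flip: ennreal_mult')
    also have "\<dots> = (\<integral>\<^sup>+z. ennreal m * (ennreal (norm (z::'a) powr (s / \<theta> - ?d)) * indicator (ball 0 q) z) \<partial>lborel)"
      by (rule nn_integral_cmult[symmetric]) measurable
    also have "\<dots> \<le> (\<integral>\<^sup>+z. ennreal (cmod (?f z) powr (2 / \<theta>) * norm z powr (s / \<theta> - ?d)) \<partial>lborel)"
    proof (rule nn_integral_mono)
      fix z :: 'a
      have "m * norm z powr (s / \<theta> - ?d) \<le> cmod (?f z) powr (2 / \<theta>) * norm z powr (s / \<theta> - ?d)" if "norm z < q"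
        unfolding m_def using that q \<theta> by (intro mult_right_mono powr_mono2 r(2)) auto
      then show "ennreal m * (ennreal (norm z powr (s / \<theta> - ?d)) * indicator (ball 0 q) z)
        \<le> ennreal (cmod (?f z) powr (2 / \<theta>) * norm z powr (s / \<theta> - ?d))"
        using m by (auto simp: indicator_def ennreal_mult'[symmetric] intro!: ennreal_leI)
    qed
    finally have "ennreal (m * v * q powr (s / \<theta>)) \<le> ennreal I" unfolding I .
    then show ?thesis using I(2) by simp
  qed
  \<comment> \<open>The second entry solves m v q^(s/\<theta>) = I + 1, which contradicts the bound
    \<open>I\<close>; the minimum with r / 2 can only increase the left side, the exponent being
    negative.\<close>
  define q where "q = min (r / 2) (((I + 1) / (m * v)) powr (\<theta> / s))"
  have q: "0 < q" "q < r" using r I m v by (auto simp: q_def min_def)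
  have "q powr (s / \<theta>) \<ge> (((I + 1) / (m * v)) powr (\<theta> / s)) powr (s / \<theta>)"
    using q s \<theta> by (intro powr_mono2') (auto simp: q_def divide_nonpos_pos)
  also have "(((I + 1) / (m * v)) powr (\<theta> / s)) powr (s / \<theta>) = (I + 1) / (m * v)"
    using s \<theta> I m v by (simp add: powr_powr)
  finally have "I + 1 \<le> m * v * q powr (s / \<theta>)" using m v by (simp add: divide_le_eq mult.commute)
  with le[OF q] show False by simp
qed

lemma fourier_spectrum_measure_nonneg:
  fixes \<mu> :: "'a::euclidean_space measure"
  assumes "\<mu> \<in> compact_measures X" "0 < \<theta>"
  shows "0 \<le> fourier_spectrum_measure \<theta> \<mu>"
proof (cases "{ereal s |s. J_energy s \<theta> \<mu> < \<infinity>} = {}")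
  case False
  then obtain s where s: "J_energy s \<theta> \<mu> < \<infinity>" by blast
  have "0 \<le> ereal s" using J_energy_finite_imp_nonneg[OF assms s] by simp
  also have "\<dots> \<le> Sup {ereal s |s. J_energy s \<theta> \<mu> < \<infinity>}" using s by (intro Sup_upper) auto
  finally show ?thesis using False by (simp add: fourier_spectrum_measure_def Sup0_def)
qed (simp add: fourier_spectrum_measure_def Sup0_def)

text \<open>For \<open>t\<close> above the claimed bound there is an exponent \<open>a\<close> with
  finite weighted integral and k(d-k) + u/\<theta> - (a + d) < t, in general a = s/\<theta> - d for
  an order s close to the spectrum; then the exceptional set is null for the exponent
  \<open>t\<close>.\<close>

lemma grassmannian_dim_exceptional_le:
  fixes \<mu> :: "(real ^ 'd) measure" and \<iota> :: "(real ^ 'd) set \<Rightarrow> real ^ 'k \<Rightarrow> real ^ 'd"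
  assumes \<mu>: "\<mu> \<in> compact_measures UNIV" and \<theta>: "0 < \<theta>" "\<theta> \<le> 1" and u: "0 \<le> u"
    and \<iota>: "\<And>V. V \<in> grassmannian CARD('k) \<Longrightarrow> isometric_coords (\<iota> V) V"
  shows "grassmannian_dim {V \<in> grassmannian CARD('k).
           fourier_spectrum_measure \<theta> (distr \<mu> borel (coord_proj (\<iota> V) V)) < ereal u}
    \<le> max 0 (ereal (real CARD('k) * (real CARD('d) - real CARD('k)))
              + (ereal u - fourier_spectrum_measure \<theta> \<mu>) / ereal \<theta>)"
    (is "grassmannian_dim ?E \<le> max 0 (ereal ?c + (ereal u - ?D) / ereal \<theta>)")
proof (cases "u = 0")
  case True
  \<comment> \<open>For \<open>u = 0\<close> the exceptional set is empty, since push-forwards have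
    nonnegative spectrum.\<close>
  have "0 \<le> fourier_spectrum_measure \<theta> (distr \<mu> borel (coord_proj (\<iota> V) V))" if "V \<in> grassmannian CARD('k)" for V
    by (rule fourier_spectrum_measure_nonneg[OF distr_compact_measures[OF \<mu> continuous_on_coord_proj[OF \<iota>[OF that]]] \<theta>(1)])
  then have E: "?E = {}" using True by (auto simp: zero_ereal_def not_less)
  show ?thesis unfolding E by (simp add: grassmannian_dim_def hausdorff_dim_empty)
next
  case False
  then have u: "0 < u" using u by simp
  note fm = compact_measures_finite[OF \<mu>]
  define F where "F = (\<lambda>z. cmod (fourier_transform \<mu> z) powr (2 / \<theta>))"
  have [measurable]: "fourier_transform \<mu> \<in> borel_measurable borel"
    by (rule borel_measurable_fourier_transform[OF fm(1,2)])
  have Fm: "F \<in> borel_measurable borel" unfolding F_def by measurable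
  have F0: "0 \<le> F x" for x by (simp add: F_def)
  have FB: "F x \<le> measure \<mu> (space \<mu>) powr (2 / \<theta>)" for x
    unfolding F_def using \<theta> by (intro powr_mono2 norm_fourier_transform_le fm(1)) auto
  show ?thesis unfolding grassmannian_dim_def
  proof (rule hausdorff_dim_leI)
    fix t :: real assume t: "0 < t" "ereal ?c + (ereal u - ?D) / ereal \<theta> < ereal t"
    have "\<exists>a. (\<integral>\<^sup>+z. ennreal (F z * (1 + norm z) powr a) \<partial>lborel) < \<infinity> \<and> ?c + u / \<theta> - (a + real CARD('d)) < t"
    proof (cases "{ereal s |s. J_energy s \<theta> \<mu> < \<infinity>} = {}")
      case True
      then have "?D = 0" by (simp add: fourier_spectrum_measure_def Sup0_def)
      then have t': "?c + u / \<theta> < t" using t(2) \<theta> by simp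
      define \<eta> where "\<eta> = (t - (?c + u / \<theta>)) / 2"
      have \<eta>: "0 < \<eta>" using t' by (simp add: \<eta>_def)
      \<comment> \<open>No energy is finite, so the spectrum is 0 by convention and the bound is
        k(d-k) + u/\<theta>. Boundedness of \<open>F\<close> gives a finite integral for every
        exponent below -d, which corresponds to orders just below 0.\<close>
      let ?a = "- real CARD('d) - \<eta>"
      have "(\<integral>\<^sup>+z. ennreal (F z * (1 + norm z) powr ?a) \<partial>lborel)
         \<le> (\<integral>\<^sup>+z. ennreal (measure \<mu> (space \<mu>) powr (2 / \<theta>)) * ennreal ((1 + norm (z :: real ^ 'd)) powr ?a) \<partial>lborel)"
        by (intro nn_integral_mono) (simp add: ennreal_leI mult_right_mono FB flip: ennreal_mult')
      also have "\<dots> = ennreal (measure \<mu> (space \<mu>) powr (2 / \<theta>)) * (\<integral>\<^sup>+z. ennreal ((1 + norm (z :: real ^ 'd)) powr ?a) \<partial>lborel)"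
        by (rule nn_integral_cmult) measurable
      also have "\<dots> < \<infinity>"
        using nn_integral_one_plus_norm_powr_finite[where 'a="real ^ 'd", of ?a] \<eta> by (simp add: ennreal_mult_less_top)
      finally have "(\<integral>\<^sup>+z. ennreal (F z * (1 + norm z) powr ?a) \<partial>lborel) < \<infinity>" .
      moreover have "?c + u / \<theta> - (?a + real CARD('d)) < t"
      proof -
        have "?c + u / \<theta> + \<eta> < t" using t' by (simp add: \<eta>_def field_simps)
        then show ?thesis by simp
      qed
      ultimately show ?thesis by blast
    next
      case False
      then have D: "?D = Sup {ereal s |s. J_energy s \<theta> \<mu> < \<infinity>}"
        unfolding fourier_spectrum_measure_def Sup0_def by (rule if_not_P)
      have "0 \<le> ?D" by (rule fourier_spectrum_measure_nonneg[OF \<mu> \<theta>(1)])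
      \<comment> \<open>The condition k(d-k) + (u - s)/\<theta> < t solved for the order s; an
        infinite spectrum satisfies it trivially.\<close>
      then have "ereal (u - \<theta> * (t - ?c)) < ?D"
      proof (cases ?D)
        case (real r)
        then have "?c + (u - r) / \<theta> < t" using t(2) \<theta> by simp
        then have "(u - r) / \<theta> < t - ?c" by simp
        then have "u - r < (t - ?c) * \<theta>" using \<theta> by (simp add: pos_divide_less_eq)
        then show ?thesis using real by (simp add: mult.commute)
      qed auto
      then obtain s where s: "J_energy s \<theta> \<mu> < \<infinity>" "u - \<theta> * (t - ?c) < s"
        unfolding D less_Sup_iff by auto
      let ?a = "s / \<theta> - real CARD('d)"
      have "(\<integral>\<^sup>+z. ennreal (F z * norm z powr ?a) \<partial>lborel) < \<infinity>"
        using s(1) unfolding J_energy_finite_iff F_def by simp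
      then have "(\<integral>\<^sup>+z. ennreal (F z * (1 + norm z) powr ?a) \<partial>lborel) < \<infinity>"
        by (rule nn_integral_one_plus_weight_finite[OF Fm F0 FB])
      moreover have "?c + u / \<theta> - (?a + real CARD('d)) < t"
      proof -
        have "(u - s) / \<theta> < t - ?c" using s(2) \<theta> by (simp add: pos_divide_less_eq mult.commute)
        then show ?thesis by (simp add: diff_divide_distrib)
      qed
      ultimately show ?thesis by blast
    qed
    then obtain a where a: "(\<integral>\<^sup>+z. ennreal (F z * (1 + norm z) powr a) \<partial>lborel) < \<infinity>"
      "?c + u / \<theta> - (a + real CARD('d)) < t" by blast
    \<comment> \<open>Writing -k - a as (d - k) - (a + d) supplies one more d - k, so that (k - 1)(d
      - k) becomes k(d - k).\<close>
    have "u / \<theta> - real CARD('k) - a + (real CARD('k) - 1) * (real CARD('d) - real CARD('k)) = ?c + u / \<theta> - (a + real CARD('d))"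
      by (simp add: algebra_simps)
    then have t': "u / \<theta> - real CARD('k) - a + (real CARD('k) - 1) * (real CARD('d) - real CARD('k)) < t"
      using a(2) by simp
    have null: "hausdorff_measure t (proj_op ` {V \<in> grassmannian CARD('k).
           \<not> J_energy u \<theta> (distr \<mu> borel (coord_proj (\<iota> V) V)) < \<infinity>}) = 0"
      by (rule exceptional_subspaces_null[OF \<mu> \<theta> u \<iota> a(1)[unfolded F_def] t(1) t'])
    have "?E \<subseteq> {V \<in> grassmannian CARD('k). \<not> J_energy u \<theta> (distr \<mu> borel (coord_proj (\<iota> V) V)) < \<infinity>}"
    proof (intro subsetI CollectI conjI notI)
      fix V assume V: "V \<in> ?E"
      then show "V \<in> grassmannian CARD('k)" by simp
      let ?\<nu> = "distr \<mu> borel (coord_proj (\<iota> V) V)"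
      assume J: "J_energy u \<theta> ?\<nu> < \<infinity>"
      then have "ereal u \<le> Sup {ereal s |s. J_energy s \<theta> ?\<nu> < \<infinity>}" by (intro Sup_upper) auto
      also have "\<dots> = fourier_spectrum_measure \<theta> ?\<nu>"
        using J by (auto simp: fourier_spectrum_measure_def Sup0_def)
      finally have "ereal u \<le> fourier_spectrum_measure \<theta> ?\<nu>" .
      moreover have "fourier_spectrum_measure \<theta> ?\<nu> < ereal u" using V by blast
      ultimately show False by (rule leD[THEN notE])
    qed
    then show "hausdorff_measure t (proj_op ` ?E) = 0"
      by (intro hausdorff_measure_zero_subset[OF null] image_mono)
  qed
qed

section \<open>Point masses and the dimension of the whole Grassmannian\<close>

definition dirac :: "'a::euclidean_space \<Rightarrow> 'a measure" where
  "dirac x = distr (count_space (UNIV :: unit set)) borel (\<lambda>_. x)"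

lemma emeasure_dirac: "A \<in> sets borel \<Longrightarrow> emeasure (dirac x) A = indicator A x"
  unfolding dirac_def by (subst emeasure_distr) (auto simp: indicator_def)

lemma integral_dirac:
  fixes h :: "'a::euclidean_space \<Rightarrow> complex"
  assumes "h \<in> borel_measurable borel"
  shows "integral\<^sup>L (dirac x) h = h x"
  unfolding dirac_def using assms
  by (subst integral_distr) (auto simp: lebesgue_integral_count_space_finite UNIV_unit)

text \<open>Point masses guarantee that the supremum defining the spectrum of a nonempty set runs
  over a nonempty family.\<close>

lemma dirac_compact_measures:
  assumes "x \<in> X"
  shows "dirac x \<in> compact_measures X"
proof -
  have "msupport (dirac x) = {x}"
  proof (intro equalityI subsetI)
    fix y assume y: "y \<in> msupport (dirac x)"
    show "y \<in> {x}"
    proof (rule ccontr)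
      assume "y \<notin> {x}"
      then have "0 < emeasure (dirac x) (- {x})" using y by (auto simp: msupport_def open_Compl)
      then show False by (simp add: emeasure_dirac)
    qed
  qed (auto simp: msupport_def emeasure_dirac)
  then show ?thesis using assms by (simp add: compact_measures_def emeasure_dirac) (simp add: dirac_def)
qed

lemma hausdorff_dim_mono: "A \<subseteq> B \<Longrightarrow> hausdorff_dim A \<le> hausdorff_dim B"
  unfolding hausdorff_dim_def by (intro Inf_superset_mono) (auto intro: hausdorff_measure_zero_subset)

lemma compact_measures_mono: "X \<subseteq> Y \<Longrightarrow> compact_measures X \<subseteq> compact_measures Y"
  by (auto simp: compact_measures_def)

lemma grassmannian_dim_mono: "A \<subseteq> B \<Longrightarrow> grassmannian_dim A \<le> grassmannian_dim B"
  unfolding grassmannian_dim_def by (intro hausdorff_dim_mono image_mono)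

lemma fourier_spectrum_set_empty: "fourier_spectrum_set \<theta> {} = 0"
proof -
  have "compact_measures ({} :: 'a::euclidean_space set) = {}"
  proof (rule ccontr)
    assume "compact_measures ({} :: 'a set) \<noteq> {}"
    then obtain \<mu> :: "'a measure" where \<mu>: "\<mu> \<in> compact_measures {}" by blast
    note fm = compact_measures_finite[OF \<mu>]
    have "msupport \<mu> = {}" using \<mu> by (auto simp: compact_measures_def)
    then have "emeasure \<mu> UNIV = 0" using null_sets_Compl_msupport[OF fm(2)] by auto
    then show False using \<mu> by (simp add: compact_measures_def)
  qed
  then show ?thesis by (simp add: fourier_spectrum_set_def Sup0_def)
qed

text \<open>The point mass at 0 projects to a point mass on every subspace, whose transform is
  constant and whose energies of positive order are infinite. Hence every subspace is exceptional
  for it. This serves the empty set, on which no measure is at hand.\<close>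

lemma grassmannian_dim_le:
  assumes \<iota>: "\<And>V. V \<in> grassmannian CARD('k) \<Longrightarrow> isometric_coords (\<iota> V :: real ^ 'k \<Rightarrow> real ^ 'd) V"
    and u: "0 < u"
  shows "grassmannian_dim (grassmannian CARD('k) :: (real ^ 'd) set set)
    \<le> max 0 (ereal (real CARD('k) * (real CARD('d) - real CARD('k))) + ereal u)"
  unfolding grassmannian_dim_def
proof (rule hausdorff_dim_leI)
  let ?c = "real CARD('k) * (real CARD('d) - real CARD('k))" and ?k = "real CARD('k)"
  fix t :: real assume t: "0 < t" "ereal ?c + ereal u < ereal t"
  define \<mu> where "\<mu> = dirac (0 :: real ^ 'd)"
  have \<mu>: "\<mu> \<in> compact_measures UNIV" unfolding \<mu>_def by (rule dirac_compact_measures) simp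
  have ft: "fourier_transform \<mu> z = 1" for z
    unfolding fourier_transform_cis \<mu>_def by (subst integral_dirac) auto
  \<comment> \<open>At most \<open>?k\<close>, so that the exponent s - k is nonpositive and the
    lower bound over balls applies.\<close>
  define s where "s = min u ?k"
  have s: "0 < s" "s \<le> u" "s \<le> ?k" using u by (auto simp: s_def)
  define \<eta> where "\<eta> = (t - (?c + u)) / 2"
  have \<eta>: "0 < \<eta>" "?c + u + \<eta> < t" using t(2) by (auto simp: \<eta>_def field_simps)
  let ?a = "- real CARD('d) - \<eta>"
  have "hausdorff_measure t (proj_op ` {V \<in> grassmannian CARD('k).
           \<not> J_energy s 1 (distr \<mu> borel (coord_proj (\<iota> V) V)) < \<infinity>}) = 0"
  proof (rule exceptional_subspaces_null[OF \<mu> _ _ s(1) \<iota>, where a = ?a])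
    show "(\<integral>\<^sup>+z. ennreal (cmod (fourier_transform \<mu> z) powr (2 / 1) * (1 + norm z) powr ?a) \<partial>lborel) < \<infinity>"
      using nn_integral_one_plus_norm_powr_finite[where 'a="real ^ 'd", of ?a] \<eta> by (simp add: ft)
    have "s / 1 - ?k - ?a + (?k - 1) * (real CARD('d) - ?k) = ?c + s + \<eta>" by (simp add: algebra_simps)
    then show "s / 1 - ?k - ?a + (?k - 1) * (real CARD('d) - ?k) < t" using \<eta> s by simp
  qed (use t in auto)
  moreover have "\<not> J_energy s 1 (distr \<mu> borel (coord_proj (\<iota> V) V)) < \<infinity>" if V: "V \<in> grassmannian CARD('k)" for V
  proof
    assume "J_energy s 1 (distr \<mu> borel (coord_proj (\<iota> V) V)) < \<infinity>"
    moreover have "fourier_transform (distr \<mu> borel (coord_proj (\<iota> V) V)) z = 1" for z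
      using fourier_transform_coord_proj[OF \<iota>[OF V], of \<mu> z] compact_measures_finite(2)[OF \<mu>] by (simp add: ft)
    ultimately have fin: "(\<integral>\<^sup>+z. ennreal (norm (z :: real ^ 'k) powr (s - ?k)) \<partial>lborel) < \<infinity>"
      unfolding J_energy_finite_iff by simp
    define I where "I = enn2real (\<integral>\<^sup>+z. ennreal (norm (z :: real ^ 'k) powr (s - ?k)) \<partial>lborel)"
    have I: "(\<integral>\<^sup>+z. ennreal (norm (z :: real ^ 'k) powr (s - ?k)) \<partial>lborel) = ennreal I" "0 \<le> I"
      using fin by (auto simp: I_def)
    define v where "v = unit_ball_vol ?k"
    have v: "0 < v" by (simp add: v_def)
    \<comment> \<open>A radius with v q^s = I + 1, beyond the supposed value \<open>I\<close> of the
      integral.\<close>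
    define q where "q = ((I + 1) / v) powr (1 / s)"
    have q: "0 < q" "q powr s = (I + 1) / v" using I v s by (auto simp: q_def powr_powr)
    have "ennreal (v * q powr s) \<le> (\<integral>\<^sup>+z. ennreal (norm (z :: real ^ 'k) powr (s - ?k)) * indicator (ball 0 q) z \<partial>lborel)"
      using nn_integral_norm_powr_ball_ge[of "s - ?k" q, where 'a="real ^ 'k"] s q by (simp add: v_def)
    also have "\<dots> \<le> (\<integral>\<^sup>+z. ennreal (norm (z :: real ^ 'k) powr (s - ?k)) \<partial>lborel)"
      by (intro nn_integral_mono) (simp add: indicator_def)
    also have "\<dots> = ennreal I" by (rule I)
    finally have "v * q powr s \<le> I" using I by simp
    then show False using q v by simp
  qed
  then have "{V \<in> grassmannian CARD('k). \<not> J_energy s 1 (distr \<mu> borel (coord_proj (\<iota> V) V)) < \<infinity>} = grassmannian CARD('k)"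
    by blast
  ultimately show "hausdorff_measure t (proj_op ` (grassmannian CARD('k) :: (real ^ 'd) set set)) = 0" by simp
qed

theorem theorem5p1:
  fixes \<theta> :: real
    and \<iota> :: "(real ^ 'd) set \<Rightarrow> real ^ 'k \<Rightarrow> real ^ 'd"
  assumes "CARD('k) < CARD('d)"
    and "0 < \<theta>" and "\<theta> \<le> 1"
    and "\<And>V. V \<in> grassmannian CARD('k) \<Longrightarrow> isometric_coords (\<iota> V) V"
  shows "(\<forall>\<mu> \<in> compact_measures (UNIV :: (real ^ 'd) set). \<forall>u::real. 0 \<le> u \<longrightarrow>
            grassmannian_dim {V \<in> grassmannian CARD('k).
                fourier_spectrum_measure \<theta> (distr \<mu> borel (coord_proj (\<iota> V) V)) < ereal u}
            \<le> max 0 (ereal (real CARD('k) * (real CARD('d) - real CARD('k)))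
                     + (ereal u - fourier_spectrum_measure \<theta> \<mu>) / ereal \<theta>))
       \<and> (\<forall>X :: (real ^ 'd) set. X \<in> sets borel \<longrightarrow> (\<forall>u::real. 0 \<le> u \<and> u \<le> real CARD('k) \<longrightarrow>
            grassmannian_dim {V \<in> grassmannian CARD('k).
                fourier_spectrum_set \<theta> (coord_proj (\<iota> V) V ` X) < ereal u}
            \<le> max 0 (ereal (real CARD('k) * (real CARD('d) - real CARD('k)))
                     + (ereal u - fourier_spectrum_set \<theta> X) / ereal \<theta>)))"
proof (intro conjI ballI allI impI)
  fix \<mu> :: "(real ^ 'd) measure" and u :: real
  assume "\<mu> \<in> compact_measures UNIV" "0 \<le> u"
  then show "grassmannian_dim {V \<in> grassmannian CARD('k).
                fourier_spectrum_measure \<theta> (distr \<mu> borel (coord_proj (\<iota> V) V)) < ereal u}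
            \<le> max 0 (ereal (real CARD('k) * (real CARD('d) - real CARD('k)))
                     + (ereal u - fourier_spectrum_measure \<theta> \<mu>) / ereal \<theta>)"
    by (intro grassmannian_dim_exceptional_le assms)
next
  fix X :: "(real ^ 'd) set" and u :: real
  assume u: "0 \<le> u \<and> u \<le> real CARD('k)"
  let ?c = "real CARD('k) * (real CARD('d) - real CARD('k))" and ?D = "fourier_spectrum_set \<theta> X"
  let ?E = "{V \<in> grassmannian CARD('k). fourier_spectrum_set \<theta> (coord_proj (\<iota> V) V ` X) < ereal u}"
  show "grassmannian_dim ?E \<le> max 0 (ereal ?c + (ereal u - ?D) / ereal \<theta>)"
  proof (cases "X = {}")
    case True
    show ?thesis
    proof (cases "u = 0")
      case True
      then have E: "?E = {}" using \<open>X = {}\<close> by (simp add: fourier_spectrum_set_empty zero_ereal_def)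
      show ?thesis unfolding E by (simp add: grassmannian_dim_def hausdorff_dim_empty)
    next
      case False
      \<comment> \<open>Projections of the empty set are empty and have spectrum 0, so every
        subspace is exceptional and the bound for the whole Grassmannian is applied with the excess
        u/\<theta>.\<close>
      then have "0 < u / \<theta>" using u assms(2) by simp
      have "grassmannian_dim ?E \<le> grassmannian_dim (grassmannian CARD('k) :: (real ^ 'd) set set)"
        by (rule grassmannian_dim_mono) auto
      also have "\<dots> \<le> max 0 (ereal ?c + ereal (u / \<theta>))"
        by (rule grassmannian_dim_le[OF assms(4) \<open>0 < u / \<theta>\<close>])
      also have "ereal (u / \<theta>) = (ereal u - ?D) / ereal \<theta>"
        using True assms(2) by (simp add: fourier_spectrum_set_empty)
      finally show ?thesis .
    qed
  next
    case False
    let ?S = "{min (fourier_spectrum_measure \<theta> \<mu>) (ereal (real DIM(real ^ 'd))) |\<mu>. \<mu> \<in> compact_measures X}"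
    obtain x where "x \<in> X" using False by blast
    then have ne: "?S \<noteq> {}" using dirac_compact_measures by blast
    then have D: "?D = Sup ?S" by (simp add: fourier_spectrum_set_def Sup0_def)
    have "?D \<le> ereal (real CARD('d))" unfolding D by (rule Sup_least) auto
    moreover have "0 \<le> ?D"
    proof -
      obtain s where s: "s \<in> ?S" using ne by blast
      then have "0 \<le> s" using fourier_spectrum_measure_nonneg[OF _ assms(2)] by (auto simp: zero_ereal_def)
      also have "s \<le> ?D" unfolding D using s by (rule Sup_upper)
      finally show ?thesis .
    qed
    \<comment> \<open>The truncation at d makes the spectrum of the set a real number, so that the
      arithmetic with \<open>?D\<close> is free of infinite values.\<close>
    ultimately obtain \<delta> where \<delta>: "?D = ereal \<delta>" by (cases ?D) auto
    have le: "grassmannian_dim ?E \<le> max 0 (ereal ?c + (ereal u - fourier_spectrum_measure \<theta> \<mu>) / ereal \<theta>)"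
      if \<mu>: "\<mu> \<in> compact_measures X" for \<mu>
    proof -
      \<comment> \<open>The push-forward of \<open>\<mu>\<close> lives on the projection of
        \<open>X\<close>, so its truncated spectrum is below \<open>u\<close>; as u \<le> k, it is
        not the cut-off value k that lies below \<open>u\<close>.\<close>
      have "?E \<subseteq> {V \<in> grassmannian CARD('k).
                fourier_spectrum_measure \<theta> (distr \<mu> borel (coord_proj (\<iota> V) V)) < ereal u}"
      proof (intro subsetI CollectI conjI)
        fix V assume V: "V \<in> ?E"
        then show G: "V \<in> grassmannian CARD('k)" by simp
        let ?\<nu> = "distr \<mu> borel (coord_proj (\<iota> V) V)"
        have \<nu>: "?\<nu> \<in> compact_measures (coord_proj (\<iota> V) V ` X)"
          by (rule distr_compact_measures[OF \<mu> continuous_on_coord_proj[OF assms(4)[OF G]]])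
        have "min (fourier_spectrum_measure \<theta> ?\<nu>) (ereal (real CARD('k))) \<le> fourier_spectrum_set \<theta> (coord_proj (\<iota> V) V ` X)"
          unfolding fourier_spectrum_set_def Sup0_def using \<nu> by (auto intro!: Sup_upper)
        also have "\<dots> < ereal u" using V by simp
        finally show "fourier_spectrum_measure \<theta> ?\<nu> < ereal u" using u by (auto simp: min_less_iff_disj)
      qed
      then have "grassmannian_dim ?E \<le> grassmannian_dim {V \<in> grassmannian CARD('k).
                fourier_spectrum_measure \<theta> (distr \<mu> borel (coord_proj (\<iota> V) V)) < ereal u}"
        by (rule grassmannian_dim_mono)
      also have "\<dots> \<le> max 0 (ereal ?c + (ereal u - fourier_spectrum_measure \<theta> \<mu>) / ereal \<theta>)"
        using compact_measures_mono[of X UNIV] \<mu> u by (intro grassmannian_dim_exceptional_le assms) auto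
      finally show ?thesis .
    qed
    show ?thesis
    proof (rule dense_ge)
      fix z assume "max 0 (ereal ?c + (ereal u - ?D) / ereal \<theta>) < z"
      then obtain t where t: "max 0 (ereal ?c + (ereal u - ?D) / ereal \<theta>) < ereal t" "ereal t < z"
        using ereal_dense2 by blast
      then have "0 < t" "?c + (u - \<delta>) / \<theta> < t" using assms(2) by (auto simp: \<delta>)
      then have "(u - \<delta>) / \<theta> < t - ?c" by simp
      then have "ereal (u - \<theta> * (t - ?c)) < ?D" using assms(2) by (simp add: \<delta> pos_divide_less_eq mult.commute)
      \<comment> \<open>A measure on \<open>X\<close> whose spectrum is nearly \<open>?D\<close>;
        the slack between the bound and \<open>t\<close> is the tolerance.\<close>
      then obtain \<mu> where \<mu>: "\<mu> \<in> compact_measures X" "ereal (u - \<theta> * (t - ?c)) < fourier_spectrum_measure \<theta> \<mu>"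
        unfolding D less_Sup_iff by auto
      have "ereal ?c + (ereal u - fourier_spectrum_measure \<theta> \<mu>) / ereal \<theta> \<le> ereal t"
      proof (cases "fourier_spectrum_measure \<theta> \<mu>")
        case (real r)
        then have "u - r \<le> (t - ?c) * \<theta>" using \<mu>(2) by (simp add: mult.commute)
        then have "(u - r) / \<theta> \<le> t - ?c" using assms(2) by (simp add: pos_divide_le_eq)
        then show ?thesis using real assms(2) by simp
      qed (use \<mu>(2) assms(2) in auto)
      then have "grassmannian_dim ?E \<le> ereal t" using le[OF \<mu>(1)] \<open>0 < t\<close> by (auto intro: order_trans)
      then show "grassmannian_dim ?E \<le> z" using t by simp
    qed
  qed
qed

end
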